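(* Let $t\ge s\ge1$ be integers, $\mathbf S\sim\mathbf W_s(t,\mathbf I_s,\mathbf\Omega)$, and suppose $\mathbf\Omega$ has exactly $L\le s$ non-zero eigenvalues, distinct, $\lambda_1>\dots>\lambda_L>0$. Let $\phi_1$ be the largest eigenvalue of $\mathbf S$. For $x\in(0,\infty)$ define the $s\times s$ matrix $\mathbf\Xi(x)$ by $$\{\mathbf\Xi(x)\}_{i,j}=\begin{cases}2^{(2i-s-t)/2}\Big[Q_{s+t-2i+1,\,t-s}\big(\sqrt{2\lambda_j},0\big)-Q_{s+t-2i+1,\,t-s}\big(\sqrt{2\lambda_j},\sqrt{2x}\big)\Big], & j=1,\dots,L,\\ \gamma(t+s-i-j+1,x), & j=L+1,\dots,s,\end{cases}$$ and let $\mathbf\Psi(0)$ be the $s\times s$ matrix with $\{\mathbf\Psi(0)\}_{i,j}=2^{(2i-s-t)/2}Q_{s+t-2i+1,t-s}(\sqrt{2\lambda_j},0)$ for $j\le L$ and $\{\mathbf\Psi(0)\}_{i,j}=(t+s-i-j)!$ for $j>L$. Then the c.d.f.\ of $\phi_1$ is $$F_{\phi_1}(x)=\frac{|\mathbf\Xi(x)|}{|\mathbf\Psi(0)|}.$$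
   Context: Complex noncentral Wishart: $\mathbf S=\mathbf X\mathbf X^\dagger$ where $\mathbf X$ is an $s\times t$ complex random matrix with independent entries $\{\mathbf X\}_{ij}\sim\mathcal{CN}(\{\mathbf M\}_{ij},1)$ and $\mathbf\Omega=\mathbf M\mathbf M^\dagger$; denoted $\mathbf W_s(t,\mathbf I_s,\mathbf\Omega)$. Nuttall $Q$-function: $Q_{p,q}(a,b)=\int_b^\infty x^p\exp\!\big(-\tfrac{x^2+a^2}{2}\big)I_q(ax)\,\mathrm dx$, with $I_q$ the modified Bessel function of the first kind. Lower incomplete gamma function: $\gamma(p,x)=\int_0^x u^{p-1}e^{-u}\,\mathrm du$. *)

theory Defs
  imports "HOL-Probability.Probability" "Jordan_Normal_Form.Schur_Decomposition"
          "Jordan_Normal_Form.Char_Poly"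
begin

definition besselI :: "nat \<Rightarrow> real \<Rightarrow> real" where
  "besselI q z = (\<Sum>m. (z / 2) ^ (2 * m + q) / (fact m * fact (m + q)))"

definition nuttallQ :: "nat \<Rightarrow> nat \<Rightarrow> real \<Rightarrow> real \<Rightarrow> real" where
  "nuttallQ p q a b =
     (LBINT x:{b..}. x ^ p * exp (- (x\<^sup>2 + a\<^sup>2) / 2) * besselI q (a * x))"

definition lower_gamma :: "nat \<Rightarrow> real \<Rightarrow> real" where
  "lower_gamma p x = (LBINT u:{0..x}. u ^ (p - 1) * exp (- u))"

definition cgauss :: "complex \<Rightarrow> complex measure" where
  "cgauss m = density lborel (\<lambda>z. ennreal (exp (- (cmod (z - m))\<^sup>2) / pi))"

definition gauss_matrix_measure :: "nat \<Rightarrow> nat \<Rightarrow> complex mat \<Rightarrow> (nat \<times> nat \<Rightarrow> complex) measure" where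
  "gauss_matrix_measure s t M = PiM ({..<s} \<times> {..<t}) (\<lambda>(i,j). cgauss (M $$ (i,j)))"

definition to_mat :: "nat \<Rightarrow> nat \<Rightarrow> (nat \<times> nat \<Rightarrow> complex) \<Rightarrow> complex mat" where
  "to_mat s t X = mat s t X"

text \<open>Largest eigenvalue of a (Hermitian, hence real-spectrum) complex matrix.\<close>
definition largest_eigenvalue :: "complex mat \<Rightarrow> real" where
  "largest_eigenvalue A = Max {r :: real. eigenvalue A (complex_of_real r)}"

definition Xi_mat :: "nat \<Rightarrow> nat \<Rightarrow> nat \<Rightarrow> (nat \<Rightarrow> real) \<Rightarrow> real \<Rightarrow> real mat" where
  "Xi_mat s t L lam x = mat s s (\<lambda>(i0, j0). let i = i0 + 1; j = j0 + 1 in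
     if j \<le> L then
       2 powr ((2 * real i - real s - real t) / 2) *
         (nuttallQ (s + t - 2 * i + 1) (t - s) (sqrt (2 * lam j)) 0
          - nuttallQ (s + t - 2 * i + 1) (t - s) (sqrt (2 * lam j)) (sqrt (2 * x)))
     else lower_gamma (t + s - i - j + 1) x)"

definition Psi0_mat :: "nat \<Rightarrow> nat \<Rightarrow> nat \<Rightarrow> (nat \<Rightarrow> real) \<Rightarrow> real mat" where
  "Psi0_mat s t L lam = mat s s (\<lambda>(i0, j0). let i = i0 + 1; j = j0 + 1 in
     if j \<le> L then
       2 powr ((2 * real i - real s - real t) / 2) *
         nuttallQ (s + t - 2 * i + 1) (t - s) (sqrt (2 * lam j)) 0
     else fact (t + s - i - j))"

end

theory Submission
  imports Defs
begin

text \<open>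
  For a polynomial \<open>f\<close> in complex Gaussian variables and their conjugates, Euler's identity and
  Gaussian integration by parts express \<open>d \<cdot> E f\<close>, for \<open>f\<close> homogeneous of degree \<open>d\<close>, by \<open>E (\<partial>\<^sub>a f)\<close> and
  \<open>E (\<Delta> f)\<close>. Hence if the Laplacians of \<open>f\<close> over two disjoint blocks of variables agree, then it
  does not matter which of the blocks is randomised. Take \<open>f\<close> to be the product of the
  Vandermonde determinant of \<open>(z\<^sub>a)\<close> and of the \<open>det (z\<^sub>a I - X X\<^sup>\<dagger>)\<close>, where \<open>- z\<^sub>a\<close> is the squared
  length of a vector in dimension \<open>t - s + 1\<close>: averaging over \<open>X\<close> may be replaced by averaging over these
  vectors, and then \<open>X\<close> enters only through the eigenvalues of \<open>\<Omega>\<close>, which may in turn be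
  replaced by squared lengths of vectors. The result is that \<open>E \<Prod>\<^sub>k \<phi>(u\<^sub>k)\<close> over the eigenvalues
  \<open>u\<^sub>k\<close> of \<open>S\<close> is proportional to the determinant of the noncentral chi-square moments of \<open>u\<^sup>i \<phi>(u)\<close>
  for all polynomials \<open>\<phi>\<close> (distinct eigenvalues first, then a confluent limit). Approximation
  of continuous functions by polynomials with respect to an exponential weight extends this to the
  indicator function of \<open>u \<le> x\<close>.\<close>

text \<open>The joint density of the eigenvalues and integrals over the unitary group are bypassed:
  everything is an identity between Gaussian expectations of one polynomial, \<open>Phi\<close>.
  Where \<open>Phi\<close> does not vanish, its Laplacians are computed by logarithmic
  differentiation. The one over \<open>X\<close> reduces to traces of resolvents of
  \<open>X X\<^sup>\<dagger>\<close>, because \<open>A R = z R - 1\<close> removes the matrix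
  entries. The vectors depend on the same \<open>z\<^sub>a\<close> and produce the opposite
  expression once they have \<open>t - s + 1\<close> complex components; what remains involves the
  \<open>z\<^sub>a\<close> alone and vanishes by symmetry. The minus sign in front of the squared
  lengths makes the two Laplacians equal instead of opposite. The same computation without
  \<open>X\<close>, with signs of both kinds, is the second replacement. Treating a variable and its
  conjugate as independent coordinates permits arbitrary complex \<open>z\<^sub>a\<close>, although
  true squared lengths are nonnegative. The normalising constant is never evaluated: it is the same
  determinant for the test function 1, and is only shown to be nonzero.\<close>

section \<open>Homogeneous polynomial functions and their formal calculus\<close>

text \<open>A predicate on functions rather than a type of polynomials: the functions are evaluated,
  integrated and differentiated directly, and each closure property is one induction over the rules.
  The degree is an index because Euler's identity and the induction of \<open>gexp_exchange\<close>
  run on it.\<close>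

inductive hpol :: "'a set \<Rightarrow> nat \<Rightarrow> (('a \<Rightarrow> complex) \<Rightarrow> complex) \<Rightarrow> bool" for A where
  hpol_const: "hpol A 0 (\<lambda>_. k)"
| hpol_zero: "hpol A d (\<lambda>_. 0)"
| hpol_var: "a \<in> A \<Longrightarrow> hpol A (Suc 0) (\<lambda>x. x a)"
| hpol_add: "hpol A d f \<Longrightarrow> hpol A d g \<Longrightarrow> hpol A d (\<lambda>x. f x + g x)"
| hpol_mult: "hpol A d f \<Longrightarrow> hpol A e g \<Longrightarrow> hpol A (d + e) (\<lambda>x. f x * g x)"

text \<open>The degree is a variable constrained by an equation, so that the rule resolves against
  goals whose degree is a numeral.\<close>

lemma hpol_mult': "hpol A d f \<Longrightarrow> hpol A e g \<Longrightarrow> n = d + e \<Longrightarrow> hpol A n (\<lambda>x. f x * g x)"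
  by (simp add: hpol_mult)

lemma hpol_cmult: "hpol A d f \<Longrightarrow> hpol A d (\<lambda>x. k * f x)"
  using hpol_mult[OF hpol_const[of A k], of d f] by simp

lemma hpol_uminus: "hpol A d f \<Longrightarrow> hpol A d (\<lambda>x. - f x)"
  using hpol_cmult[of A d f "-1"] by simp

lemma hpol_diff: "hpol A d f \<Longrightarrow> hpol A d g \<Longrightarrow> hpol A d (\<lambda>x. f x - g x)"
  using hpol_add[OF _ hpol_uminus, of A d f g] by simp

lemma hpol_sum: "(\<And>i. i \<in> I \<Longrightarrow> hpol A d (f i)) \<Longrightarrow> hpol A d (\<lambda>x. \<Sum>i\<in>I. f i x)"
proof (induction I rule: infinite_finite_induct)
  case (insert i I)
  then show ?case by (simp add: hpol_add)
qed (auto simp: hpol_zero)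

lemma hpol_prod: "(\<And>i. i \<in> I \<Longrightarrow> hpol A (d i) (f i)) \<Longrightarrow> hpol A (\<Sum>i\<in>I. d i) (\<lambda>x. \<Prod>i\<in>I. f i x)"
proof (induction I rule: infinite_finite_induct)
  case (insert i I)
  then show ?case by (simp add: hpol_mult)
qed (auto simp: hpol_const)

abbreviation fmat :: "nat \<Rightarrow> (nat \<Rightarrow> nat \<Rightarrow> 'a) \<Rightarrow> 'a mat" where
  "fmat n B \<equiv> mat n n (\<lambda>(i, j). B i j)"

lemma det_fmat:
  "det (fmat n (B :: nat \<Rightarrow> nat \<Rightarrow> complex)) = (\<Sum>p | p permutes {..<n}. signof p * (\<Prod>i<n. B i (p i)))"
proof -
  have "det (fmat n B) = (\<Sum>p | p permutes {0..<n}. signof p * (\<Prod>i = 0..<n. B i (p i)))"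
    by (subst det_def'[of _ n]) (auto intro!: sum.cong prod.cong arg_cong2[where f = "(*)"]
        dest: permutes_in_image)
  then show ?thesis by (simp add: atLeast0LessThan)
qed

lemma hpol_det:
  assumes "\<And>i j. i < n \<Longrightarrow> j < n \<Longrightarrow> hpol A d (\<lambda>x. B x i j)"
  shows "hpol A (n * d) (\<lambda>x. det (fmat n (B x)))"
proof -
  have "hpol A (\<Sum>i<n. d) (\<lambda>x. \<Prod>i<n. B x i (p i))" if "p permutes {..<n}" for p
    using permutes_in_image[OF that] by (intro hpol_prod assms) auto
  then show ?thesis
    unfolding det_fmat by (intro hpol_sum hpol_cmult) simp
qed

text \<open>Conjugates are separate coordinates, so this holomorphic derivative in a single slot
  plays the role of a Wirtinger derivative.\<close>

definition PD :: "'a \<Rightarrow> (('a \<Rightarrow> complex) \<Rightarrow> complex) \<Rightarrow> ('a \<Rightarrow> complex) \<Rightarrow> complex" where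
  "PD a f x = deriv (\<lambda>t. f (x(a := t))) (x a)"

lemma PD_I: "((\<lambda>t. f (x(a := t))) has_field_derivative D) (at (x a)) \<Longrightarrow> PD a f x = D"
  unfolding PD_def by (rule DERIV_imp_deriv)

lemma hpol_field_differentiable:
  "hpol A d f \<Longrightarrow> (\<lambda>t. f (x(a := t))) field_differentiable (at t)"
proof (induction rule: hpol.induct)
  case (hpol_var b)
  then show ?case by (cases "b = a") (auto intro!: derivative_intros)
qed (auto intro!: derivative_intros)

lemma hpol_has_derivative:
  "hpol A d f \<Longrightarrow> ((\<lambda>t. f (x(a := t))) has_field_derivative PD a f (x(a := t))) (at t)"
  using hpol_field_differentiable[of A d f x a t] unfolding PD_def
  by (simp add: field_differentiable_derivI)

lemma hpol_has_derivative':
  "hpol A d f \<Longrightarrow> ((\<lambda>t. f (x(a := t))) has_field_derivative PD a f x) (at (x a))"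
  using hpol_has_derivative[of A d f x a "x a"] by simp

lemma PD_const: "PD a (\<lambda>_. k) = (\<lambda>_. 0)"
  by (auto simp: PD_def)

lemma PD_var: "PD a (\<lambda>x. x b) = (\<lambda>_. if a = b then 1 else 0)"
  by (rule ext, rule PD_I) (auto intro!: derivative_eq_intros)

lemma PD_add: "hpol A d f \<Longrightarrow> hpol A e g \<Longrightarrow> PD a (\<lambda>x. f x + g x) = (\<lambda>x. PD a f x + PD a g x)"
  by (rule ext, rule PD_I) (intro DERIV_add hpol_has_derivative')

lemma PD_mult: "hpol A d f \<Longrightarrow> hpol A e g \<Longrightarrow>
    PD a (\<lambda>x. f x * g x) = (\<lambda>x. PD a f x * g x + f x * PD a g x)"
  by (rule ext, rule PD_I, rule DERIV_cong[OF DERIV_mult[OF hpol_has_derivative' hpol_has_derivative']])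
     (auto simp: algebra_simps)

lemma PD_sum: "(\<And>i. i \<in> I \<Longrightarrow> hpol A d (f i)) \<Longrightarrow>
    PD a (\<lambda>x. \<Sum>i\<in>I. f i x) = (\<lambda>x. \<Sum>i\<in>I. PD a (f i) x)"
  by (rule ext, rule PD_I) (intro DERIV_sum hpol_has_derivative')

text \<open>The zero function has every degree, so truncated subtraction in \<open>d - 1\<close> is harmless.\<close>
lemma hpol_PD: "hpol A d f \<Longrightarrow> hpol A (d - 1) (PD a f)"
proof (induction rule: hpol.induct)
  case (hpol_var b)
  then show ?case by (simp add: PD_var hpol.hpol_const)
next
  case (hpol_add d f g)
  then show ?case by (simp add: PD_add[OF hpol_add.hyps] hpol.hpol_add)
next
  case (hpol_mult d f e g)
  \<comment> \<open>For \<open>d = 0\<close> truncation can make \<open>d - 1 + e\<close> larger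
    than \<open>d + e - 1\<close>. That case is saved because functions of degree 0 are constant, so
    that the offending summand is the zero function.\<close>
  have z: "PD a h = (\<lambda>_. 0)" if "hpol A 0 h" for h
  proof -
    have "hpol A n h \<Longrightarrow> n = 0 \<Longrightarrow> (\<exists>k. h = (\<lambda>_. k))" for n
    proof (induction rule: hpol.induct)
      case (hpol_add d f g)
      then obtain k l where "f = (\<lambda>_. k)" "g = (\<lambda>_. l)" by auto
      then show ?case by auto
    next
      case (hpol_mult d f e g)
      then obtain k l where "f = (\<lambda>_. k)" "g = (\<lambda>_. l)" by auto
      then show ?case by auto
    qed auto
    then show ?thesis using that by (auto simp: PD_const)
  qed
  have 1: "hpol A (d + e - 1) (\<lambda>x. PD a f x * g x)"
  proof (cases "d = 0")
    case True then show ?thesis using z[of f] hpol_mult.hyps by (simp add: hpol_zero)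
  next
    case False then show ?thesis
      by (intro hpol_mult'[OF hpol_mult.IH(1) hpol_mult.hyps(2)]) auto
  qed
  have 2: "hpol A (d + e - 1) (\<lambda>x. f x * PD a g x)"
  proof (cases "e = 0")
    case True then show ?thesis using z[of g] hpol_mult.hyps by (simp add: hpol_zero)
  next
    case False then show ?thesis
      by (intro hpol_mult'[OF hpol_mult.hyps(1) hpol_mult.IH(2)]) auto
  qed
  show ?case unfolding PD_mult[OF hpol_mult.hyps] by (rule hpol.hpol_add[OF 1 2])
qed (simp_all add: PD_const hpol.hpol_const hpol.hpol_zero)

lemma PD_commute: "hpol A d f \<Longrightarrow> PD a (PD b f) = PD b (PD a f)"
proof (induction rule: hpol.induct)
  case (hpol_add d f g)
  then show ?case by (simp add: PD_add[OF hpol_add.hyps]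
        PD_add[OF hpol_add.hyps[THEN hpol_PD]])
next
  case (hpol_mult d f e g)
  note h = hpol_mult.hyps hpol_mult.hyps[THEN hpol_PD]
  have "PD a (PD b (\<lambda>x. f x * g x)) = (\<lambda>x. PD a (PD b f) x * g x + PD b f x * PD a g x
      + (PD a f x * PD b g x + f x * PD a (PD b g) x))" for a b
    unfolding PD_mult[OF h(1,2)] PD_add[OF hpol.hpol_mult hpol.hpol_mult, OF h(3,2,1,4)]
      PD_mult[OF h(3) h(2)] PD_mult[OF h(1) h(4)] ..
  then show ?case by (simp add: hpol_mult.IH add_ac mult_ac)
qed (simp_all add: PD_const PD_var)

lemma hpol_euler:
  assumes "finite A"
  shows "hpol A d f \<Longrightarrow> (\<Sum>a\<in>A. x a * PD a f x) = of_nat d * f x"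
proof (induction rule: hpol.induct)
  case (hpol_var a)
  then show ?case using assms by (simp add: PD_var if_distrib sum.delta cong: if_cong)
next
  case (hpol_add d f g)
  then show ?case by (simp add: PD_add[OF hpol_add.hyps] algebra_simps sum.distrib)
next
  case (hpol_mult d f e g)
  have "(\<Sum>a\<in>A. x a * PD a (\<lambda>x. f x * g x) x) =
    (\<Sum>a\<in>A. x a * PD a f x) * g x + f x * (\<Sum>a\<in>A. x a * PD a g x)"
    by (simp add: PD_mult[OF hpol_mult.hyps] algebra_simps sum.distrib sum_distrib_left sum_distrib_right)
  then show ?case by (simp add: hpol_mult.IH algebra_simps)
qed (auto simp: PD_const)

lemma hpol_line_derivative:
  assumes "finite A"
  shows "hpol A d f \<Longrightarrow> ((\<lambda>t. f (\<lambda>a. x a + t * w a)) has_field_derivative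
      (\<Sum>a\<in>A. w a * PD a f (\<lambda>a. x a + t * w a))) (at t)"
proof (induction rule: hpol.induct)
  case (hpol_var b)
  then show ?case using assms
    by (auto simp: PD_var if_distrib sum.delta' cong: if_cong intro!: derivative_eq_intros)
next
  case (hpol_add d f g)
  then show ?case by (auto simp: PD_add[OF hpol_add.hyps] sum.distrib algebra_simps intro!: DERIV_add)
next
  case (hpol_mult d f e g)
  show ?case
    by (rule DERIV_cong[OF DERIV_mult[OF hpol_mult.IH]])
       (simp add: PD_mult[OF hpol_mult.hyps] sum.distrib algebra_simps sum_distrib_left sum_distrib_right)
qed (auto simp: PD_const)

text \<open>Restriction to a line is the bridge to univariate \<open>poly\<close>. It serves both
  the vanishing argument below and one-dimensional integration by parts.\<close>

lemma hpol_line_poly: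
  "hpol A d f \<Longrightarrow> \<exists>p. \<forall>t. f (\<lambda>a. x a + t * w a) = poly p t"
proof (induction rule: hpol.induct)
  case (hpol_const k)
  show ?case by (rule exI[of _ "[:k:]"]) simp
next
  case (hpol_zero d)
  show ?case by (rule exI[of _ 0]) simp
next
  case (hpol_var b)
  show ?case by (rule exI[of _ "[:x b, w b:]"]) simp
next
  case (hpol_add d f g)
  then obtain p q where "\<forall>t. f (\<lambda>a. x a + t * w a) = poly p t" "\<forall>t. g (\<lambda>a. x a + t * w a) = poly q t"
    by blast
  then show ?case by (intro exI[of _ "p + q"]) simp
next
  case (hpol_mult d f e g)
  then obtain p q where "\<forall>t. f (\<lambda>a. x a + t * w a) = poly p t" "\<forall>t. g (\<lambda>a. x a + t * w a) = poly q t"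
    by blast
  then show ?case by (intro exI[of _ "p * q"]) simp
qed

text \<open>On the line through \<open>x\<close> and \<open>w\<close> both functions are univariate polynomials.\<close>
lemma hpol_zero_if_generic_zero:
  assumes F: "hpol A d F" and Q: "hpol A e Q" and w: "Q w \<noteq> 0"
    and z: "\<And>x. Q x \<noteq> 0 \<Longrightarrow> F x = 0"
  shows "F x = 0"
proof -
  define v where "v a = w a - x a" for a
  obtain p where p: "\<forall>t. F (\<lambda>a. x a + t * v a) = poly p t"
    using hpol_line_poly[OF F] by blast
  obtain q where q: "\<forall>t. Q (\<lambda>a. x a + t * v a) = poly q t"
    using hpol_line_poly[OF Q] by blast
  have "poly q 1 = Q w" using q[rule_format, of 1, symmetric] by (simp add: v_def)
  then have "q \<noteq> 0" using w by auto
  moreover have "poly (p * q) t = 0" for t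
    using z[of "\<lambda>a. x a + t * v a"] p q by (cases "poly q t = 0") auto
  then have "p * q = 0" using poly_all_0_iff_0 by blast
  ultimately have "p = 0" by simp
  then show ?thesis using p[rule_format, of 0] by simp
qed

text \<open>A product over the coordinates is used instead of a norm of \<open>x\<close> because it
  integrates against a product measure factor by factor.\<close>

lemma hpol_bound:
  assumes "finite A"
  shows "hpol A d f \<Longrightarrow> \<exists>C k. C \<ge> 0 \<and> (\<forall>x. norm (f x) \<le> C * (\<Prod>a\<in>A. (1 + norm (x a))) ^ k)"
proof (induction rule: hpol.induct)
  case (hpol_const c)
  show ?case by (rule exI[of _ "norm c"], rule exI[of _ 0]) auto
next
  case (hpol_zero d)
  show ?case by (rule exI[of _ "0"], rule exI[of _ 0]) auto
next
  case (hpol_var b)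
  have "norm (x b) \<le> (\<Prod>a\<in>A. (1 + norm (x a)))" for x :: "'a \<Rightarrow> complex"
  proof -
    have "(\<Prod>a\<in>A. if a = b then 1 + norm (x b) else 1) \<le> (\<Prod>a\<in>A. (1 + norm (x a)))"
      by (intro prod_mono) auto
    then show ?thesis using assms hpol_var by (simp add: prod.delta')
  qed
  then show ?case by (intro exI[of _ 1]) (auto intro!: exI[of _ 1])
next
  case (hpol_add d f g)
  then obtain C k C' k' where *: "C \<ge> 0" "C' \<ge> 0"
    "\<And>x. norm (f x) \<le> C * (\<Prod>a\<in>A. (1 + norm (x a))) ^ k"
    "\<And>x. norm (g x) \<le> C' * (\<Prod>a\<in>A. (1 + norm (x a))) ^ k'" by blast
  have "norm (f x + g x) \<le> (C + C') * (\<Prod>a\<in>A. (1 + norm (x a))) ^ (k + k')" for x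
  proof -
    have 1: "1 \<le> (\<Prod>a\<in>A. (1 + norm (x a)))" by (rule prod_ge_1) auto
    have "norm (f x + g x) \<le> C * (\<Prod>a\<in>A. (1 + norm (x a))) ^ k + C' * (\<Prod>a\<in>A. (1 + norm (x a))) ^ k'"
      using *(3)[of x] *(4)[of x] norm_triangle_ineq[of "f x" "g x"] by linarith
    also have "\<dots> \<le> C * (\<Prod>a\<in>A. (1 + norm (x a))) ^ (k + k') + C' * (\<Prod>a\<in>A. (1 + norm (x a))) ^ (k + k')"
      using 1 * by (intro add_mono mult_left_mono power_increasing) auto
    finally show ?thesis by (simp add: algebra_simps)
  qed
  then show ?case using * by (intro exI[of _ "C + C'"] exI[of _ "k + k'"]) auto
next
  case (hpol_mult d f e g)
  then obtain C k C' k' where *: "C \<ge> 0" "C' \<ge> 0"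
    "\<And>x. norm (f x) \<le> C * (\<Prod>a\<in>A. (1 + norm (x a))) ^ k"
    "\<And>x. norm (g x) \<le> C' * (\<Prod>a\<in>A. (1 + norm (x a))) ^ k'" by blast
  have "norm (f x * g x) \<le> (C * C') * (\<Prod>a\<in>A. (1 + norm (x a))) ^ (k + k')" for x
  proof -
    have "norm (f x * g x) \<le> (C * (\<Prod>a\<in>A. (1 + norm (x a))) ^ k) * (C' * (\<Prod>a\<in>A. (1 + norm (x a))) ^ k')"
      unfolding norm_mult using * by (intro mult_mono) (auto intro!: prod_nonneg mult_nonneg_nonneg zero_le_power)
    then show ?thesis by (simp add: power_add algebra_simps)
  qed
  then show ?case using * by (intro exI[of _ "C * C'"] exI[of _ "k + k'"]) auto
qed

section \<open>The complex Gaussian measure and its exponential integrability\<close>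

text \<open>Agreement on boxes identifies the measure on the complex numbers with the planar one;
  this is what splits a complex Gaussian into two independent real ones.\<close>

lemma lborel_complex: "lborel = distr (lborel \<Otimes>\<^sub>M lborel) borel (\<lambda>(a, b). Complex a b)"
proof (rule lborel_eqI)
  fix l u :: complex
  assume "\<And>b. b \<in> Basis \<Longrightarrow> l \<bullet> b \<le> u \<bullet> b"
  then have lu: "Re l \<le> Re u" "Im l \<le> Im u"
    using \<open>\<And>b. b \<in> Basis \<Longrightarrow> l \<bullet> b \<le> u \<bullet> b\<close>[of 1] \<open>\<And>b. b \<in> Basis \<Longrightarrow> l \<bullet> b \<le> u \<bullet> b\<close>[of \<i>]
    by (auto simp: Basis_complex_def)
  have m: "(\<lambda>(a, b). Complex a b) \<in> borel_measurable (lborel \<Otimes>\<^sub>M lborel)"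
    unfolding Complex_eq case_prod_beta by measurable
  have "(\<lambda>(a, b). Complex a b) -` box l u \<inter> space (lborel \<Otimes>\<^sub>M lborel)
      = box (Re l) (Re u) \<times> box (Im l) (Im u)"
    by (auto simp: box_def Basis_complex_def space_pair_measure)
  then show "emeasure (distr (lborel \<Otimes>\<^sub>M lborel) borel (\<lambda>(a, b). Complex a b)) (box l u)
      = ennreal (\<Prod>b\<in>Basis. (u - l) \<bullet> b)"
    using lu m by (simp add: emeasure_distr lborel.emeasure_pair_measure_Times Basis_complex_def
        ennreal_mult[symmetric])
qed simp

text \<open>Variance 1/2 for each of the real and imaginary parts, so that the complex variance is
  1.\<close>

definition gauss1 :: "real measure" where
  "gauss1 = density lborel (\<lambda>x. ennreal (normal_density 0 (1 / sqrt 2) x))"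

lemma normal_density_gauss1: "normal_density 0 (1 / sqrt 2) x = exp (- x\<^sup>2) / sqrt pi"
  by (simp add: normal_density_def power_divide)

lemma prob_space_gauss1: "prob_space gauss1"
  unfolding gauss1_def by (rule prob_space_normal_density) simp

lemma sets_gauss1 [measurable_cong]: "sets gauss1 = sets borel"
  by (simp add: gauss1_def)

text \<open>Translation invariance moves the mean into the map, and the centred density factorises
  because the squared modulus is the sum of the squares of the two parts.\<close>

lemma cgauss_eq_distr:
  "cgauss m = distr (gauss1 \<Otimes>\<^sub>M gauss1) borel (\<lambda>(a, b). m + Complex a b)"
proof -
  have meas [measurable]: "(\<lambda>(a, b). Complex a b) \<in> borel_measurable (borel \<Otimes>\<^sub>M borel)"
    unfolding Complex_eq case_prod_beta by measurable
  have meas2 [measurable]: "(\<lambda>(a, b). m + Complex a b) \<in> borel_measurable (lborel \<Otimes>\<^sub>M lborel)"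
    unfolding Complex_eq case_prod_beta by measurable
  have "lborel = distr lborel borel (\<lambda>z. m + z)"
    using lborel_distr_plus[of m] by simp
  also have "\<dots> = distr (distr (lborel \<Otimes>\<^sub>M lborel) borel (\<lambda>(a, b). Complex a b)) borel (\<lambda>z. m + z)"
    using lborel_complex by simp
  also have "\<dots> = distr (lborel \<Otimes>\<^sub>M lborel) borel (\<lambda>(a, b). m + Complex a b)"
    by (subst distr_distr) (auto simp: comp_def case_prod_beta intro!: distr_cong)
  finally have L: "lborel = distr (lborel \<Otimes>\<^sub>M lborel) borel (\<lambda>(a, b). m + Complex a b)" .
  interpret prob_space gauss1 by (rule prob_space_gauss1)
  have "gauss1 \<Otimes>\<^sub>M gauss1 = density (lborel \<Otimes>\<^sub>M lborel)
     (\<lambda>(x,y). ennreal (normal_density 0 (1 / sqrt 2) x) * ennreal (normal_density 0 (1 / sqrt 2) y))"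
    unfolding gauss1_def
    by (rule pair_measure_density) (auto intro: sigma_finite_lborel
        prob_space_imp_sigma_finite[OF prob_space_gauss1[unfolded gauss1_def]])
  also have "\<dots> = density (lborel \<Otimes>\<^sub>M lborel)
     (\<lambda>x. ennreal (exp (- (cmod ((\<lambda>(a, b). m + Complex a b) x - m))\<^sup>2) / pi))"
  proof (rule density_cong)
    have *: "normal_density 0 (1 / sqrt 2) a * normal_density 0 (1 / sqrt 2) b = exp (- (cmod (Complex a b))\<^sup>2) / pi" for a b
      unfolding normal_density_gauss1 cmod_power2 by (simp add: mult_exp_exp)
    show "AE x in lborel \<Otimes>\<^sub>M lborel.
       (case x of (x, y) \<Rightarrow> ennreal (normal_density 0 (1 / sqrt 2) x) * ennreal (normal_density 0 (1 / sqrt 2) y)) =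
       ennreal (exp (- (cmod ((case x of (a, b) \<Rightarrow> m + Complex a b) - m))\<^sup>2) / pi)"
      by (intro AE_I2) (simp add: case_prod_beta ennreal_mult[symmetric] * del: of_real_power)
  qed (simp_all add: case_prod_beta Complex_eq)
  finally have "distr (gauss1 \<Otimes>\<^sub>M gauss1) borel (\<lambda>(a, b). m + Complex a b) =
     density (distr (lborel \<Otimes>\<^sub>M lborel) borel (\<lambda>(a, b). m + Complex a b)) (\<lambda>z. ennreal (exp (- (cmod (z - m))\<^sup>2) / pi))"
    by (subst density_distr) auto
  then show ?thesis
    unfolding cgauss_def by (simp add: L[symmetric])
qed

lemma sets_cgauss [measurable_cong, simp]: "sets (cgauss m) = sets borel"
  by (simp add: cgauss_def)

lemma space_cgauss [simp]: "space (cgauss m) = UNIV"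
  by (simp add: cgauss_def)

lemma prob_space_cgauss: "prob_space (cgauss m)"
proof -
  interpret prob_space gauss1 by (rule prob_space_gauss1)
  interpret pair_prob_space gauss1 gauss1 ..
  show ?thesis
    unfolding cgauss_eq_distr by (rule prob_space_distr) (simp add: Complex_eq case_prod_beta)
qed

lemma integrable_gauss1_exp: "integrable gauss1 (\<lambda>a. exp (a\<^sup>2 / 2))"
proof -
  \<comment> \<open>Multiplying the density by \<open>exp (x\<^sup>2 / 2)\<close> leaves a Gaussian
    shape of variance 1; \<open>sqrt 2\<close> is the quotient of the normalisations.\<close>
  have "integrable lborel (\<lambda>x. sqrt 2 * std_normal_density x)"
    using integrable_normal_density[of 1 0] by simp
  moreover have "sqrt 2 * std_normal_density x = normal_density 0 (1 / sqrt 2) x * exp (x\<^sup>2 / 2)" for x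
    by (simp add: normal_density_gauss1 std_normal_density_def real_sqrt_mult mult_exp_exp)
  ultimately show ?thesis
    unfolding gauss1_def by (subst integrable_density) auto
qed

text \<open>The exponent 1/4 leaves room for any mean: \<open>(cmod (m + z))\<^sup>2 / 4\<close> is
  at most \<open>(cmod m)\<^sup>2 / 2 + (cmod z)\<^sup>2 / 2\<close>, which costs only half of the
  Gaussian decay. Polynomial growth and the products over the spectrum are both dominated by this
  function.\<close>

lemma integrable_cgauss_exp: "integrable (cgauss m) (\<lambda>z. exp ((cmod z)\<^sup>2 / 4))"
proof -
  interpret prob_space gauss1 by (rule prob_space_gauss1)
  interpret pair_prob_space gauss1 gauss1 ..
  have "integrable (gauss1 \<Otimes>\<^sub>M gauss1) (\<lambda>(a, b). exp (a\<^sup>2 / 2) * exp (b\<^sup>2 / 2))"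
    using integrable_gauss1_exp by (intro Fubini_integrable) (auto simp: norm_mult)
  then have "integrable (gauss1 \<Otimes>\<^sub>M gauss1) (\<lambda>x. exp ((cmod m)\<^sup>2 / 2) * (exp ((fst x)\<^sup>2 / 2) * exp ((snd x)\<^sup>2 / 2)))"
    by (intro integrable_mult_right) (simp add: case_prod_beta')
  then have "integrable (gauss1 \<Otimes>\<^sub>M gauss1) (\<lambda>x. exp ((cmod (m + Complex (fst x) (snd x)))\<^sup>2 / 4))"
  proof (rule Bochner_Integration.integrable_bound)
    show "(\<lambda>x. exp ((cmod (m + Complex (fst x) (snd x)))\<^sup>2 / 4)) \<in> borel_measurable (gauss1 \<Otimes>\<^sub>M gauss1)"
      unfolding Complex_eq by measurable
    have "(cmod (m + z))\<^sup>2 / 4 \<le> (cmod m)\<^sup>2 / 2 + ((Re z)\<^sup>2 / 2 + (Im z)\<^sup>2 / 2)" for z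
    proof -
      have "(cmod (m + z))\<^sup>2 \<le> (cmod m + cmod z)\<^sup>2"
        by (intro power_mono norm_triangle_ineq) auto
      also have "\<dots> \<le> 2 * (cmod m)\<^sup>2 + 2 * (cmod z)\<^sup>2"
        using zero_le_power2[of "cmod m - cmod z"] by (simp add: power2_eq_square algebra_simps)
      finally show ?thesis using cmod_power2[of z] by simp
    qed
    from this[of "Complex _ _"] show "AE x in gauss1 \<Otimes>\<^sub>M gauss1.
       norm (exp ((cmod (m + Complex (fst x) (snd x)))\<^sup>2 / 4)) \<le>
       norm (exp ((cmod m)\<^sup>2 / 2) * (exp ((fst x)\<^sup>2 / 2) * exp ((snd x)\<^sup>2 / 2)))"
      by (simp add: mult_exp_exp)
  qed
  then show ?thesis
    unfolding cgauss_eq_distr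
    by (subst integrable_distr_eq) (auto simp: Complex_eq case_prod_beta)
qed

lemma one_plus_power_le_exp: "\<exists>C::real. \<forall>r\<ge>0. (1 + r) ^ n \<le> C * exp (r\<^sup>2 / 4)"
proof -
  have "((\<lambda>r::real. (1 + r) ^ n / exp (r\<^sup>2 / 4)) \<longlongrightarrow> 0) at_top"
    by real_asymp
  then have "\<forall>\<^sub>F r::real in at_top. (1 + r) ^ n / exp (r\<^sup>2 / 4) < 1"
    by (rule order_tendstoD) simp
  then obtain R :: real where R: "\<And>r. r \<ge> R \<Longrightarrow> (1 + r) ^ n / exp (r\<^sup>2 / 4) < 1"
    by (auto simp: eventually_at_top_linorder)
  have "(1 + r) ^ n \<le> (1 + (1 + \<bar>R\<bar>) ^ n) * exp (r\<^sup>2 / 4)" if "r \<ge> 0" for r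
  proof (cases "r \<ge> R")
    case True
    then have "(1 + r) ^ n \<le> 1 * exp (r\<^sup>2 / 4)" using R[of r] by (simp add: divide_simps)
    also have "\<dots> \<le> (1 + (1 + \<bar>R\<bar>) ^ n) * exp (r\<^sup>2 / 4)" by (intro mult_right_mono) auto
    finally show ?thesis .
  next
    case False
    then have "(1 + r) ^ n \<le> (1 + \<bar>R\<bar>) ^ n" using that by (intro power_mono) auto
    also have "\<dots> \<le> (1 + (1 + \<bar>R\<bar>) ^ n) * 1" by simp
    also have "\<dots> \<le> (1 + (1 + \<bar>R\<bar>) ^ n) * exp (r\<^sup>2 / 4)" by (intro mult_left_mono) auto
    finally show ?thesis .
  qed
  then show ?thesis by blast
qed

lemma integrable_cgauss_power: "integrable (cgauss m) (\<lambda>z. (1 + cmod z) ^ n)"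
proof -
  obtain C where C: "\<And>r::real. r \<ge> 0 \<Longrightarrow> (1 + r) ^ n \<le> C * exp (r\<^sup>2 / 4)"
    using one_plus_power_le_exp by blast
  have "integrable (cgauss m) (\<lambda>z. C * exp ((cmod z)\<^sup>2 / 4))"
    using integrable_cgauss_exp by simp
  then show ?thesis
  proof (rule Bochner_Integration.integrable_bound)
    show "AE z in cgauss m. norm ((1 + cmod z) ^ n) \<le> norm (C * exp ((cmod z)\<^sup>2 / 4))"
    proof (intro AE_I2)
      fix z
      have "(1 + cmod z) ^ n \<le> C * exp ((cmod z)\<^sup>2 / 4)" by (rule C) simp
      then show "norm ((1 + cmod z) ^ n) \<le> norm (C * exp ((cmod z)\<^sup>2 / 4))" by simp
    qed
  qed simp
qed

section \<open>Gaussian integration by parts for polynomials\<close>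

text \<open>The recursion is read off from the closed forms: for even \<open>n\<close> both sides
  consist of odd moments and vanish, for odd \<open>n\<close> it is a quotient of even moments. At
  \<open>n = 0\<close> the factor \<open>n\<close> makes the truncated exponent harmless.\<close>

lemma gauss1_moments:
  "integrable gauss1 (\<lambda>a. a ^ n)"
  "(LINT a|gauss1. a ^ Suc n) = of_nat n / 2 * (LINT a|gauss1. a ^ (n - 1))"
proof -
  show "integrable gauss1 (\<lambda>a. a ^ n)" for n
    unfolding gauss1_def using integrable_normal_moment[of "1 / sqrt 2" 0 n]
    by (subst integrable_density) auto
  have I: "(LINT a|gauss1. a ^ n) = (LINT x|lborel. normal_density 0 (1 / sqrt 2) x * x ^ n)" for n
    unfolding gauss1_def by (subst integral_density) auto
  show "(LINT a|gauss1. a ^ Suc n) = of_nat n / 2 * (LINT a|gauss1. a ^ (n - 1))"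
  proof (cases "even n")
    case True
    then obtain k where n: "n = 2 * k" by (auto elim: evenE)
    have "(LINT a|gauss1. a ^ Suc n) = 0"
      using integral_normal_moment_odd[of "1 / sqrt 2" 0 k] unfolding I n by simp
    moreover have "of_nat n * (LINT a|gauss1. a ^ (n - 1)) = 0"
    proof (cases k)
      case (Suc l)
      then show ?thesis using integral_normal_moment_odd[of "1 / sqrt 2" 0 l] unfolding I n by simp
    qed (simp add: n)
    ultimately show ?thesis by simp
  next
    case False
    then obtain k where n: "n = 2 * k + 1" by (auto elim: oddE)
    have "(LINT a|gauss1. a ^ Suc n) = fact (2 * Suc k) / (4 ^ Suc k * fact (Suc k))"
      using integral_normal_moment_even[of "1 / sqrt 2" 0 "Suc k"] unfolding I n
      by (simp add: power_divide)
    moreover have "(LINT a|gauss1. a ^ (n - 1)) = fact (2 * k) / (4 ^ k * fact k)"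
      using integral_normal_moment_even[of "1 / sqrt 2" 0 k] unfolding I n
      by (simp add: power_divide)
    moreover have "fact (2 * Suc k) / (4 ^ Suc k * fact (Suc k)) =
        real n / 2 * (fact (2 * k) / (4 ^ k * fact k))"
      by (simp add: n divide_simps)
    ultimately show ?thesis by simp
  qed
qed

lemma integrable_gauss1_poly: "integrable gauss1 (\<lambda>a. poly p (complex_of_real a))"
proof -
  have "integrable gauss1 (\<lambda>a. coeff p i * of_real (a ^ i))" for i
    using gauss1_moments(1) by (intro integrable_mult_right integrable_of_real) auto
  then show ?thesis unfolding poly_altdef by (intro Bochner_Integration.integrable_sum) simp
qed

text \<open>Stein's identity for variance 1/2, obtained monomial by monomial from the moment
  recursion and extended by linearity.\<close>

lemma gauss1_stein:
  "(LINT a|gauss1. complex_of_real a * poly p (of_real a)) = 1/2 * (LINT a|gauss1. poly (pderiv p) (of_real a))"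
proof -
  have m: "integrable gauss1 (\<lambda>a. c * complex_of_real a ^ n)" for n c
    using gauss1_moments(1)[of n] by (intro integrable_mult_right) (auto simp flip: of_real_power)
  have M: "(LINT a|gauss1. complex_of_real a ^ n) = of_real (LINT a|gauss1. a ^ n)" for n
    by (simp flip: of_real_power)
  have mono: "(LINT a|gauss1. complex_of_real a * poly (monom c n) (of_real a))
      = 1/2 * (LINT a|gauss1. poly (pderiv (monom c n)) (of_real a))" for c n
  proof -
    have "(LINT a|gauss1. complex_of_real a * poly (monom c n) (of_real a)) = (LINT a|gauss1. c * complex_of_real a ^ Suc n)"
      by (simp add: poly_monom algebra_simps)
    also have "\<dots> = c * of_real (LINT a|gauss1. a ^ Suc n)"
      by (simp only: integral_mult_right_zero M)
    also have "\<dots> = 1/2 * (LINT a|gauss1. (of_nat n * c) * complex_of_real a ^ (n - 1))"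
      unfolding gauss1_moments(2) by (simp add: M)
    finally show ?thesis by (simp add: pderiv_monom poly_monom algebra_simps)
  qed
  have "(LINT a|gauss1. complex_of_real a * poly p (of_real a)) =
     (LINT a|gauss1. (\<Sum>i\<le>degree p. complex_of_real a * poly (monom (coeff p i) i) (of_real a)))"
    by (simp add: poly_monom poly_altdef[of p] sum_distrib_left)
  also have "\<dots> = (\<Sum>i\<le>degree p. (LINT a|gauss1. complex_of_real a * poly (monom (coeff p i) i) (of_real a)))"
  proof (intro Bochner_Integration.integral_sum)
    fix i
    have "(\<lambda>a. complex_of_real a * poly (monom (coeff p i) i) (of_real a)) = (\<lambda>a. coeff p i * complex_of_real a ^ Suc i)"
      by (simp add: poly_monom algebra_simps)
    then show "integrable gauss1 (\<lambda>a. complex_of_real a * poly (monom (coeff p i) i) (of_real a))"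
      using m[of "coeff p i" "Suc i"] by metis
  qed
  also have "\<dots> = 1/2 * (\<Sum>i\<le>degree p. (LINT a|gauss1. poly (pderiv (monom (coeff p i) i)) (of_real a)))"
    by (simp add: mono sum_distrib_left)
  also have "\<dots> = 1/2 * (LINT a|gauss1. (\<Sum>i\<le>degree p. poly (pderiv (monom (coeff p i) i)) (of_real a)))"
    by (subst Bochner_Integration.integral_sum) (auto intro: integrable_gauss1_poly)
  also have "(\<lambda>a. \<Sum>i\<le>degree p. poly (pderiv (monom (coeff p i) i)) (complex_of_real a)) = (\<lambda>a. poly (pderiv p) (of_real a))"
    by (subst (3) poly_as_sum_of_monoms[symmetric]) (simp add: pderiv_sum poly_sum)
  finally show ?thesis .
qed

definition unit_at :: "'a \<Rightarrow> 'a \<Rightarrow> complex" where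
  "unit_at a b = (if a = b then 1 else 0)"

text \<open>Both orders of integration are recorded because integration by parts is done once with
  the real and once with the imaginary part innermost.\<close>

lemma integral_cgauss:
  fixes f :: "complex \<Rightarrow> complex"
  assumes "integrable (cgauss m) f"
  shows "integrable (gauss1 \<Otimes>\<^sub>M gauss1) (\<lambda>(a, b). f (m + Complex a b))"
    and "(\<integral>z. f z \<partial>cgauss m) = (\<integral>a. (\<integral>b. f (m + Complex a b) \<partial>gauss1) \<partial>gauss1)"
    and "(\<integral>z. f z \<partial>cgauss m) = (\<integral>b. (\<integral>a. f (m + Complex a b) \<partial>gauss1) \<partial>gauss1)"
proof -
  interpret prob_space gauss1 by (rule prob_space_gauss1)
  interpret pair_prob_space gauss1 gauss1 ..
  have M: "(\<lambda>(a, b). m + Complex a b) \<in> measurable (gauss1 \<Otimes>\<^sub>M gauss1) borel"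
    by (simp add: Complex_eq case_prod_beta)
  have f: "f \<in> borel_measurable borel"
    using assms by (auto dest: borel_measurable_integrable)
  show I: "integrable (gauss1 \<Otimes>\<^sub>M gauss1) (\<lambda>(a, b). f (m + Complex a b))"
    using assms unfolding cgauss_eq_distr integrable_distr_eq[OF M f]
    by (simp add: case_prod_beta')
  have "(\<integral>z. f z \<partial>cgauss m) = (\<integral>(a, b). f (m + Complex a b) \<partial>(gauss1 \<Otimes>\<^sub>M gauss1))"
    unfolding cgauss_eq_distr integral_distr[OF M f] by (simp add: case_prod_beta')
  then show "(\<integral>z. f z \<partial>cgauss m) = (\<integral>a. (\<integral>b. f (m + Complex a b) \<partial>gauss1) \<partial>gauss1)"
    "(\<integral>z. f z \<partial>cgauss m) = (\<integral>b. (\<integral>a. f (m + Complex a b) \<partial>gauss1) \<partial>gauss1)"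
    using integral_fst[OF I] integral_snd[OF I] by simp_all
qed

text \<open>Adding \<open>z\<close> to one complex variable moves its own slot by \<open>z\<close>
  and its conjugate slot by \<open>cnj z\<close>.\<close>

definition dshift :: "'e \<Rightarrow> complex \<Rightarrow> ('e \<times> bool \<Rightarrow> complex) \<Rightarrow> ('e \<times> bool \<Rightarrow> complex)" where
  "dshift c z x = (\<lambda>a. x a + z * unit_at (c, False) a + cnj z * unit_at (c, True) a)"

lemma borel_measurable_cnj [measurable (raw)]:
  "f \<in> borel_measurable M \<Longrightarrow> (\<lambda>x. cnj (f x)) \<in> borel_measurable M"
  by (rule borel_measurable_continuous_on[OF _, of cnj]) (auto intro: continuous_intros)

lemma measurable_hpol:
  assumes "hpol A d f" "\<And>a. a \<in> A \<Longrightarrow> (\<lambda>w. g w a) \<in> borel_measurable M"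
  shows "(\<lambda>w. f (g w)) \<in> borel_measurable M"
  using assms(1) by (induction rule: hpol.induct) (auto simp: assms(2))

lemma prod_one_plus_le:
  fixes x y :: "'a \<Rightarrow> complex"
  shows "(\<Prod>a\<in>A. 1 + cmod (x a + y a)) \<le> (\<Prod>a\<in>A. 1 + cmod (x a)) * (\<Prod>a\<in>A. 1 + cmod (y a))"
  unfolding prod.distrib[symmetric]
proof (rule prod_mono, safe)
  fix a
  have "1 + cmod (x a + y a) \<le> 1 + (cmod (x a) + cmod (y a)) + cmod (x a) * cmod (y a)"
    using norm_triangle_ineq[of "x a" "y a"] by (simp add: add_increasing2)
  then show "1 + cmod (x a + y a) \<le> (1 + cmod (x a)) * (1 + cmod (y a))"
    by (simp add: algebra_simps)
qed simp

lemma integrable_cgauss_shift: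
  assumes A: "finite A" and f: "hpol A d f"
  shows "integrable (cgauss m) (\<lambda>z. f (dshift c z x))"
proof -
  obtain C k where C: "C \<ge> 0" "\<And>x. norm (f x) \<le> C * (\<Prod>a\<in>A. (1 + norm (x a))) ^ k"
    using hpol_bound[OF A f] by blast
  define D where "D = (\<Prod>a\<in>A. 1 + norm (x a))"
  have D: "D \<ge> 0" unfolding D_def by (intro prod_nonneg) auto
  have "norm (f (dshift c z x)) \<le> (C * D ^ k) * (1 + cmod z) ^ (card A * k)" for z
  proof -
    define y where "y a = z * unit_at (c, False) a + cnj z * unit_at (c, True) a" for a
    have "(\<Prod>a\<in>A. 1 + norm (dshift c z x a)) \<le> D * (\<Prod>a\<in>A. 1 + cmod (y a))"
      using prod_one_plus_le[of x y A] unfolding D_def dshift_def y_def by (simp add: add.assoc)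
    also have "\<dots> \<le> D * (\<Prod>a\<in>A. 1 + cmod z)"
      using D by (intro mult_left_mono prod_mono) (auto simp: y_def unit_at_def)
    finally have "(\<Prod>a\<in>A. 1 + norm (dshift c z x a)) ^ k \<le> (D * (1 + cmod z) ^ card A) ^ k"
      by (intro power_mono) (auto intro!: prod_nonneg)
    then have "C * (\<Prod>a\<in>A. 1 + norm (dshift c z x a)) ^ k \<le> C * (D * (1 + cmod z) ^ card A) ^ k"
      using C by (intro mult_left_mono)
    then show ?thesis using C(2)[of "dshift c z x"] by (simp add: power_mult_distrib power_mult mult.assoc)
  qed
  note b = this
  have "integrable (cgauss m) (\<lambda>z. (C * D ^ k) * (1 + cmod z) ^ (card A * k))"
    using integrable_cgauss_power by simp
  then show ?thesis
  proof (rule Bochner_Integration.integrable_bound)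
    show "(\<lambda>z. f (dshift c z x)) \<in> borel_measurable (cgauss m)"
      by (rule measurable_hpol[OF f]) (simp add: dshift_def cong: measurable_cong_sets)
    show "AE z in cgauss m. norm (f (dshift c z x)) \<le> norm (C * D ^ k * (1 + cmod z) ^ (card A * k))"
      using b C D by (intro AE_I2) (simp add: abs_mult)
  qed
qed

text \<open>Along a line the function is a univariate polynomial, and uniqueness of derivatives
  identifies \<open>pderiv\<close> with the directional derivative. The direction \<open>w\<close>
  may be complex although the parameter is real.\<close>

lemma gauss1_stein_line:
  assumes A: "finite A" and f: "hpol A d f"
  shows "(\<integral>t. complex_of_real t * f (\<lambda>a. x a + of_real t * w a) \<partial>gauss1)
    = 1/2 * (\<integral>t. (\<Sum>a\<in>A. w a * PD a f (\<lambda>a. x a + of_real t * w a)) \<partial>gauss1)"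
proof -
  obtain p where p: "\<And>t. f (\<lambda>a. x a + t * w a) = poly p t"
    using hpol_line_poly[OF f] by blast
  have "(\<Sum>a\<in>A. w a * PD a f (\<lambda>a. x a + t * w a)) = poly (pderiv p) t" for t
    using hpol_line_derivative[OF A f, of x w t] poly_DERIV[of p t] unfolding p
    by (rule DERIV_unique)
  then show ?thesis using gauss1_stein[of p] by (simp add: p)
qed

text \<open>Write \<open>z - m = a + \<i> b\<close>, and \<open>F1\<close>, \<open>F2\<close> for
  the derivatives in the slot and in its conjugate. Integration by parts in \<open>a\<close> yields
  \<open>(F1 + F2) / 2\<close>, in \<open>b\<close> it yields \<open>\<i> (F1 - F2) / 2\<close>.
  Adding \<open>\<i>\<close> times the second leaves \<open>F2\<close>, subtracting it leaves
  \<open>F1\<close>.\<close>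

lemma cgauss_stein:
  assumes A: "finite A" and f: "hpol A d f" and c: "(c, False) \<in> A" "(c, True) \<in> A"
  shows "(\<integral>z. (z - m) * f (dshift c z x) \<partial>cgauss m) = (\<integral>z. PD (c, True) f (dshift c z x) \<partial>cgauss m)"
    and "(\<integral>z. cnj (z - m) * f (dshift c z x) \<partial>cgauss m) = (\<integral>z. PD (c, False) f (dshift c z x) \<partial>cgauss m)"
proof -
  define F where "F z = f (dshift c z x)" for z
  define F1 where "F1 z = PD (c, False) f (dshift c z x)" for z
  define F2 where "F2 z = PD (c, True) f (dshift c z x)" for z
  note f' = hpol_PD[OF f]
  have i12: "integrable (cgauss m) F1" "integrable (cgauss m) F2"
    unfolding F1_def F2_def by (rule integrable_cgauss_shift[OF A f'])+
  have sh: "dshift c z x (c, False) = x (c, False) + z" "dshift c z x (c, True) = x (c, True) + cnj z" for z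
    by (auto simp: dshift_def unit_at_def)
  have "integrable (cgauss m) (\<lambda>z. (z + k) * F z)" "integrable (cgauss m) (\<lambda>z. (cnj z + k) * F z)" for k
  proof -
    \<comment> \<open>Up to a multiple of \<open>F\<close>, multiplication by \<open>z\<close> or
      \<open>cnj z\<close> is multiplication by a coordinate of the shifted point, which stays
      within \<open>hpol\<close>; this supplies integrability.\<close>
    have g: "hpol A (Suc 0) (\<lambda>x. x (c, b))" for b using c by (cases b) (auto intro: hpol.intros)
    have *: "integrable (cgauss m) (\<lambda>z. dshift c z x (c, b) * F z)" for b
      unfolding F_def using integrable_cgauss_shift[OF A hpol_mult[OF g f], of m] by simp
    have F: "integrable (cgauss m) F" unfolding F_def by (rule integrable_cgauss_shift[OF A f])
    have "integrable (cgauss m) (\<lambda>z. dshift c z x (c, False) * F z + (k - x (c, False)) * F z)"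
       "integrable (cgauss m) (\<lambda>z. dshift c z x (c, True) * F z + (k - x (c, True)) * F z)"
      using * F by auto
    then show "integrable (cgauss m) (\<lambda>z. (z + k) * F z)" "integrable (cgauss m) (\<lambda>z. (cnj z + k) * F z)"
      unfolding sh by (simp_all add: algebra_simps)
  qed note i = this
  have "integrable (cgauss m) (\<lambda>z. complex_of_real (Re (z - m)) * F z)"
    "integrable (cgauss m) (\<lambda>z. complex_of_real (Im (z - m)) * F z)"
  proof -
    have e: "(1/2) * ((z + (- m - cnj m)) * F z + (cnj z + 0) * F z) = complex_of_real (Re (z - m)) * F z"
      "(- \<i>/2) * ((z + (- m + cnj m)) * F z - (cnj z + 0) * F z) = complex_of_real (Im (z - m)) * F z" for z
    proof -
      have "complex_of_real (Re (z - m)) = (1/2) * ((z + (- m - cnj m)) + (cnj z + 0))"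
         "complex_of_real (Im (z - m)) = (- \<i>/2) * ((z + (- m + cnj m)) - (cnj z + 0))"
        by (auto simp: complex_eq_iff field_simps)
      then show "(1/2) * ((z + (- m - cnj m)) * F z + (cnj z + 0) * F z) = complex_of_real (Re (z - m)) * F z"
        "(- \<i>/2) * ((z + (- m + cnj m)) * F z - (cnj z + 0) * F z) = complex_of_real (Im (z - m)) * F z"
        by (simp_all only: ring_distribs mult.assoc)
    qed
    have "integrable (cgauss m) (\<lambda>z. (1/2) * ((z + (- m - cnj m)) * F z + (cnj z + 0) * F z))"
      "integrable (cgauss m) (\<lambda>z. (- \<i>/2) * ((z + (- m + cnj m)) * F z - (cnj z + 0) * F z))"
      using i by (intro integrable_mult_right Bochner_Integration.integrable_add Bochner_Integration.integrable_diff; blast)+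
    then show "integrable (cgauss m) (\<lambda>z. complex_of_real (Re (z - m)) * F z)"
      "integrable (cgauss m) (\<lambda>z. complex_of_real (Im (z - m)) * F z)"
      unfolding e by blast+
  qed note ii = this
  have line: "(\<Sum>a\<in>A. w a * PD a f y) = w (c, False) * PD (c, False) f y + w (c, True) * PD (c, True) f y"
    if "\<And>a. a \<noteq> (c, False) \<Longrightarrow> a \<noteq> (c, True) \<Longrightarrow> w a = 0" for w y
  proof -
    have "(\<Sum>a\<in>A. w a * PD a f y) = (\<Sum>a\<in>{(c, False), (c, True)}. w a * PD a f y)"
      using c that A by (intro sum.mono_neutral_right) auto
    then show ?thesis by simp
  qed
  \<comment> \<open>A real displacement moves both slots equally; an imaginary one moves them by
    opposite multiples of \<open>\<i>\<close>. These are the directions to which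
    \<open>gauss1_stein_line\<close> is applied.\<close>
  have shr: "dshift c (m + Complex a b) x = (\<lambda>v. dshift c (m + Complex 0 b) x v + of_real a * (unit_at (c, False) v + unit_at (c, True) v))" for a b
    by (auto simp: dshift_def fun_eq_iff Complex_eq algebra_simps)
  have shi: "dshift c (m + Complex a b) x = (\<lambda>v. dshift c (m + Complex a 0) x v + of_real b * (\<i> * unit_at (c, False) v - \<i> * unit_at (c, True) v))" for a b
    by (auto simp: dshift_def fun_eq_iff Complex_eq algebra_simps)
  have R: "(\<integral>z. complex_of_real (Re (z - m)) * F z \<partial>cgauss m) = 1/2 * (\<integral>z. F1 z + F2 z \<partial>cgauss m)"
  proof -
    have "(\<integral>z. complex_of_real (Re (z - m)) * F z \<partial>cgauss m) =
      (\<integral>b. (\<integral>a. complex_of_real a * F (m + Complex a b) \<partial>gauss1) \<partial>gauss1)"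
      by (subst integral_cgauss(3)[OF ii(1)]) simp
    also have "\<dots> = (\<integral>b. 1/2 * (\<integral>a. F1 (m + Complex a b) + F2 (m + Complex a b) \<partial>gauss1) \<partial>gauss1)"
    proof (rule Bochner_Integration.integral_cong[OF refl])
      fix b
      let ?w = "\<lambda>v. unit_at (c, False) v + unit_at (c, True) v"
      have w: "(\<Sum>a\<in>A. ?w a * PD a f y) = PD (c, False) f y + PD (c, True) f y" for y
        by (subst line) (auto simp: unit_at_def)
      show "(\<integral>a. complex_of_real a * F (m + Complex a b) \<partial>gauss1) =
          1/2 * (\<integral>a. F1 (m + Complex a b) + F2 (m + Complex a b) \<partial>gauss1)"
        unfolding F_def F1_def F2_def
        using gauss1_stein_line[OF A f, of "dshift c (m + Complex 0 b) x" ?w] w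
        by (simp add: shr[symmetric])
    qed
    also have "\<dots> = 1/2 * (\<integral>z. F1 z + F2 z \<partial>cgauss m)"
      using i12 by (subst integral_cgauss(3)[of m "\<lambda>z. F1 z + F2 z"]) auto
    finally show ?thesis .
  qed
  have I: "(\<integral>z. complex_of_real (Im (z - m)) * F z \<partial>cgauss m) = 1/2 * (\<integral>z. \<i> * F1 z - \<i> * F2 z \<partial>cgauss m)"
  proof -
    have "(\<integral>z. complex_of_real (Im (z - m)) * F z \<partial>cgauss m) =
      (\<integral>a. (\<integral>b. complex_of_real b * F (m + Complex a b) \<partial>gauss1) \<partial>gauss1)"
      by (subst integral_cgauss(2)[OF ii(2)]) simp
    also have "\<dots> = (\<integral>a. 1/2 * (\<integral>b. \<i> * F1 (m + Complex a b) - \<i> * F2 (m + Complex a b) \<partial>gauss1) \<partial>gauss1)"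
    proof (rule Bochner_Integration.integral_cong[OF refl])
      fix a
      let ?w = "\<lambda>v. \<i> * unit_at (c, False) v - \<i> * unit_at (c, True) v"
      have w: "(\<Sum>a\<in>A. ?w a * PD a f y) = \<i> * PD (c, False) f y - \<i> * PD (c, True) f y" for y
        by (subst line) (auto simp: unit_at_def)
      show "(\<integral>b. complex_of_real b * F (m + Complex a b) \<partial>gauss1) =
          1/2 * (\<integral>b. \<i> * F1 (m + Complex a b) - \<i> * F2 (m + Complex a b) \<partial>gauss1)"
        unfolding F_def F1_def F2_def
        using gauss1_stein_line[OF A f, of "dshift c (m + Complex a 0) x" ?w] w
        by (simp add: shi[symmetric])
    qed
    also have "\<dots> = 1/2 * (\<integral>z. \<i> * F1 z - \<i> * F2 z \<partial>cgauss m)"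
      using i12 by (subst integral_cgauss(2)[of m "\<lambda>z. \<i> * F1 z - \<i> * F2 z"]) auto
    finally show ?thesis .
  qed
  have e: "(z - m) * F z = complex_of_real (Re (z - m)) * F z + \<i> * (complex_of_real (Im (z - m)) * F z)"
     "cnj (z - m) * F z = complex_of_real (Re (z - m)) * F z - \<i> * (complex_of_real (Im (z - m)) * F z)" for z
  proof -
    have "z - m = complex_of_real (Re (z - m)) + \<i> * complex_of_real (Im (z - m))"
      "cnj (z - m) = complex_of_real (Re (z - m)) - \<i> * complex_of_real (Im (z - m))"
      by (auto simp: complex_eq_iff)
    then show "(z - m) * F z = complex_of_real (Re (z - m)) * F z + \<i> * (complex_of_real (Im (z - m)) * F z)"
     "cnj (z - m) * F z = complex_of_real (Re (z - m)) * F z - \<i> * (complex_of_real (Im (z - m)) * F z)"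
      by (metis distrib_right mult.assoc, metis left_diff_distrib mult.assoc)
  qed
  have s1: "(\<integral>z. F1 z + F2 z \<partial>cgauss m) = (\<integral>z. F1 z \<partial>cgauss m) + (\<integral>z. F2 z \<partial>cgauss m)"
    "(\<integral>z. \<i> * F1 z - \<i> * F2 z \<partial>cgauss m) = \<i> * (\<integral>z. F1 z \<partial>cgauss m) - \<i> * (\<integral>z. F2 z \<partial>cgauss m)"
    using i12 by simp_all
  have "(\<integral>z. (z - m) * F z \<partial>cgauss m) =
      (\<integral>z. complex_of_real (Re (z - m)) * F z \<partial>cgauss m) + \<i> * (\<integral>z. complex_of_real (Im (z - m)) * F z \<partial>cgauss m)"
    unfolding e(1) integral_mult_right_zero[symmetric]
    by (rule Bochner_Integration.integral_add[OF ii(1) integrable_mult_right[OF ii(2)]])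
  also have "\<dots> = (\<integral>z. F2 z \<partial>cgauss m)"
    unfolding R I s1 by (simp add: algebra_simps)
  finally have "(\<integral>z. (z - m) * F z \<partial>cgauss m) = (\<integral>z. F2 z \<partial>cgauss m)" .
  moreover have "(\<integral>z. cnj (z - m) * F z \<partial>cgauss m) =
      (\<integral>z. complex_of_real (Re (z - m)) * F z \<partial>cgauss m) - \<i> * (\<integral>z. complex_of_real (Im (z - m)) * F z \<partial>cgauss m)"
    unfolding e(2) integral_mult_right_zero[symmetric]
    by (rule Bochner_Integration.integral_diff[OF ii(1) integrable_mult_right[OF ii(2)]])
  then have "(\<integral>z. cnj (z - m) * F z \<partial>cgauss m) = (\<integral>z. F1 z \<partial>cgauss m)"
    unfolding R I s1 by (simp add: algebra_simps)
  ultimately show "(\<integral>z. (z - m) * f (dshift c z x) \<partial>cgauss m) = (\<integral>z. PD (c, True) f (dshift c z x) \<partial>cgauss m)"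
    "(\<integral>z. cnj (z - m) * f (dshift c z x) \<partial>cgauss m) = (\<integral>z. PD (c, False) f (dshift c z x) \<partial>cgauss m)"
    by (simp_all add: F_def F1_def F2_def)
qed

section \<open>Expectations over blocks of complex Gaussian variables and their exchange\<close>

text \<open>The coordinate \<open>(c, True)\<close> stands for the conjugate of the coordinate \<open>(c, False)\<close>.\<close>
definition dbl :: "'e set \<Rightarrow> ('e \<Rightarrow> complex) \<Rightarrow> ('e \<times> bool \<Rightarrow> complex)" where
  "dbl J \<zeta> = (\<lambda>(c, b). if c \<in> J then (if b then cnj (\<zeta> c) else \<zeta> c) else 0)"

text \<open>Slots outside \<open>J\<close> are frozen at \<open>Q\<close>, those inside receive
  \<open>Q\<close> plus a Gaussian vector. The effective mean is therefore \<open>Q\<close> plus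
  \<open>dbl J m\<close>, the point that two experiments must share in order to be
  exchanged.\<close>

definition gexp :: "'e set \<Rightarrow> ('e \<Rightarrow> complex) \<Rightarrow> (('e \<times> bool \<Rightarrow> complex) \<Rightarrow> complex) \<Rightarrow>
    ('e \<times> bool \<Rightarrow> complex) \<Rightarrow> complex" where
  "gexp J m f Q = (\<integral>\<zeta>. f (\<lambda>a. Q a + dbl J \<zeta> a) \<partial>PiM J (\<lambda>c. cgauss (m c)))"

text \<open>The mixed derivative in a variable and its conjugate, that is, a quarter of the real
  Laplacian.\<close>

definition Lap :: "'e set \<Rightarrow> (('e \<times> bool \<Rightarrow> complex) \<Rightarrow> complex) \<Rightarrow> ('e \<times> bool \<Rightarrow> complex) \<Rightarrow> complex" where
  "Lap J f x = (\<Sum>c\<in>J. PD (c, False) (PD (c, True) f) x)"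

lemma product_sigma_finite_cgauss: "product_sigma_finite (\<lambda>c. cgauss (m c))"
  unfolding product_sigma_finite_def
  using prob_space_cgauss prob_space_imp_sigma_finite by blast

lemma prod_dbl_le:
  assumes "finite A" "finite J"
  shows "(\<Prod>a\<in>A. 1 + cmod (dbl J \<zeta> a)) \<le> (\<Prod>c\<in>J. (1 + cmod (\<zeta> c)) ^ 2)"
proof -
  have "(\<Prod>a\<in>A. 1 + cmod (dbl J \<zeta> a)) = (\<Prod>a\<in>A \<inter> J \<times> UNIV. 1 + cmod (dbl J \<zeta> a))"
    using assms by (intro prod.mono_neutral_right) (auto simp: dbl_def split: if_splits)
  also have "\<dots> \<le> (\<Prod>a\<in>J \<times> UNIV. 1 + cmod (dbl J \<zeta> a))"
    using assms by (intro prod_mono2) auto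
  also have "\<dots> = (\<Prod>c\<in>J. \<Prod>b\<in>UNIV. 1 + cmod (dbl J \<zeta> (c, b)))"
    by (subst prod.cartesian_product) auto
  also have "\<dots> = (\<Prod>c\<in>J. (1 + cmod (\<zeta> c)) ^ 2)"
    by (intro prod.cong) (auto simp: UNIV_bool dbl_def power2_eq_square)
  finally show ?thesis .
qed

text \<open>The constants do not depend on \<open>Q\<close>, which later permits dominated
  convergence along a convergent sequence of offsets.\<close>

lemma gexp_bound:
  assumes A: "finite A" and f: "hpol A d f" and J: "finite J"
  obtains C k where "C \<ge> 0"
    "\<And>Q \<zeta>. norm (f (\<lambda>a. Q a + dbl J \<zeta> a)) \<le> C * (\<Prod>a\<in>A. 1 + norm (Q a)) ^ k * (\<Prod>c\<in>J. (1 + cmod (\<zeta> c)) ^ (2 * k))"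
proof -
  obtain C k where C: "C \<ge> 0" "\<And>x. norm (f x) \<le> C * (\<Prod>a\<in>A. (1 + norm (x a))) ^ k"
    using hpol_bound[OF A f] by blast
  have b: "norm (f (\<lambda>a. Q a + dbl J \<zeta> a)) \<le> C * (\<Prod>a\<in>A. 1 + norm (Q a)) ^ k * (\<Prod>c\<in>J. (1 + cmod (\<zeta> c)) ^ (2 * k))" for Q \<zeta>
  proof -
    define D where "D = (\<Prod>a\<in>A. 1 + norm (Q a))"
    have D: "D \<ge> 0" unfolding D_def by (intro prod_nonneg) auto
    have "(\<Prod>a\<in>A. 1 + norm (Q a + dbl J \<zeta> a)) \<le> D * (\<Prod>a\<in>A. 1 + cmod (dbl J \<zeta> a))"
      using prod_one_plus_le[of Q "dbl J \<zeta>" A] unfolding D_def .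
    also have "\<dots> \<le> D * (\<Prod>c\<in>J. (1 + cmod (\<zeta> c)) ^ 2)"
      using D by (intro mult_left_mono prod_dbl_le A J)
    finally have "(\<Prod>a\<in>A. 1 + norm (Q a + dbl J \<zeta> a)) ^ k \<le> (D * (\<Prod>c\<in>J. (1 + cmod (\<zeta> c)) ^ 2)) ^ k"
      by (intro power_mono) (auto intro!: prod_nonneg)
    then have "C * (\<Prod>a\<in>A. 1 + norm (Q a + dbl J \<zeta> a)) ^ k \<le> C * (D * (\<Prod>c\<in>J. (1 + cmod (\<zeta> c)) ^ 2)) ^ k"
      using C by (intro mult_left_mono)
    then show ?thesis using C(2)[of "\<lambda>a. Q a + dbl J \<zeta> a"]
      by (simp add: power_mult_distrib power_mult mult.assoc prod_power_distrib D_def)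
  qed
  show ?thesis by (rule that[OF C(1) b])
qed

lemma borel_measurable_dbl:
  "(\<lambda>\<zeta>. Q a + dbl J \<zeta> a) \<in> borel_measurable (PiM J (\<lambda>c. cgauss (m c)))"
proof (cases "fst a \<in> J")
  case True
  then have "(\<lambda>\<zeta>. \<zeta> (fst a)) \<in> borel_measurable (PiM J (\<lambda>c. cgauss (m c)))"
    using measurable_component_singleton[of "fst a" J "\<lambda>c. cgauss (m c)"]
    by (simp cong: measurable_cong_sets)
  then show ?thesis by (auto simp: dbl_def case_prod_beta)
qed (auto simp: dbl_def case_prod_beta)

lemma integrable_gexp:
  assumes A: "finite A" and f: "hpol A d f" and J: "finite J"
  shows "integrable (PiM J (\<lambda>c. cgauss (m c))) (\<lambda>\<zeta>. f (\<lambda>a. Q a + dbl J \<zeta> a))"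
proof -
  interpret product_sigma_finite "\<lambda>c. cgauss (m c)" by (rule product_sigma_finite_cgauss)
  obtain C k where C: "C \<ge> 0"
    "\<And>Q \<zeta>. norm (f (\<lambda>a. Q a + dbl J \<zeta> a)) \<le> C * (\<Prod>a\<in>A. 1 + norm (Q a)) ^ k * (\<Prod>c\<in>J. (1 + cmod (\<zeta> c)) ^ (2 * k))"
    using gexp_bound[OF A f J] by blast
  have "integrable (PiM J (\<lambda>c. cgauss (m c)))
      (\<lambda>\<zeta>. C * (\<Prod>a\<in>A. 1 + norm (Q a)) ^ k * (\<Prod>c\<in>J. (1 + cmod (\<zeta> c)) ^ (2 * k)))"
    using integrable_cgauss_power J by (intro integrable_mult_right product_integrable_prod)
  then show ?thesis
  proof (rule Bochner_Integration.integrable_bound)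
    show "(\<lambda>\<zeta>. f (\<lambda>a. Q a + dbl J \<zeta> a)) \<in> borel_measurable (PiM J (\<lambda>c. cgauss (m c)))"
      by (intro measurable_hpol[OF f] borel_measurable_dbl)
  qed (intro AE_I2 order.trans[OF C(2)], simp only: real_norm_def abs_ge_self)
qed

text \<open>By Fubini the coordinate \<open>c\<close> is integrated innermost, where the claim is
  \<open>cgauss_stein\<close>. Multiplying by a slot brings out its mean \<open>P (c, b)\<close> and
  differentiates in the conjugate slot.\<close>

lemma gexp_stein:
  assumes A: "finite A" and f: "hpol A d f" and J: "finite J" "c \<in> J"
    and c: "(c, False) \<in> A" "(c, True) \<in> A" and P: "P = (\<lambda>a. Q a + dbl J m a)"
  shows "gexp J m (\<lambda>x. x (c, b) * f x) Q = P (c, b) * gexp J m f Q + gexp J m (PD (c, \<not> b) f) Q"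
proof -
  interpret product_sigma_finite "\<lambda>c. cgauss (m c)" by (rule product_sigma_finite_cgauss)
  define J' where "J' = J - {c}"
  have J': "J = insert c J'" "finite J'" "c \<notin> J'" using J by (auto simp: J'_def)
  have sh: "(\<lambda>a. Q a + dbl J (\<zeta>(c := z)) a) = dshift c z (\<lambda>a. Q a + dbl J' \<zeta> a)" for \<zeta> z
    using J' by (auto simp: dbl_def dshift_def unit_at_def fun_eq_iff)
  have g: "hpol A (Suc 0) (\<lambda>x. x (c, b))" for b using c by (cases b) (auto intro: hpol.intros)
  have I: "gexp J m h Q = (\<integral>\<zeta>. (\<integral>z. h (dshift c z (\<lambda>a. Q a + dbl J' \<zeta> a)) \<partial>cgauss (m c)) \<partial>PiM J' (\<lambda>c. cgauss (m c)))"
    if "hpol A e h" for h e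
    unfolding gexp_def
    using product_integral_insert[OF J'(2,3), of "\<lambda>\<zeta>. h (\<lambda>a. Q a + dbl J \<zeta> a)"] integrable_gexp[OF A that J(1), of m Q]
    by (simp add: J'(1)[symmetric] sh)
  have d: "dshift c z (\<lambda>a. Q a + dbl J' \<zeta> a) (c, b) = P (c, b) + (if b then cnj (z - m c) else z - m c)" for z \<zeta>
    using J J' by (auto simp: dbl_def dshift_def unit_at_def P)
  define k where "k = P (c, b)"
  have ih: "integrable (cgauss (m c)) (\<lambda>z. h (dshift c z x))" if "hpol A e h" for h e x
    using integrable_cgauss_shift[OF A that] .
  have inner: "(\<integral>z. (\<lambda>x. x (c, b) * f x) (dshift c z (\<lambda>a. Q a + dbl J' \<zeta> a)) \<partial>cgauss (m c))
     = (\<integral>z. k * f (dshift c z (\<lambda>a. Q a + dbl J' \<zeta> a)) + PD (c, \<not> b) f (dshift c z (\<lambda>a. Q a + dbl J' \<zeta> a)) \<partial>cgauss (m c))" for \<zeta>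
  proof -
    define x where "x = (\<lambda>a. Q a + dbl J' \<zeta> a)"
    define e where "e z = (if b then cnj (z - m c) else z - m c)" for z
    have dd: "dshift c z x (c, b) = k + e z" for z
      unfolding x_def d e_def k_def ..
    have st: "(\<integral>z. e z * f (dshift c z x) \<partial>cgauss (m c)) = (\<integral>z. PD (c, \<not> b) f (dshift c z x) \<partial>cgauss (m c))"
      unfolding e_def using cgauss_stein[OF A f c, of "m c" x] by (cases b) auto
    have i1: "integrable (cgauss (m c)) (\<lambda>z. k * f (dshift c z x))"
      using ih[OF f] by simp
    have "integrable (cgauss (m c)) (\<lambda>z. dshift c z x (c, b) * f (dshift c z x) - k * f (dshift c z x))"
      using i1 ih[OF hpol_mult[OF g f]] by (intro Bochner_Integration.integrable_diff)
    then have i2: "integrable (cgauss (m c)) (\<lambda>z. e z * f (dshift c z x))"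
      unfolding dd by (simp add: algebra_simps)
    have "(\<integral>z. dshift c z x (c, b) * f (dshift c z x) \<partial>cgauss (m c)) =
      (\<integral>z. k * f (dshift c z x) \<partial>cgauss (m c)) + (\<integral>z. e z * f (dshift c z x) \<partial>cgauss (m c))"
      unfolding dd distrib_right by (rule Bochner_Integration.integral_add[OF i1 i2])
    also have "\<dots> = (\<integral>z. k * f (dshift c z x) + PD (c, \<not> b) f (dshift c z x) \<partial>cgauss (m c))"
      unfolding st by (rule Bochner_Integration.integral_add[symmetric, OF i1 ih[OF hpol_PD[OF f]]])
    finally show ?thesis by (simp add: x_def)
  qed
  have "gexp J m (\<lambda>x. x (c, b) * f x) Q = (\<integral>\<zeta>. k * f (\<lambda>a. Q a + dbl J \<zeta> a) + PD (c, \<not> b) f (\<lambda>a. Q a + dbl J \<zeta> a) \<partial>PiM J (\<lambda>c. cgauss (m c)))"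
  proof -
    have "integrable (PiM J (\<lambda>c. cgauss (m c))) (\<lambda>\<zeta>. k * f (\<lambda>a. Q a + dbl J \<zeta> a) + PD (c, \<not> b) f (\<lambda>a. Q a + dbl J \<zeta> a))"
      using integrable_gexp[OF A f J(1)] integrable_gexp[OF A hpol_PD[OF f] J(1)] by auto
    then show ?thesis
      unfolding I[OF hpol_mult[OF g f]] inner
      using product_integral_insert[OF J'(2,3), of "\<lambda>\<zeta>. k * f (\<lambda>a. Q a + dbl J \<zeta> a) + PD (c, \<not> b) f (\<lambda>a. Q a + dbl J \<zeta> a)"]
      by (simp add: J'(1)[symmetric] sh)
  qed
  also have "\<dots> = k * gexp J m f Q + gexp J m (PD (c, \<not> b) f) Q"
    unfolding gexp_def using integrable_gexp[OF A f J(1)] integrable_gexp[OF A hpol_PD[OF f] J(1)] by simp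
  finally show ?thesis by (simp add: k_def)
qed

lemma gexp_sum:
  assumes "finite A" "finite J" "\<And>i. i \<in> I \<Longrightarrow> hpol A d (f i)"
  shows "gexp J m (\<lambda>x. \<Sum>i\<in>I. f i x) Q = (\<Sum>i\<in>I. gexp J m (f i) Q)"
  unfolding gexp_def using assms integrable_gexp
  by (intro Bochner_Integration.integral_sum) blast

lemma hpol_Lap: "hpol A d f \<Longrightarrow> hpol A (d - 1 - 1) (Lap J f)"
  unfolding Lap_def by (intro hpol_sum hpol_PD)

text \<open>Euler's identity turned into a recursion on the degree by Gaussian integration by parts.\<close>
lemma gexp_euler:
  assumes A: "finite A" and f: "hpol A d f" and J: "finite J" "J \<times> UNIV \<subseteq> A"
    and P: "P = (\<lambda>a. Q a + dbl J m a)"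
  shows "of_nat d * gexp J m f Q = (\<Sum>a\<in>A. P a * gexp J m (PD a f) Q) + 2 * gexp J m (Lap J f) Q"
proof -
  have g: "hpol A (Suc 0 + (d - 1)) (\<lambda>x. x a * PD a f x)" if "a \<in> A" for a
    using that by (intro hpol_mult hpol_PD[OF f] hpol_var)
  have J2: "finite (J \<times> (UNIV :: bool set))" using J by auto
  have t: "gexp J m (\<lambda>x. x a * PD a f x) Q = P a * gexp J m (PD a f) Q
      + (if a \<in> J \<times> UNIV then gexp J m (PD (fst a, \<not> snd a) (PD a f)) Q else 0)" if "a \<in> A" for a
  proof (cases "a \<in> J \<times> UNIV")
    case True
    then obtain c b where a: "a = (c, b)" "c \<in> J" by auto
    have "(c, False) \<in> A" "(c, True) \<in> A" using J a by auto
    from gexp_stein[OF A hpol_PD[OF f] J(1) a(2) this P] True show ?thesis by (simp add: a)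
  next
    case False
    then have "dbl J \<zeta> a = 0" for \<zeta> by (cases a) (auto simp: dbl_def)
    then show ?thesis using False by (simp add: gexp_def P)
  qed
  have "of_nat d * gexp J m f Q = gexp J m (\<lambda>x. of_nat d * f x) Q"
    by (simp add: gexp_def)
  also have "\<dots> = gexp J m (\<lambda>x. \<Sum>a\<in>A. x a * PD a f x) Q"
    by (simp add: hpol_euler[OF A f])
  also have "\<dots> = (\<Sum>a\<in>A. gexp J m (\<lambda>x. x a * PD a f x) Q)"
    by (rule gexp_sum[OF A J(1) g])
  also have "\<dots> = (\<Sum>a\<in>A. P a * gexp J m (PD a f) Q)
      + (\<Sum>a\<in>A. if a \<in> J \<times> UNIV then gexp J m (PD (fst a, \<not> snd a) (PD a f)) Q else 0)"
    by (simp add: t sum.distrib)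
  also have "(\<Sum>a\<in>A. if a \<in> J \<times> UNIV then gexp J m (PD (fst a, \<not> snd a) (PD a f)) Q else 0)
     = (\<Sum>a\<in>J \<times> UNIV. gexp J m (PD (fst a, \<not> snd a) (PD a f)) Q)"
    using A J by (simp add: sum.If_cases Int_absorb1 flip: Int_def)
  also have "\<dots> = (\<Sum>c\<in>J. \<Sum>b\<in>UNIV. gexp J m (PD (c, \<not> b) (PD (c, b) f)) Q)"
    by (subst sum.cartesian_product) (auto simp: case_prod_beta)
  \<comment> \<open>Both slots of \<open>c\<close> lead to the same mixed derivative, hence the
    factor 2.\<close>
  also have "\<dots> = (\<Sum>c\<in>J. 2 * gexp J m (PD (c, False) (PD (c, True) f)) Q)"
    by (intro sum.cong) (auto simp: UNIV_bool PD_commute[OF f, of _ "(_, False)"])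
  also have "\<dots> = 2 * gexp J m (Lap J f) Q"
    unfolding Lap_def by (subst gexp_sum[OF A J(1)]) (auto intro!: hpol_PD f simp: sum_distrib_left)
  finally show ?thesis .
qed

text \<open>Together with \<open>Lap_commute\<close> this shows that equality of two block
  Laplacians is inherited by all functions to which the induction in \<open>gexp_exchange\<close>
  descends.\<close>

lemma PD_Lap: "hpol A d f \<Longrightarrow> PD a (Lap J f) = Lap J (PD a f)"
proof -
  assume f: "hpol A d f"
  have "PD a (Lap J f) = (\<lambda>x. \<Sum>c\<in>J. PD a (PD (c, False) (PD (c, True) f)) x)"
    unfolding Lap_def[abs_def] by (rule PD_sum[OF hpol_PD[OF hpol_PD[OF f]]])
  also have "\<dots> = (\<lambda>x. \<Sum>c\<in>J. PD (c, False) (PD (c, True) (PD a f)) x)"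
    using PD_commute[OF f, of a] PD_commute[OF hpol_PD[OF f], of a] by simp
  finally show ?thesis unfolding Lap_def[abs_def] .
qed

lemma Lap_commute: "hpol A d f \<Longrightarrow> Lap J (Lap J' f) = Lap J' (Lap J f)"
proof -
  assume f: "hpol A d f"
  have L: "Lap J (Lap J' f) = (\<lambda>x. \<Sum>c\<in>J. \<Sum>c'\<in>J'. PD (c', False) (PD (c', True) (PD (c, False) (PD (c, True) f))) x)" for J J'
    unfolding Lap_def[of J, abs_def] PD_Lap[OF f] PD_Lap[OF hpol_PD[OF f]] by (simp add: Lap_def)
  have c: "PD a (PD b (PD c (PD d f))) = PD c (PD d (PD a (PD b f)))" for a b c d
  proof -
    have "PD b (PD c (PD d f)) = PD c (PD d (PD b f))"
      using PD_commute[OF hpol_PD[OF f, of d], of b c] PD_commute[OF f, of b d] by simp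
    moreover have "PD a (PD c (PD d (PD b f))) = PD c (PD d (PD a (PD b f)))"
      using PD_commute[OF hpol_PD[OF hpol_PD[OF f, of b], of d], of a c] PD_commute[OF hpol_PD[OF f, of b], of a d]
      by simp
    ultimately show ?thesis by simp
  qed
  show ?thesis
    unfolding L by (subst sum.swap, intro ext sum.cong refl fun_cong[OF c])
qed

text \<open>Conceptually both sides are the terminating heat series of \<open>f\<close> at the
  common mean point \<open>P\<close>, in powers of the respective Laplacian. In the proof the Euler
  recursion has the same coefficients on both sides, and degree 0 is settled by total mass
  1.\<close>

theorem gexp_exchange:
  assumes A: "finite A" and f: "hpol A d f"
    and J1: "finite J1" "J1 \<times> UNIV \<subseteq> A" and J2: "finite J2" "J2 \<times> UNIV \<subseteq> A"
    and L: "\<And>x. Lap J1 f x = Lap J2 f x"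
    and P1: "P = (\<lambda>a. Q1 a + dbl J1 m1 a)" and P2: "P = (\<lambda>a. Q2 a + dbl J2 m2 a)"
  shows "gexp J1 m1 f Q1 = gexp J2 m2 f Q2"
  using f L
proof (induction d arbitrary: f rule: less_induct)
  case (less d)
  note f = less.prems(1)
  have L: "Lap J1 f = Lap J2 f" using less.prems(2) by auto
  show ?case
  proof (cases "d = 0")
    case True
    have "hpol A n h \<Longrightarrow> n = 0 \<Longrightarrow> (\<exists>k. h = (\<lambda>_. k))" for n h
    proof (induction rule: hpol.induct)
      case (hpol_add d f g)
      then obtain k l where "f = (\<lambda>_. k)" "g = (\<lambda>_. l)" by auto
      then show ?case by auto
    next
      case (hpol_mult d f e g)
      then obtain k l where "f = (\<lambda>_. k)" "g = (\<lambda>_. l)" by auto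
      then show ?case by auto
    qed auto
    then obtain k where k: "f = (\<lambda>_. k)" using True f by blast
    have "prob_space (PiM J (\<lambda>c. cgauss (m c)))" for J :: "'a set" and m
      by (rule prob_space_PiM[OF prob_space_cgauss])
    then show ?thesis by (simp add: k gexp_def prob_space.prob_space)
  next
    case False
    have PD: "gexp J1 m1 (PD a f) Q1 = gexp J2 m2 (PD a f) Q2" for a
      using False by (intro less.IH[of "d - 1"] hpol_PD[OF f]) (auto simp: L PD_Lap[OF f, symmetric])
    \<comment> \<open>One function, \<open>Lap J1 f\<close>, under both measures. Its own two block
      Laplacians agree because Laplacians commute and those of \<open>f\<close> coincide.\<close>
    have "gexp J1 m1 (Lap J1 f) Q1 = gexp J2 m2 (Lap J1 f) Q2"
      using False by (intro less.IH[of "d - 1 - 1"] hpol_Lap[OF f]) (simp, metis L Lap_commute[OF f])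
    then have "of_nat d * gexp J1 m1 f Q1 = of_nat d * gexp J2 m2 f Q2"
      unfolding gexp_euler[OF A f J1 P1] gexp_euler[OF A f J2 P2] by (simp add: PD L)
    then show ?thesis using False by simp
  qed
qed

section \<open>Derivatives of determinants and of inverse matrices\<close>

lemma fmat_mult:
  fixes A B :: "nat \<Rightarrow> nat \<Rightarrow> complex"
  shows "fmat n A * fmat n B = fmat n (\<lambda>i j. \<Sum>k<n. A i k * B k j)"
  by (rule eq_matI) (auto simp: scalar_prod_def atLeast0LessThan)

text \<open>A permutation other than the identity moves at least two indices, so after one factor
  has been differentiated an off-diagonal zero remains. Only the trace survives.\<close>

lemma det_near_one_derivative:
  fixes K :: "complex \<Rightarrow> nat \<Rightarrow> nat \<Rightarrow> complex"
  assumes K: "\<And>i j. i < n \<Longrightarrow> j < n \<Longrightarrow> ((\<lambda>t. K t i j) has_field_derivative K' i j) (at t0)"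
    and one: "\<And>i j. i < n \<Longrightarrow> j < n \<Longrightarrow> K t0 i j = (if i = j then 1 else 0)"
  shows "((\<lambda>t. det (fmat n (K t))) has_field_derivative (\<Sum>i<n. K' i i)) (at t0)"
proof -
  have "((\<lambda>t. signof p * (\<Prod>i<n. K t i (p i))) has_field_derivative
      (if p = id then (\<Sum>i<n. K' i i) else 0)) (at t0)" if p: "p permutes {..<n}" for p
  proof -
    have pn: "p i < n" if "i < n" for i using permutes_in_image[OF p] that by auto
    have "((\<lambda>t. signof p * (\<Prod>i<n. K t i (p i))) has_field_derivative
       signof p * (\<Sum>i<n. K' i (p i) * (\<Prod>y\<in>{..<n} - {i}. K t0 y (p y)))) (at t0)"
      by (intro DERIV_cmult has_field_derivative_prod K) (auto intro: pn)
    also have "signof p * (\<Sum>i<n. K' i (p i) * (\<Prod>y\<in>{..<n} - {i}. K t0 y (p y))) =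
       (if p = id then (\<Sum>i<n. K' i i) else 0)"
    proof (cases "p = id")
      case True
      then show ?thesis by (simp add: one)
    next
      case False
      then obtain a where a: "p a \<noteq> a" by (auto simp: fun_eq_iff)
      then have an: "a < n" using p by (auto simp: permutes_def)
      have "p (p a) \<noteq> p a" using a permutes_inj[OF p] by (auto dest: injD)
      have "(\<Prod>y\<in>{..<n} - {i}. K t0 y (p y)) = 0" for i
      proof (cases "i = a")
        case True
        then show ?thesis using a an pn \<open>p (p a) \<noteq> p a\<close> by (intro prod_zero bexI[of _ "p a"]) (auto simp: one)
      next
        case False
        then show ?thesis using a an pn by (intro prod_zero bexI[of _ "a"]) (auto simp: one)
      qed
      then show ?thesis using False by simp
    qed
    finally show ?thesis .
  qed
  then have "((\<lambda>t. \<Sum>p | p permutes {..<n}. signof p * (\<Prod>i<n. K t i (p i))) has_field_derivative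
     (\<Sum>p | p permutes {..<n}. (if p = id then (\<Sum>i<n. K' i i) else 0))) (at t0)"
    by (intro DERIV_sum) auto
  moreover have "(\<Sum>p | p permutes {..<n}. (if p = id then (\<Sum>i<n. K' i i) else 0)) = (\<Sum>i<n. K' i i)"
    by (subst sum.delta) (auto simp: permutes_id finite_permutations)
  ultimately show ?thesis unfolding det_fmat by simp
qed

text \<open>Jacobi's formula. Multiplying by the fixed inverse at \<open>t0\<close> moves the
  question to the identity matrix.\<close>

lemma det_derivative:
  fixes B :: "complex \<Rightarrow> nat \<Rightarrow> nat \<Rightarrow> complex"
  assumes B: "\<And>i j. i < n \<Longrightarrow> j < n \<Longrightarrow> ((\<lambda>t. B t i j) has_field_derivative B' i j) (at t0)"
    and R: "\<And>i j. i < n \<Longrightarrow> j < n \<Longrightarrow> (\<Sum>k<n. R i k * B t0 k j) = (if i = j then 1 else 0)"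
  shows "((\<lambda>t. det (fmat n (B t))) has_field_derivative
      det (fmat n (B t0)) * (\<Sum>i<n. \<Sum>j<n. R i j * B' j i)) (at t0)"
proof -
  define K where "K t i j = (\<Sum>k<n. R i k * B t k j)" for t i j
  have K: "((\<lambda>t. K t i j) has_field_derivative (\<Sum>k<n. R i k * B' k j)) (at t0)" if "i < n" "j < n" for i j
    unfolding K_def using that by (intro DERIV_sum DERIV_cmult B) auto
  have K1: "K t0 i j = (if i = j then 1 else 0)" if "i < n" "j < n" for i j
    unfolding K_def using that R by simp
  have d: "det (fmat n R) * det (fmat n (B t)) = det (fmat n (K t))" for t
    unfolding K_def fmat_mult[symmetric] by (rule det_mult[symmetric]) auto
  have "fmat n (K t0) = 1\<^sub>m n" by (rule eq_matI) (auto simp: K1)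
  then have d1: "det (fmat n R) * det (fmat n (B t0)) = 1" by (simp add: d)
  have e: "det (fmat n (B t)) = det (fmat n (B t0)) * det (fmat n (K t))" for t
    unfolding d[symmetric] using d1 by (simp add: algebra_simps)
  have "((\<lambda>t. det (fmat n (B t0)) * det (fmat n (K t))) has_field_derivative
      det (fmat n (B t0)) * (\<Sum>i<n. (\<Sum>k<n. R i k * B' k i))) (at t0)"
    by (intro DERIV_cmult det_near_one_derivative K K1)
  then show ?thesis unfolding e[symmetric] .
qed

text \<open>Differentiate \<open>R B = 1\<close>, which must hold near \<open>t0\<close> and not
  only at it, and multiply by \<open>R\<close> from the right.\<close>

lemma inverse_derivative:
  fixes B R :: "complex \<Rightarrow> nat \<Rightarrow> nat \<Rightarrow> complex"
  assumes B: "\<And>i j. i < n \<Longrightarrow> j < n \<Longrightarrow> ((\<lambda>t. B t i j) has_field_derivative B' i j) (at t0)"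
    and R': "\<And>i j. i < n \<Longrightarrow> j < n \<Longrightarrow> ((\<lambda>t. R t i j) has_field_derivative R' i j) (at t0)"
    and S: "open S" "t0 \<in> S"
    and RB: "\<And>t i j. t \<in> S \<Longrightarrow> i < n \<Longrightarrow> j < n \<Longrightarrow> (\<Sum>k<n. R t i k * B t k j) = (if i = j then 1 else 0)"
    and BR: "\<And>i j. i < n \<Longrightarrow> j < n \<Longrightarrow> (\<Sum>k<n. B t0 i k * R t0 k j) = (if i = j then 1 else 0)"
    and ij: "i < n" "j < n"
  shows "R' i j = - (\<Sum>k<n. \<Sum>l<n. R t0 i k * B' k l * R t0 l j)"
proof -
  have z: "(\<Sum>k<n. R' i k * B t0 k l) = - (\<Sum>k<n. R t0 i k * B' k l)" if l: "l < n" for l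
  proof -
    have "((\<lambda>t. \<Sum>k<n. R t i k * B t k l) has_field_derivative (\<Sum>k<n. R' i k * B t0 k l + R t0 i k * B' k l)) (at t0)"
      using l ij by (intro DERIV_sum DERIV_cong[OF DERIV_mult[OF R' B]]) (auto simp: algebra_simps)
    moreover have "((\<lambda>t. \<Sum>k<n. R t i k * B t k l) has_field_derivative 0) (at t0)"
      by (rule has_field_derivative_transform_within_open[OF DERIV_const[of "if i = l then 1 else 0"] S])
         (use RB ij l in auto)
    ultimately have "(\<Sum>k<n. R' i k * B t0 k l + R t0 i k * B' k l) = 0" by (rule DERIV_unique)
    then show ?thesis by (simp add: sum.distrib eq_neg_iff_add_eq_0)
  qed
  have "R' i j = (\<Sum>k<n. R' i k * (\<Sum>l<n. B t0 k l * R t0 l j))"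
    using ij by (simp add: BR if_distrib sum.delta' cong: if_cong)
  also have "\<dots> = (\<Sum>k<n. \<Sum>l<n. R' i k * B t0 k l * R t0 l j)"
    by (simp add: sum_distrib_left mult.assoc)
  also have "\<dots> = (\<Sum>l<n. (\<Sum>k<n. R' i k * B t0 k l) * R t0 l j)"
    by (subst sum.swap) (simp add: sum_distrib_right)
  also have "\<dots> = (\<Sum>l<n. - (\<Sum>k<n. R t0 i k * B' k l * R t0 l j))"
    by (intro sum.cong) (auto simp: z sum_distrib_right)
  also have "\<dots> = - (\<Sum>k<n. \<Sum>l<n. R t0 i k * B' k l * R t0 l j)"
    by (subst sum.swap) (simp add: sum_negf)
  finally show ?thesis .
qed

text \<open>The inverse as adjugate over determinant, so that its entries are quotients of
  \<open>hpol\<close> functions. For the characteristic matrix \<open>BB a\<close> it is the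
  resolvent.\<close>

definition res :: "nat \<Rightarrow> (nat \<Rightarrow> nat \<Rightarrow> complex) \<Rightarrow> nat \<Rightarrow> nat \<Rightarrow> complex" where
  "res n B i j = adj_mat (fmat n B) $$ (i, j) / det (fmat n B)"

lemma res_inverse:
  assumes "det (fmat n B) \<noteq> 0" "i < n" "j < n"
  shows "(\<Sum>k<n. res n B i k * B k j) = (if i = j then 1 else 0)"
    and "(\<Sum>k<n. B i k * res n B k j) = (if i = j then 1 else 0)"
proof -
  note a = adj_mat[OF mat_carrier[of n n "\<lambda>(i, j). B i j"]]
  have "(\<Sum>k<n. adj_mat (fmat n B) $$ (i, k) * B k j) = (adj_mat (fmat n B) * fmat n B) $$ (i, j)"
    using assms a(1) by (subst index_mult_mat) (auto simp: scalar_prod_def atLeast0LessThan intro!: sum.cong)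
  then show "(\<Sum>k<n. res n B i k * B k j) = (if i = j then 1 else 0)"
    using assms unfolding a(3) res_def by (simp flip: sum_divide_distrib)
  have "(\<Sum>k<n. B i k * adj_mat (fmat n B) $$ (k, j)) = (fmat n B * adj_mat (fmat n B)) $$ (i, j)"
    using assms a(1) by (subst index_mult_mat) (auto simp: scalar_prod_def atLeast0LessThan intro!: sum.cong)
  then show "(\<Sum>k<n. B i k * res n B k j) = (if i = j then 1 else 0)"
    using assms unfolding a(2) res_def by (simp flip: sum_divide_distrib)
qed

lemma hpol_adj:
  assumes "\<And>i j. i < n \<Longrightarrow> j < n \<Longrightarrow> hpol A d (\<lambda>x. B x i j)" "i < n" "j < n"
  shows "hpol A ((n - 1) * d) (\<lambda>x. adj_mat (fmat n (B x)) $$ (i, j))"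
proof -
  have eq: "adj_mat (fmat n (B x)) $$ (i, j) = (-1) ^ (j + i) *
      det (fmat (n - 1) (\<lambda>i' j'. B x (if i' < j then i' else Suc i') (if j' < i then j' else Suc j')))" for x
  proof -
    have "mat_delete (fmat n (B x)) j i =
      fmat (n - 1) (\<lambda>i' j'. B x (if i' < j then i' else Suc i') (if j' < i then j' else Suc j'))"
      using assms by (intro eq_matI) (auto simp: mat_delete_def)
    then show ?thesis using assms by (simp add: adj_mat_def cofactor_def)
  qed
  show ?thesis unfolding eq
    by (intro hpol_cmult hpol_det assms(1)) (use assms in auto)
qed

text \<open>Differentiability comes from the cofactor quotient, the value of the derivative from
  \<open>inverse_derivative\<close> on the open set where the determinant does not vanish.\<close>

lemma res_derivative:
  assumes h: "\<And>i j. i < n \<Longrightarrow> j < n \<Longrightarrow> hpol A d (\<lambda>x. B x i j)"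
    and D: "det (fmat n (B x)) \<noteq> 0"
    and B': "\<And>i j. i < n \<Longrightarrow> j < n \<Longrightarrow> PD e (\<lambda>x. B x i j) x = B' i j"
    and ij: "i < n" "j < n"
  shows "((\<lambda>t. res n (B (x(e := t))) i j) has_field_derivative
      - (\<Sum>k<n. \<Sum>l<n. res n (B x) i k * B' k l * res n (B x) l j)) (at (x e))"
proof -
  define S where "S = {t. det (fmat n (B (x(e := t)))) \<noteq> 0}"
  have dd: "((\<lambda>t. det (fmat n (B (x(e := t))))) has_field_derivative
      PD e (\<lambda>x. det (fmat n (B x))) (x(e := t))) (at t)" for t
    using hpol_has_derivative[OF hpol_det[where B = B, OF h], of n x e t] by simp
  have "open S"
    unfolding S_def using dd
    by (intro open_Collect_neq continuous_at_imp_continuous_on ballI DERIV_isCont continuous_intros)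
  moreover have "x e \<in> S" using D by (simp add: S_def)
  define R' where "R' i j = deriv (\<lambda>t. res n (B (x(e := t))) i j) (x e)" for i j
  have R': "((\<lambda>t. res n (B (x(e := t))) i j) has_field_derivative R' i j) (at (x e))"
    if "i < n" "j < n" for i j
  proof -
    have "(\<lambda>t. res n (B (x(e := t))) i j) field_differentiable (at (x e))"
      unfolding res_def using D that
      by (intro field_differentiable_divide hpol_field_differentiable[OF hpol_adj[OF h]] hpol_field_differentiable[OF hpol_det[OF h]])
         auto
    then show ?thesis unfolding R'_def by (rule field_differentiable_derivI)
  qed
  have "R' i j = - (\<Sum>k<n. \<Sum>l<n. res n (B (x(e := x e))) i k * B' k l * res n (B (x(e := x e))) l j)"
    by (rule inverse_derivative[where B = "\<lambda>t. B (x(e := t))" and R = "\<lambda>t. res n (B (x(e := t)))" and ?t0.0 = "x e",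
        OF _ R' \<open>open S\<close> \<open>x e \<in> S\<close> res_inverse(1) res_inverse(2) ij])
       (use hpol_has_derivative'[OF h, of _ _ x e] D in \<open>auto simp: S_def B'\<close>)
  then show ?thesis using R'[OF ij] by simp
qed

lemma PD_det:
  assumes h: "\<And>i j. i < n \<Longrightarrow> j < n \<Longrightarrow> hpol A d (\<lambda>x. B x i j)"
    and D: "det (fmat n (B x)) \<noteq> 0"
    and B': "\<And>i j. i < n \<Longrightarrow> j < n \<Longrightarrow> PD e (\<lambda>x. B x i j) x = B' i j"
  shows "((\<lambda>t. det (fmat n (B (x(e := t))))) has_field_derivative
     det (fmat n (B x)) * (\<Sum>i<n. \<Sum>j<n. res n (B x) i j * B' j i)) (at (x e))"
  using det_derivative[of n "\<lambda>t. B (x(e := t))" B' "x e" "res n (B x)"]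
    hpol_has_derivative'[OF h, of _ _ x e] res_inverse(1)[OF D] by (simp add: B')

text \<open>If \<open>G\<close> is the logarithmic derivative of \<open>f\<close> wherever \<open>f\<close> does not vanish, then second
  derivatives of \<open>f\<close> are products and derivatives of logarithmic derivatives.\<close>
lemma PD_PD_log:
  assumes f: "hpol A d f" and x: "f x \<noteq> 0"
    and G: "\<And>y. f y \<noteq> 0 \<Longrightarrow> PD e f y = f y * G y"
    and G': "PD e' f x = f x * G'"
    and H: "((\<lambda>t. G (x(e' := t))) has_field_derivative H) (at (x e'))"
  shows "PD e' (PD e f) x = f x * (G' * G x + H)"
proof (rule PD_I)
  define S where "S = {t. f (x(e' := t)) \<noteq> 0}"
  have "open S"
    unfolding S_def using hpol_has_derivative[OF f]
    by (intro open_Collect_neq continuous_at_imp_continuous_on ballI DERIV_isCont continuous_intros)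
  have "((\<lambda>t. f (x(e' := t)) * G (x(e' := t))) has_field_derivative f x * (G' * G x + H)) (at (x e'))"
    using DERIV_mult[OF hpol_has_derivative'[OF f, of x e'] H] by (simp add: G' algebra_simps)
  then show "((\<lambda>t. PD e f (x(e' := t))) has_field_derivative f x * (G' * G x + H)) (at (x e'))"
    by (rule has_field_derivative_transform_within_open[OF _ \<open>open S\<close>])
       (use x in \<open>auto simp: S_def G\<close>)
qed

section \<open>The Laplacians of \<open>Phi\<close>\<close>

text \<open>The rows with index below \<open>s\<close> are those of \<open>X\<close>; a row \<open>a \<in> R\<close> carries a vector whose squared length,
  up to the sign \<open>\<sigma> a\<close>, is the variable \<open>z\<^sub>a\<close>.\<close>
locale radial =
  fixes s q :: nat and \<sigma> :: "nat \<Rightarrow> complex" and R :: "nat set"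
  assumes finite_R: "finite R" and sigma: "\<And>a. \<sigma> a * \<sigma> a = 1" and disj: "\<And>a. a \<in> R \<Longrightarrow> s \<le> a"
begin

definition zz :: "nat \<Rightarrow> ((nat \<times> nat) \<times> bool \<Rightarrow> complex) \<Rightarrow> complex" where
  "zz a x = \<sigma> a * (\<Sum>c\<le>q. x ((a, c), False) * x ((a, c), True))"

definition AA :: "((nat \<times> nat) \<times> bool \<Rightarrow> complex) \<Rightarrow> nat \<Rightarrow> nat \<Rightarrow> complex" where
  "AA x i j = (\<Sum>b<s + q. x ((i, b), False) * x ((j, b), True))"

definition BB :: "nat \<Rightarrow> ((nat \<times> nat) \<times> bool \<Rightarrow> complex) \<Rightarrow> nat \<Rightarrow> nat \<Rightarrow> complex" where
  "BB a x i j = (if i = j then 1 else 0) * zz a x - AA x i j"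

definition pairs :: "(nat \<times> nat) set" where
  "pairs = {(a, b). a \<in> R \<and> b \<in> R \<and> b < a}"

text \<open>If \<open>u\<^sub>k\<close> are the eigenvalues of \<open>X X\<^sup>\<dagger>\<close>,
  this is up to sign the Vandermonde determinant of all \<open>z\<^sub>a\<close> and
  \<open>u\<^sub>k\<close> divided by that of the \<open>u\<^sub>k\<close> alone. For
  \<open>s = 0\<close> it is the plain Vandermonde determinant.\<close>

definition Phi :: "((nat \<times> nat) \<times> bool \<Rightarrow> complex) \<Rightarrow> complex" where
  "Phi x = (\<Prod>p\<in>pairs. zz (fst p) x - zz (snd p) x) * (\<Prod>a\<in>R. det (fmat s (BB a x)))"

definition vars :: "((nat \<times> nat) \<times> bool) set" where
  "vars = ({..<s} \<times> {..<s + q} \<union> R \<times> {..q}) \<times> UNIV"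

lemma finite_vars: "finite vars"
  using finite_R by (auto simp: vars_def)

lemma finite_pairs: "finite pairs"
  by (rule finite_subset[of _ "R \<times> R"]) (auto simp: pairs_def finite_R)

lemma hpol_zz: "a \<in> R \<Longrightarrow> hpol vars 2 (zz a)"
  unfolding zz_def[abs_def]
  by (intro hpol_cmult hpol_sum hpol_mult'[OF hpol_var hpol_var]) (auto simp: vars_def)

lemma hpol_AA: "i < s \<Longrightarrow> j < s \<Longrightarrow> hpol vars 2 (\<lambda>x. AA x i j)"
  unfolding AA_def
  by (intro hpol_sum hpol_mult'[OF hpol_var hpol_var]) (auto simp: vars_def)

lemma hpol_BB: "a \<in> R \<Longrightarrow> i < s \<Longrightarrow> j < s \<Longrightarrow> hpol vars 2 (\<lambda>x. BB a x i j)"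
  unfolding BB_def by (intro hpol_diff hpol_cmult hpol_zz hpol_AA)

lemma hpol_Phi: "hpol vars ((\<Sum>p\<in>pairs. 2) + (\<Sum>a\<in>R. s * 2)) Phi"
  unfolding Phi_def[abs_def]
  by (intro hpol_mult hpol_prod hpol_diff hpol_zz hpol_det hpol_BB) (auto simp: pairs_def)

lemma PD_zz: "PD ((k, c), b) (zz a) x = (if a = k \<and> c \<le> q then \<sigma> a * x ((a, c), \<not> b) else 0)"
proof (rule PD_I)
  define e where "e = ((k, c), b)"
  have 1: "((\<lambda>t. (x(e := t)) ((a, c'), b')) has_field_derivative (if a = k \<and> c' = c \<and> b' = b then 1 else 0)) (at (x e))"
    for c' b' by (auto simp: e_def)
  have "((\<lambda>t. zz a (x(e := t))) has_field_derivative
     \<sigma> a * (\<Sum>c'\<le>q. (if a = k \<and> c' = c \<and> False = b then 1 else 0) * x ((a, c'), True)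
       + (if a = k \<and> c' = c \<and> True = b then 1 else 0) * x ((a, c'), False))) (at (x e))"
    unfolding zz_def
    by (intro DERIV_cmult DERIV_sum DERIV_cong[OF DERIV_mult[OF 1 1]]) simp
  also have "(\<Sum>c'\<le>q. (if a = k \<and> c' = c \<and> False = b then 1 else 0) * x ((a, c'), True)
       + (if a = k \<and> c' = c \<and> True = b then 1 else 0) * x ((a, c'), False))
     = (\<Sum>c'\<le>q. if c' = c then (if a = k then x ((a, c), \<not> b) else 0) else 0)"
    by (intro sum.cong) auto
  also have "\<sigma> a * \<dots> = (if a = k \<and> c \<le> q then \<sigma> a * x ((a, c), \<not> b) else 0)"
    by (simp add: sum.delta)
  finally show "((\<lambda>t. zz a (x(((k, c), b) := t))) has_field_derivative
      (if a = k \<and> c \<le> q then \<sigma> a * x ((a, c), \<not> b) else 0)) (at (x ((k, c), b)))"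
    unfolding e_def .
qed

lemma PD_AA: "PD ((p, c), b) (\<lambda>x. AA x i j) x =
    (if c < s + q then (if b then (if j = p then x ((i, c), False) else 0)
      else (if i = p then x ((j, c), True) else 0)) else 0)"
proof (rule PD_I)
  define e where "e = ((p, c), b)"
  have 1: "((\<lambda>t. (x(e := t)) ((a, c'), b')) has_field_derivative (if a = p \<and> c' = c \<and> b' = b then 1 else 0)) (at (x e))"
    for a c' b' by (auto simp: e_def)
  have "((\<lambda>t. AA (x(e := t)) i j) has_field_derivative
     (\<Sum>c'<s + q. (if i = p \<and> c' = c \<and> False = b then 1 else 0) * x ((j, c'), True)
       + (if j = p \<and> c' = c \<and> True = b then 1 else 0) * x ((i, c'), False))) (at (x e))"
    unfolding AA_def
    by (intro DERIV_sum DERIV_cong[OF DERIV_mult[OF 1 1]]) simp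
  also have "(\<Sum>c'<s + q. (if i = p \<and> c' = c \<and> False = b then 1 else 0) * x ((j, c'), True)
       + (if j = p \<and> c' = c \<and> True = b then 1 else 0) * x ((i, c'), False))
     = (\<Sum>c'<s + q. if c' = c then (if b then (if j = p then x ((i, c), False) else 0)
      else (if i = p then x ((j, c), True) else 0)) else 0)"
    by (intro sum.cong) auto
  also have "\<dots> = (if c < s + q then (if b then (if j = p then x ((i, c), False) else 0)
      else (if i = p then x ((j, c), True) else 0)) else 0)"
    by (simp add: sum.delta)
  finally show "((\<lambda>t. AA (x(((p, c), b) := t)) i j) has_field_derivative
      (if c < s + q then (if b then (if j = p then x ((i, c), False) else 0)
      else (if i = p then x ((j, c), True) else 0)) else 0)) (at (x ((p, c), b)))"
    unfolding e_def .
qed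

lemma PD_BB:
  "a \<in> R \<Longrightarrow> i < s \<Longrightarrow> j < s \<Longrightarrow> PD e (\<lambda>x. BB a x i j) x = (if i = j then PD e (zz a) x else 0) - PD e (\<lambda>x. AA x i j) x"
  by (rule PD_I, unfold BB_def, rule DERIV_cong[OF DERIV_diff[OF DERIV_cmult hpol_has_derivative'[OF hpol_AA]]],
      rule hpol_has_derivative'[OF hpol_zz]) auto

abbreviation "rs a x \<equiv> res s (BB a x)"

text \<open>\<open>rho\<close> and \<open>tau\<close> are the traces of the resolvent and of its
  square; \<open>gg\<close> is the logarithmic derivative of the Vandermonde factor. As a function
  of \<open>z\<^sub>a\<close>, the logarithm of \<open>Phi\<close> has derivative
  \<open>gg + rho\<close>.\<close>

definition rho where "rho a x = (\<Sum>i<s. rs a x i i)"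
definition tau where "tau a x = (\<Sum>i<s. \<Sum>j<s. rs a x i j * rs a x j i)"
definition gg where "gg a x = (\<Sum>b\<in>R - {a}. 1 / (zz a x - zz b x))"

lemma Phi_nonzeroD:
  assumes "Phi x \<noteq> 0"
  shows "a \<in> R \<Longrightarrow> det (fmat s (BB a x)) \<noteq> 0"
    and "a \<in> R \<Longrightarrow> b \<in> R \<Longrightarrow> a \<noteq> b \<Longrightarrow> zz a x - zz b x \<noteq> 0"
proof -
  show "a \<in> R \<Longrightarrow> det (fmat s (BB a x)) \<noteq> 0"
    using assms finite_R by (auto simp: Phi_def)
  have "(\<Prod>p\<in>pairs. zz (fst p) x - zz (snd p) x) \<noteq> 0"
    using assms unfolding Phi_def by (rule contrapos_nn) simp
  then have *: "zz (fst p) x - zz (snd p) x \<noteq> 0" if "p \<in> pairs" for p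
    using finite_pairs that by (meson prod_zero)
  assume ab: "a \<in> R" "b \<in> R" "a \<noteq> b"
  then have "(a, b) \<in> pairs \<or> (b, a) \<in> pairs" by (simp add: pairs_def) arith
  then show "zz a x - zz b x \<noteq> 0"
    using *[of "(a, b)"] *[of "(b, a)"] by auto
qed

lemma PD_Phi:
  assumes "Phi x \<noteq> 0"
  shows "PD e Phi x = Phi x * ((\<Sum>(a, b)\<in>pairs. (PD e (zz a) x - PD e (zz b) x) / (zz a x - zz b x))
     + (\<Sum>a\<in>R. \<Sum>i<s. \<Sum>j<s. rs a x i j * PD e (\<lambda>x. BB a x j i) x))"
proof (rule PD_I)
  have 1: "((\<lambda>t. \<Prod>p\<in>pairs. zz (fst p) (x(e := t)) - zz (snd p) (x(e := t))) has_field_derivative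
      (\<Prod>p\<in>pairs. zz (fst p) (x(e := x e)) - zz (snd p) (x(e := x e))) *
      (\<Sum>p\<in>pairs. (PD e (zz (fst p)) x - PD e (zz (snd p)) x) / (zz (fst p) (x(e := x e)) - zz (snd p) (x(e := x e))))) (at (x e))"
    using Phi_nonzeroD(2)[OF assms]
    by (intro has_field_derivative_prod' DERIV_diff hpol_has_derivative'[OF hpol_zz]) (auto simp: pairs_def)
  have 2: "((\<lambda>t. \<Prod>a\<in>R. det (fmat s (BB a (x(e := t))))) has_field_derivative
      (\<Prod>a\<in>R. det (fmat s (BB a (x(e := x e))))) *
      (\<Sum>a\<in>R. (det (fmat s (BB a x)) * (\<Sum>i<s. \<Sum>j<s. rs a x i j * PD e (\<lambda>x. BB a x j i) x)) / det (fmat s (BB a (x(e := x e)))))) (at (x e))"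
    using Phi_nonzeroD(1)[OF assms]
    by (intro has_field_derivative_prod' PD_det[OF hpol_BB]) auto
  show "((\<lambda>t. Phi (x(e := t))) has_field_derivative Phi x * ((\<Sum>(a, b)\<in>pairs. (PD e (zz a) x - PD e (zz b) x) / (zz a x - zz b x))
     + (\<Sum>a\<in>R. \<Sum>i<s. \<Sum>j<s. rs a x i j * PD e (\<lambda>x. BB a x j i) x))) (at (x e))"
    unfolding Phi_def
    by (rule DERIV_cong[OF DERIV_mult[OF 1 2]])
       (use Phi_nonzeroD(1)[OF assms] in \<open>simp add: case_prod_beta algebra_simps\<close>)
qed

text \<open>Row \<open>k\<close> enters \<open>Phi\<close> only through \<open>zz k\<close>, so this
  is the chain rule with inner derivative \<open>\<sigma> k * x ((k, c), \<not> b)\<close>.\<close>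

lemma PD_Phi_v:
  assumes x: "Phi x \<noteq> 0" and k: "k \<in> R" and c: "c \<le> q"
  shows "PD ((k, c), b) Phi x = Phi x * (\<sigma> k * x ((k, c), \<not> b) * (gg k x + rho k x))"
proof -
  define w where "w = \<sigma> k * x ((k, c), \<not> b)"
  have "(\<Sum>(a, a')\<in>pairs. (PD ((k, c), b) (zz a) x - PD ((k, c), b) (zz a') x) / (zz a x - zz a' x))
     = (\<Sum>(a, a')\<in>pairs. (if a = k then w else 0) / (zz a x - zz a' x) - (if a' = k then w else 0) / (zz a x - zz a' x))"
    using c by (intro sum.cong) (auto simp: PD_zz w_def diff_divide_distrib)
  \<comment> \<open>Where \<open>k\<close> is the second member of a pair, the signs of numerator
    and denominator both change; each pair containing \<open>k\<close> thus contributes a reciprocal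
    \<open>1 / (z\<^sub>k - z\<^sub>b)\<close>.\<close>
  also have "\<dots> = (\<Sum>p\<in>pairs. (if fst p = k then w / (zz k x - zz (snd p) x) else 0)) + (\<Sum>p\<in>pairs. if snd p = k then w / (zz k x - zz (fst p) x) else 0)"
    unfolding sum.distrib[symmetric]
  proof (intro sum.cong refl)
    fix p assume "p \<in> pairs"
    have "- (w / (zz (fst p) x - zz k x)) = w / (zz k x - zz (fst p) x)"
      by (metis minus_diff_eq minus_divide_right)
    then show "(case p of (a, a') \<Rightarrow> (if a = k then w else 0) / (zz a x - zz a' x) - (if a' = k then w else 0) / (zz a x - zz a' x))
      = (if fst p = k then w / (zz k x - zz (snd p) x) else 0) + (if snd p = k then w / (zz k x - zz (fst p) x) else 0)"
      by (auto simp: case_prod_beta)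
  qed
  also have "(\<Sum>p\<in>pairs. (if fst p = k then w / (zz k x - zz (snd p) x) else 0)) = (\<Sum>b\<in>{b\<in>R. b < k}. w / (zz k x - zz b x))"
    unfolding sum.inter_filter[OF finite_pairs, symmetric]
    by (rule sum.reindex_bij_witness[of _ "\<lambda>b. (k, b)" snd]) (use k in \<open>auto simp: pairs_def\<close>)
  also have "(\<Sum>p\<in>pairs. (if snd p = k then w / (zz k x - zz (fst p) x) else 0)) = (\<Sum>b\<in>{b\<in>R. k < b}. w / (zz k x - zz b x))"
    unfolding sum.inter_filter[OF finite_pairs, symmetric]
    by (rule sum.reindex_bij_witness[of _ "\<lambda>b. (b, k)" fst]) (use k in \<open>auto simp: pairs_def\<close>)
  also have "(\<Sum>b\<in>{b\<in>R. b < k}. w / (zz k x - zz b x)) + (\<Sum>b\<in>{b\<in>R. k < b}. w / (zz k x - zz b x))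
     = (\<Sum>b\<in>{b\<in>R. b < k} \<union> {b\<in>R. k < b}. w / (zz k x - zz b x))"
    using finite_R by (intro sum.union_disjoint[symmetric]) auto
  also have "{b\<in>R. b < k} \<union> {b\<in>R. k < b} = R - {k}" by auto
  also have "(\<Sum>b\<in>R - {k}. w / (zz k x - zz b x)) = w * gg k x"
    by (simp add: gg_def sum_distrib_left)
  finally have 1: "(\<Sum>(a, a')\<in>pairs. (PD ((k, c), b) (zz a) x - PD ((k, c), b) (zz a') x) / (zz a x - zz a' x)) = w * gg k x" .
  have A0: "PD ((k, c), b) (\<lambda>x. AA x j i) x = 0" if "i < s" "j < s" for i j
    using disj[OF k] that by (auto simp: PD_AA)
  have "(\<Sum>a\<in>R. \<Sum>i<s. \<Sum>j<s. rs a x i j * PD ((k, c), b) (\<lambda>x. BB a x j i) x)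
    = (\<Sum>a\<in>R. if a = k then (\<Sum>i<s. \<Sum>j<s. if j = i then rs k x i i * w else 0) else 0)"
    using c by (intro sum.cong refl)
      (auto simp: PD_BB A0 PD_zz w_def if_distrib cong: if_cong)
  also have "\<dots> = w * rho k x"
    using k finite_R by (simp add: sum.delta rho_def sum_distrib_left mult.commute)
  finally show ?thesis
    unfolding PD_Phi[OF x] 1 by (simp add: w_def algebra_simps)
qed

lemma PD_Phi_X:
  assumes x: "Phi x \<noteq> 0" and p: "p < s" and c: "c < s + q"
  shows "PD ((p, c), False) Phi x = Phi x * - (\<Sum>a\<in>R. \<Sum>i<s. rs a x i p * x ((i, c), True))"
    and "PD ((p, c), True) Phi x = Phi x * - (\<Sum>a\<in>R. \<Sum>i<s. rs a x p i * x ((i, c), False))"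
proof -
  have z: "PD ((p, c), b) (zz a) x = 0" if "a \<in> R" for a b
    using disj[OF that] p by (auto simp: PD_zz)
  have z2: "(\<Sum>(a, a')\<in>pairs. (PD ((p, c), b) (zz a) x - PD ((p, c), b) (zz a') x) / (zz a x - zz a' x)) = 0" for b
    by (intro sum.neutral) (auto simp: pairs_def z)
  have "(\<Sum>a\<in>R. \<Sum>i<s. \<Sum>j<s. rs a x i j * PD ((p, c), False) (\<lambda>x. BB a x j i) x)
    = (\<Sum>a\<in>R. \<Sum>i<s. \<Sum>j<s. if j = p then - (rs a x i p * x ((i, c), True)) else 0)"
    using c by (intro sum.cong refl) (auto simp: PD_BB z PD_AA)
  also have "\<dots> = - (\<Sum>a\<in>R. \<Sum>i<s. rs a x i p * x ((i, c), True))"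
    using p by (simp add: sum.delta sum_negf)
  finally show "PD ((p, c), False) Phi x = Phi x * - (\<Sum>a\<in>R. \<Sum>i<s. rs a x i p * x ((i, c), True))"
    unfolding PD_Phi[OF x] z2 by simp
  have "(\<Sum>a\<in>R. \<Sum>i<s. \<Sum>j<s. rs a x i j * PD ((p, c), True) (\<lambda>x. BB a x j i) x)
    = (\<Sum>a\<in>R. \<Sum>i<s. \<Sum>j<s. if i = p then - (rs a x p j * x ((j, c), False)) else 0)"
    using c by (intro sum.cong refl) (auto simp: PD_BB z PD_AA)
  also have "\<dots> = - (\<Sum>a\<in>R. \<Sum>i<s. rs a x p i * x ((i, c), False))"
    using p by (subst sum.swap) (simp add: sum.delta sum_negf)
  finally show "PD ((p, c), True) Phi x = Phi x * - (\<Sum>a\<in>R. \<Sum>i<s. rs a x p i * x ((i, c), False))"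
    unfolding PD_Phi[OF x] z2 by simp
qed

text \<open>The product comes from the two logarithmic derivatives, the subtracted sum from
  differentiating the second of them. There the 1 stems from the explicit factor
  \<open>x ((p, c), False)\<close>, the double sum from the derivative of the resolvent.\<close>

lemma PD2_Phi_X:
  assumes x: "Phi x \<noteq> 0" and p: "p < s" and c: "c < s + q"
  shows "PD ((p, c), False) (PD ((p, c), True) Phi) x = Phi x *
    ((\<Sum>a\<in>R. \<Sum>i<s. rs a x i p * x ((i, c), True)) * (\<Sum>a\<in>R. \<Sum>i<s. rs a x p i * x ((i, c), False))
     - (\<Sum>a\<in>R. rs a x p p * (1 + (\<Sum>i<s. \<Sum>l<s. x ((l, c), True) * rs a x l i * x ((i, c), False)))))"
proof -
  define e where "e = ((p, c), False)"
  have D: "((\<lambda>t. rs a (x(e := t)) p i) has_field_derivative rs a x p p * (\<Sum>l<s. x ((l, c), True) * rs a x l i)) (at (x e))"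
    if a: "a \<in> R" and i: "i < s" for a i
  proof -
    have B': "PD e (\<lambda>x. BB a x k l) x = (if k = p then - x ((l, c), True) else 0)" if "k < s" "l < s" for k l
      using disj[OF a] p c that a by (auto simp: PD_BB PD_zz PD_AA e_def)
    have "((\<lambda>t. rs a (x(e := t)) p i) has_field_derivative
      - (\<Sum>k<s. \<Sum>l<s. rs a x p k * (if k = p then - x ((l, c), True) else 0) * rs a x l i)) (at (x e))"
      by (rule res_derivative[OF hpol_BB[OF a] Phi_nonzeroD(1)[OF x a] B' p i])
    also have "(\<Sum>k<s. \<Sum>l<s. rs a x p k * (if k = p then - x ((l, c), True) else 0) * rs a x l i)
       = (\<Sum>k<s. if k = p then \<Sum>l<s. - (rs a x p p * (x ((l, c), True) * rs a x l i)) else 0)"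
      by (intro sum.cong refl) (auto simp: mult_ac)
    also have "- \<dots> = rs a x p p * (\<Sum>l<s. x ((l, c), True) * rs a x l i)"
      using p by (simp add: sum.delta sum_negf sum_distrib_left)
    finally show ?thesis .
  qed
  have V: "((\<lambda>t. (x(e := t)) ((i, c), False)) has_field_derivative (if i = p then 1 else 0)) (at (x e))" for i
    by (auto simp: e_def)
  have H: "((\<lambda>t. - (\<Sum>a\<in>R. \<Sum>i<s. rs a (x(e := t)) p i * (x(e := t)) ((i, c), False))) has_field_derivative
     - (\<Sum>a\<in>R. \<Sum>i<s. rs a x p p * (\<Sum>l<s. x ((l, c), True) * rs a x l i) * x ((i, c), False) + (if i = p then rs a x p p else 0))) (at (x e))"
    by (intro DERIV_minus DERIV_sum DERIV_cong[OF DERIV_mult[OF D V]]) auto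
  have H2: "(\<Sum>a\<in>R. \<Sum>i<s. rs a x p p * (\<Sum>l<s. x ((l, c), True) * rs a x l i) * x ((i, c), False) + (if i = p then rs a x p p else 0))
     = (\<Sum>a\<in>R. rs a x p p * (1 + (\<Sum>i<s. \<Sum>l<s. x ((l, c), True) * rs a x l i * x ((i, c), False))))"
    using p by (intro sum.cong refl)
      (simp add: sum.distrib sum.delta sum_distrib_left sum_distrib_right algebra_simps)
  have "PD e (PD ((p, c), True) Phi) x = Phi x *
     (- (\<Sum>a\<in>R. \<Sum>i<s. rs a x i p * x ((i, c), True)) * - (\<Sum>a\<in>R. \<Sum>i<s. rs a x p i * x ((i, c), False))
      + - (\<Sum>a\<in>R. \<Sum>i<s. rs a x p p * (\<Sum>l<s. x ((l, c), True) * rs a x l i) * x ((i, c), False) + (if i = p then rs a x p p else 0)))"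
    by (rule PD_PD_log[OF hpol_Phi x PD_Phi_X(2)[OF _ p c] PD_Phi_X(1)[OF x p c, folded e_def] H])
  then show ?thesis unfolding H2 by (simp add: e_def)
qed

text \<open>As functions of \<open>z\<^sub>k\<close>, \<open>rho\<close> has derivative
  \<open>- tau\<close> and each reciprocal in \<open>gg\<close> the negative of its square. The two
  inner derivatives carry \<open>\<sigma> k\<close> twice, and the sign squares to 1.\<close>

lemma PD2_Phi_v:
  assumes x: "Phi x \<noteq> 0" and k: "k \<in> R" and c: "c \<le> q"
  shows "PD ((k, c), False) (PD ((k, c), True) Phi) x = Phi x *
    (\<sigma> k * (gg k x + rho k x) + x ((k, c), False) * x ((k, c), True) *
       ((gg k x + rho k x)\<^sup>2 - tau k x - (\<Sum>b\<in>R - {k}. 1 / (zz k x - zz b x)\<^sup>2)))"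
proof -
  define e where "e = ((k, c), False)"
  define w where "w = \<sigma> k * x ((k, c), True)"
  have D: "((\<lambda>t. rs k (x(e := t)) i i) has_field_derivative - (w * (\<Sum>j<s. rs k x i j * rs k x j i))) (at (x e))"
    if i: "i < s" for i
  proof -
    have B': "PD e (\<lambda>x. BB k x m l) x = (if m = l then w else 0)" if "m < s" "l < s" for m l
      using disj[OF k] c that k by (auto simp: PD_BB PD_zz PD_AA e_def w_def)
    have "((\<lambda>t. rs k (x(e := t)) i i) has_field_derivative
      - (\<Sum>m<s. \<Sum>l<s. rs k x i m * (if m = l then w else 0) * rs k x l i)) (at (x e))"
      by (rule res_derivative[OF hpol_BB[OF k] Phi_nonzeroD(1)[OF x k] B' i i])
    also have "(\<Sum>m<s. \<Sum>l<s. rs k x i m * (if m = l then w else 0) * rs k x l i)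
       = (\<Sum>m<s. \<Sum>l<s. if m = l then w * (rs k x i m * rs k x m i) else 0)"
      by (intro sum.cong refl) (auto simp: mult_ac)
    also have "- \<dots> = - (w * (\<Sum>j<s. rs k x i j * rs k x j i))"
      by (simp add: sum.delta' sum_distrib_left)
    finally show ?thesis .
  qed
  have "((\<lambda>t. rho k (x(e := t))) has_field_derivative (\<Sum>i<s. - (w * (\<Sum>j<s. rs k x i j * rs k x j i)))) (at (x e))"
    unfolding rho_def by (intro DERIV_sum D) auto
  then have rho': "((\<lambda>t. rho k (x(e := t))) has_field_derivative - (w * tau k x)) (at (x e))"
    by (simp add: tau_def sum_negf sum_distrib_left)
  have "((\<lambda>t. 1 / (zz k (x(e := t)) - zz b (x(e := t)))) has_field_derivative - w / (zz k x - zz b x)\<^sup>2) (at (x e))"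
    if b: "b \<in> R - {k}" for b
  proof -
    have kb: "zz k x - zz b x \<noteq> 0" using Phi_nonzeroD(2)[OF x k, of b] b by auto
    have d: "((\<lambda>t. zz k (x(e := t)) - zz b (x(e := t))) has_field_derivative PD e (zz k) x - PD e (zz b) x) (at (x e))"
      using b k by (intro DERIV_diff hpol_has_derivative'[OF hpol_zz]) auto
    have pd: "PD e (zz k) x - PD e (zz b) x = w"
      using b c by (auto simp: PD_zz e_def w_def)
    have "((\<lambda>t. inverse (zz k (x(e := t)) - zz b (x(e := t)))) has_field_derivative
        - (inverse (zz k x - zz b x) * w * inverse (zz k x - zz b x))) (at (x e))"
      using DERIV_inverse'[OF d] kb by (simp add: pd)
    then show ?thesis by (simp add: divide_inverse power2_eq_square mult_ac)
  qed
  then have gg': "((\<lambda>t. gg k (x(e := t))) has_field_derivative (\<Sum>b\<in>R - {k}. - w / (zz k x - zz b x)\<^sup>2)) (at (x e))"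
    unfolding gg_def by (intro DERIV_sum)
  have V: "((\<lambda>t. \<sigma> k * (x(e := t)) ((k, c), False)) has_field_derivative \<sigma> k * 1) (at (x e))"
    by (intro DERIV_cmult) (auto simp: e_def)
  have H: "((\<lambda>t. \<sigma> k * (x(e := t)) ((k, c), False) * (gg k (x(e := t)) + rho k (x(e := t)))) has_field_derivative
     \<sigma> k * (gg k x + rho k x) - \<sigma> k * x ((k, c), False) * w * (tau k x + (\<Sum>b\<in>R - {k}. 1 / (zz k x - zz b x)\<^sup>2))) (at (x e))"
    by (rule DERIV_cong[OF DERIV_mult[OF V DERIV_add[OF gg' rho']]])
       (simp add: e_def algebra_simps sum_negf sum_distrib_left)
  have sw: "\<sigma> k * y * w = y * x ((k, c), True)" for y
    using sigma[of k] by (simp add: w_def algebra_simps)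
  have G: "PD ((k, c), True) Phi y = Phi y * (\<sigma> k * y ((k, c), False) * (gg k y + rho k y))" if "Phi y \<noteq> 0" for y
    using PD_Phi_v[OF that k c, of True] by simp
  have G': "PD e Phi x = Phi x * (w * (gg k x + rho k x))"
    using PD_Phi_v[OF x k c, of False] by (simp add: e_def w_def)
  have "PD e (PD ((k, c), True) Phi) x = Phi x * (w * (gg k x + rho k x) * (\<sigma> k * x ((k, c), False) * (gg k x + rho k x))
     + (\<sigma> k * (gg k x + rho k x) - \<sigma> k * x ((k, c), False) * w * (tau k x + (\<Sum>b\<in>R - {k}. 1 / (zz k x - zz b x)\<^sup>2))))"
    by (rule PD_PD_log[OF hpol_Phi x G G' H])
  also have "w * (gg k x + rho k x) * (\<sigma> k * x ((k, c), False) * (gg k x + rho k x))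
    = (\<sigma> k * x ((k, c), False) * w) * (gg k x + rho k x)\<^sup>2"
    by (simp add: power2_eq_square mult_ac)
  finally show ?thesis unfolding sw by (simp add: e_def algebra_simps)
qed

end

lemma sum_off_diagonal_swap:
  fixes f :: "'a \<Rightarrow> 'a \<Rightarrow> 'b::comm_monoid_add"
  assumes "finite R"
  shows "(\<Sum>a\<in>R. \<Sum>b\<in>R - {a}. f a b) = (\<Sum>a\<in>R. \<Sum>b\<in>R - {a}. f b a)"
proof -
  have e: "(\<Sum>b\<in>R - {a}. g b) = (\<Sum>b\<in>R. if a \<noteq> b then g b else 0)" for a and g :: "'a \<Rightarrow> 'b"
    using assms by (intro sum.mono_neutral_cong_left) auto
  show ?thesis unfolding e by (subst sum.swap) (intro sum.cong refl, auto)
qed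

text \<open>The two halves of the numerator contribute equally: interchanging \<open>a\<close> and
  \<open>b\<close> changes the sign of the denominator.\<close>

lemma sum_reciprocal_differences:
  fixes z :: "'a \<Rightarrow> complex"
  assumes "finite R"
  shows "(\<Sum>a\<in>R. \<Sum>b\<in>R - {a}. (h a - h b) / (z b - z a)) =
    - 2 * (\<Sum>a\<in>R. h a * (\<Sum>b\<in>R - {a}. 1 / (z a - z b)))"
proof -
  define S where "S = (\<Sum>a\<in>R. h a * (\<Sum>b\<in>R - {a}. 1 / (z a - z b)))"
  have S: "S = (\<Sum>a\<in>R. \<Sum>b\<in>R - {a}. h a / (z a - z b))"
    by (simp add: S_def sum_distrib_left)
  have "(h a - h b) / (z b - z a) = - (h a / (z a - z b)) - h b / (z b - z a)" for a b
    by (metis diff_divide_distrib minus_diff_eq minus_divide_right)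
  then have "(\<Sum>a\<in>R. \<Sum>b\<in>R - {a}. (h a - h b) / (z b - z a)) =
     - S - (\<Sum>a\<in>R. \<Sum>b\<in>R - {a}. h b / (z b - z a))"
    unfolding S by (simp add: sum_subtractf sum_negf)
  also have "(\<Sum>a\<in>R. \<Sum>b\<in>R - {a}. h b / (z b - z a)) = S"
    unfolding S by (rule sum_off_diagonal_swap[OF assms])
  finally show ?thesis unfolding S_def by simp
qed

lemma sum_reciprocal_antisym:
  fixes z :: "'a \<Rightarrow> complex"
  assumes "finite R"
  shows "(\<Sum>a\<in>R. \<Sum>b\<in>R - {a}. 1 / (z a - z b)) = 0"
  using sum_reciprocal_differences[OF assms, of "\<lambda>_. 1" z] by simp

text \<open>The cyclic sum of \<open>z a / ((z a - z b) * (z a - z c))\<close> vanishes.\<close>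
lemma sum_triple_reciprocals:
  fixes z :: "'a \<Rightarrow> complex"
  assumes R: "finite R" and inj: "\<And>a b. a \<in> R \<Longrightarrow> b \<in> R \<Longrightarrow> a \<noteq> b \<Longrightarrow> z a - z b \<noteq> 0"
  shows "(\<Sum>a\<in>R. z a * ((\<Sum>b\<in>R - {a}. 1 / (z a - z b))\<^sup>2 - (\<Sum>b\<in>R - {a}. 1 / (z a - z b)\<^sup>2))) = 0"
proof -
  define e where "e a b = (if a = b then 0 else 1 / (z a - z b))" for a b
  have e1: "(\<Sum>b\<in>R - {a}. 1 / (z a - z b)) = (\<Sum>b\<in>R. e a b)" for a
    using R by (intro sum.mono_neutral_cong_left) (auto simp: e_def)
  have e2: "(\<Sum>b\<in>R - {a}. 1 / (z a - z b)\<^sup>2) = (\<Sum>b\<in>R. e a b * e a b)" for a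
    using R by (intro sum.mono_neutral_cong_left) (auto simp: e_def power2_eq_square)
  \<comment> \<open>The square minus its diagonal runs over ordered pairs
    \<open>b \<noteq> c\<close>. With \<open>e\<close> zero on the diagonal, \<open>f\<close> is
    supported on triples of distinct indices, whose sum can be rotated cyclically.\<close>
  define f where "f a b c = (if b = c then 0 else z a * e a b * e a c)" for a b c
  have sq: "z a * ((\<Sum>b\<in>R. e a b)\<^sup>2 - (\<Sum>b\<in>R. e a b * e a b)) = (\<Sum>b\<in>R. \<Sum>c\<in>R. f a b c)" for a
  proof -
    have "(\<Sum>b\<in>R. \<Sum>c\<in>R. f a b c) = (\<Sum>b\<in>R. \<Sum>c\<in>R. z a * e a b * e a c - (if b = c then z a * e a b * e a b else 0))"
      by (intro sum.cong refl) (simp add: f_def)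
    also have "\<dots> = z a * (\<Sum>b\<in>R. \<Sum>c\<in>R. e a b * e a c) - z a * (\<Sum>b\<in>R. e a b * e a b)"
      using R by (simp add: sum_subtractf sum_distrib_left sum.delta' mult.assoc)
    finally show ?thesis by (simp add: power2_eq_square sum_product right_diff_distrib)
  qed
  have cyc: "f a b c + f b c a + f c a b = 0" if "a \<in> R" "b \<in> R" "c \<in> R" for a b c
  proof (cases "a \<noteq> b \<and> b \<noteq> c \<and> a \<noteq> c")
    case True
    define u v w where "u = z a - z b" and "v = z b - z c" and "w = z a - z c"
    have nz: "u \<noteq> 0" "v \<noteq> 0" "w \<noteq> 0" using True inj that by (auto simp: u_def v_def w_def)
    have "e a b = 1 / u" "e a c = 1 / w" "e b c = 1 / v" "e b a = 1 / (- u)" "e c b = 1 / (- v)" "e c a = 1 / (- w)"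
      using True by (auto simp: e_def u_def v_def w_def)
    then have fs: "f a b c = z a / (u * w)" "f b c a = - z b / (v * u)" "f c a b = z c / (w * v)"
      using True by (auto simp: f_def)
    have "f a b c + f b c a + f c a b = (z a * v - z b * w + z c * u) / (u * v * w)"
      unfolding fs using nz by (simp add: field_simps)
    also have "z a * v - z b * w + z c * u = 0" by (simp add: u_def v_def w_def algebra_simps)
    finally show ?thesis by simp
  next
    case False
    then show ?thesis by (auto simp: f_def e_def)
  qed
  define S where "S = (\<Sum>a\<in>R. \<Sum>b\<in>R. \<Sum>c\<in>R. f a b c)"
  have S1: "S = (\<Sum>a\<in>R. \<Sum>b\<in>R. \<Sum>c\<in>R. f c a b)"
  proof -
    have "(\<Sum>a\<in>R. \<Sum>b\<in>R. \<Sum>c\<in>R. f c a b) = (\<Sum>a\<in>R. \<Sum>c\<in>R. \<Sum>b\<in>R. f c a b)" by (intro sum.cong refl sum.swap)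
    also have "\<dots> = (\<Sum>c\<in>R. \<Sum>a\<in>R. \<Sum>b\<in>R. f c a b)" by (rule sum.swap)
    finally show ?thesis by (simp add: S_def)
  qed
  have S2: "S = (\<Sum>a\<in>R. \<Sum>b\<in>R. \<Sum>c\<in>R. f b c a)"
  proof -
    have "(\<Sum>a\<in>R. \<Sum>b\<in>R. \<Sum>c\<in>R. f b c a) = (\<Sum>b\<in>R. \<Sum>a\<in>R. \<Sum>c\<in>R. f b c a)" by (rule sum.swap)
    also have "\<dots> = (\<Sum>b\<in>R. \<Sum>c\<in>R. \<Sum>a\<in>R. f b c a)" by (intro sum.cong refl sum.swap)
    finally show ?thesis by (simp add: S_def)
  qed
  have "S + S + S = (\<Sum>a\<in>R. \<Sum>b\<in>R. \<Sum>c\<in>R. f a b c + f b c a + f c a b)"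
    by (subst (3) S1, subst (2) S2, unfold S_def) (simp add: sum.distrib)
  also have "\<dots> = 0" by (intro sum.neutral ballI cyc)
  finally have "S = 0" by simp
  then show ?thesis unfolding e1 e2 sq S_def .
qed

context radial begin

definition TT where "TT a b x = (\<Sum>i<s. \<Sum>j<s. rs a x i j * rs b x j i)"

text \<open>A rearrangement of \<open>(z - A) R = 1\<close>. It eliminates the matrix
  \<open>AA\<close> from the Laplacian in favour of resolvents.\<close>

lemma sum_AA_rs:
  assumes x: "Phi x \<noteq> 0" and a: "a \<in> R" and ij: "i < s" "j < s"
  shows "(\<Sum>k<s. AA x i k * rs a x k j) = zz a x * rs a x i j - (if i = j then 1 else 0)"
    and "(\<Sum>k<s. rs a x i k * AA x k j) = zz a x * rs a x i j - (if i = j then 1 else 0)"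
proof -
  note inv = res_inverse[OF Phi_nonzeroD(1)[OF x a] ij]
  have "(\<Sum>k<s. BB a x i k * rs a x k j) = (\<Sum>k<s. (if i = k then zz a x * rs a x i j else 0) - AA x i k * rs a x k j)"
    by (intro sum.cong) (auto simp: BB_def algebra_simps)
  then show "(\<Sum>k<s. AA x i k * rs a x k j) = zz a x * rs a x i j - (if i = j then 1 else 0)"
    using inv(2) ij by (simp add: sum_subtractf sum.delta' algebra_simps)
  have "(\<Sum>k<s. rs a x i k * BB a x k j) = (\<Sum>k<s. (if k = j then zz a x * rs a x i j else 0) - rs a x i k * AA x k j)"
    by (intro sum.cong) (auto simp: BB_def algebra_simps)
  then show "(\<Sum>k<s. rs a x i k * AA x k j) = zz a x * rs a x i j - (if i = j then 1 else 0)"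
    using inv(1) ij by (simp add: sum_subtractf sum.delta algebra_simps)
qed

text \<open>The trace of the resolvent identity \<open>R\<^sub>a - R\<^sub>b = (z\<^sub>b -
  z\<^sub>a) R\<^sub>a R\<^sub>b\<close>.\<close>

lemma TT_eq:
  assumes x: "Phi x \<noteq> 0" and a: "a \<in> R" and b: "b \<in> R"
  shows "(zz b x - zz a x) * TT a b x = rho a x - rho b x"
proof -
  have "(zz b x - zz a x) * (\<Sum>j<s. rs a x i j * rs b x j i) = rs a x i i - rs b x i i" if i: "i < s" for i
  proof -
    have "zz b x * (\<Sum>j<s. rs a x i j * rs b x j i) = (\<Sum>j<s. rs a x i j * (zz b x * rs b x j i))"
      by (simp add: sum_distrib_left mult_ac)
    also have "\<dots> = (\<Sum>j<s. rs a x i j * ((\<Sum>k<s. AA x j k * rs b x k i) + (if j = i then 1 else 0)))"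
      using i by (intro sum.cong refl) (simp add: sum_AA_rs[OF x b])
    also have "\<dots> = (\<Sum>j<s. \<Sum>k<s. rs a x i j * AA x j k * rs b x k i) + (\<Sum>j<s. if j = i then rs a x i i else 0)"
      unfolding sum.distrib[symmetric] by (intro sum.cong refl) (auto simp: sum_distrib_left algebra_simps)
    also have "(\<Sum>j<s. \<Sum>k<s. rs a x i j * AA x j k * rs b x k i) = (\<Sum>k<s. (\<Sum>j<s. rs a x i j * AA x j k) * rs b x k i)"
      by (subst sum.swap) (simp add: sum_distrib_right)
    also have "\<dots> = (\<Sum>k<s. (zz a x * rs a x i k) * rs b x k i - (if i = k then rs b x i i else 0))"
      using i by (intro sum.cong refl) (auto simp: sum_AA_rs(2)[OF x a] left_diff_distrib)
    finally show ?thesis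
      using i by (simp add: sum_subtractf sum.delta sum.delta' sum_distrib_left algebra_simps)
  qed
  then show ?thesis
    by (simp add: TT_def rho_def sum_distrib_left sum_subtractf[symmetric])
qed

text \<open>Summing over the columns first contracts products of coordinates to \<open>AA\<close>,
  which \<open>sum_AA_rs\<close> turns into traces. The constant \<open>q\<close> is the number
  \<open>s + q\<close> of columns minus the trace \<open>s\<close> of the identity matrix.\<close>

lemma Lap_X:
  assumes x: "Phi x \<noteq> 0"
  shows "Lap ({..<s} \<times> {..<s + q}) Phi x = Phi x *
    ((\<Sum>a\<in>R. \<Sum>b\<in>R. zz a x * TT a b x - rho b x) - (\<Sum>a\<in>R. rho a x * (of_nat q + zz a x * rho a x)))"
proof -
  have A: "(\<Sum>c<s + q. x ((i, c), False) * x ((j, c), True)) = AA x i j" for i j by (simp add: AA_def)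
  have "(\<Sum>p<s. \<Sum>c<s + q. (\<Sum>a\<in>R. \<Sum>i<s. rs a x i p * x ((i, c), True)) * (\<Sum>b\<in>R. \<Sum>j<s. rs b x p j * x ((j, c), False)))
     = (\<Sum>a\<in>R. \<Sum>b\<in>R. \<Sum>p<s. \<Sum>j<s. rs b x p j * (\<Sum>i<s. AA x j i * rs a x i p))"
  proof -
    have "(\<Sum>p<s. \<Sum>c<s + q. (\<Sum>a\<in>R. \<Sum>i<s. rs a x i p * x ((i, c), True)) * (\<Sum>b\<in>R. \<Sum>j<s. rs b x p j * x ((j, c), False)))
      = (\<Sum>p<s. \<Sum>c<s + q. \<Sum>a\<in>R. \<Sum>b\<in>R. \<Sum>j<s. \<Sum>i<s. rs b x p j * rs a x i p * (x ((j, c), False) * x ((i, c), True)))"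
    proof -
      have "(\<Sum>a\<in>R. \<Sum>i<s. F a i) * (\<Sum>b\<in>R. \<Sum>j<s. G b j) = (\<Sum>a\<in>R. \<Sum>b\<in>R. \<Sum>j<s. \<Sum>i<s. F a i * G b j)"
        for F G :: "nat \<Rightarrow> nat \<Rightarrow> complex"
        by (subst sum_product, intro sum.cong refl, subst sum_product, rule sum.swap)
      note P = this
      show ?thesis by (intro sum.cong refl, subst P, intro sum.cong refl, simp only: mult_ac)
    qed
    \<comment> \<open>The sums over \<open>a\<close> and \<open>b\<close> move to the front and the
      one over the column \<open>c\<close> becomes innermost, where it contracts to
      \<open>AA\<close>.\<close>
    also have "\<dots> = (\<Sum>a\<in>R. \<Sum>b\<in>R. \<Sum>p<s. \<Sum>j<s. \<Sum>i<s. \<Sum>c<s + q. rs b x p j * rs a x i p * (x ((j, c), False) * x ((i, c), True)))"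
      apply (subst sum.swap[of _ R "{..<s + q}"])
      apply (subst sum.swap[of _ R "{..<s}"])
      apply (rule sum.cong[OF refl])
      apply (subst sum.swap[of _ R "{..<s + q}"])
      apply (subst sum.swap[of _ R "{..<s}"])
      apply (rule sum.cong[OF refl])
      apply (rule sum.cong[OF refl])
      apply (subst sum.swap[of _ "{..<s}" "{..<s + q}"])
      apply (rule sum.cong[OF refl])
      apply (subst sum.swap[of _ "{..<s}" "{..<s + q}"])
      apply (rule refl)
      done
    also have "\<dots> = (\<Sum>a\<in>R. \<Sum>b\<in>R. \<Sum>p<s. \<Sum>j<s. rs b x p j * (\<Sum>i<s. AA x j i * rs a x i p))"
      by (simp add: sum_distrib_left[symmetric] A mult.assoc mult.commute[of "rs _ x _ _" "AA x _ _"])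
    finally show ?thesis .
  qed
  also have "\<dots> = (\<Sum>a\<in>R. \<Sum>b\<in>R. zz a x * TT a b x - rho b x)"
  proof (intro sum.cong refl)
    fix a b assume ab: "a \<in> R" "b \<in> R"
    have "(\<Sum>p<s. \<Sum>j<s. rs b x p j * (\<Sum>i<s. AA x j i * rs a x i p))
      = (\<Sum>p<s. \<Sum>j<s. zz a x * (rs a x j p * rs b x p j) - (if j = p then rs b x p p else 0))"
      by (intro sum.cong refl) (auto simp: sum_AA_rs[OF x ab(1)] algebra_simps)
    also have "\<dots> = (\<Sum>p<s. \<Sum>j<s. zz a x * (rs a x j p * rs b x p j)) - rho b x"
      by (simp add: sum_subtractf sum.delta rho_def)
    also have "(\<Sum>p<s. \<Sum>j<s. zz a x * (rs a x j p * rs b x p j)) = zz a x * TT a b x"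
      unfolding TT_def by (subst sum.swap) (simp add: sum_distrib_left)
    finally show "(\<Sum>p<s. \<Sum>j<s. rs b x p j * (\<Sum>i<s. AA x j i * rs a x i p)) = zz a x * TT a b x - rho b x" .
  qed
  finally have 1: "(\<Sum>p<s. \<Sum>c<s + q. (\<Sum>a\<in>R. \<Sum>i<s. rs a x i p * x ((i, c), True)) * (\<Sum>b\<in>R. \<Sum>j<s. rs b x p j * x ((j, c), False)))
     = (\<Sum>a\<in>R. \<Sum>b\<in>R. zz a x * TT a b x - rho b x)" .
  have "(\<Sum>p<s. \<Sum>c<s + q. \<Sum>a\<in>R. rs a x p p * (1 + (\<Sum>i<s. \<Sum>l<s. x ((l, c), True) * rs a x l i * x ((i, c), False))))
     = (\<Sum>a\<in>R. rho a x * (of_nat q + zz a x * rho a x))"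
  proof -
    have "(\<Sum>p<s. \<Sum>c<s + q. \<Sum>a\<in>R. rs a x p p * (1 + (\<Sum>i<s. \<Sum>l<s. x ((l, c), True) * rs a x l i * x ((i, c), False))))
      = (\<Sum>a\<in>R. rho a x * (\<Sum>c<s + q. 1 + (\<Sum>i<s. \<Sum>l<s. x ((l, c), True) * rs a x l i * x ((i, c), False))))"
      unfolding rho_def sum_product
      apply (subst sum.swap[of _ R "{..<s + q}"])
      apply (subst sum.swap[of _ R "{..<s}"])
      apply (rule refl)
      done
    also have "\<dots> = (\<Sum>a\<in>R. rho a x * (of_nat q + zz a x * rho a x))"
    proof (intro sum.cong refl arg_cong2[where f = "(*)"])
      fix a assume a: "a \<in> R"
      have "(\<Sum>c<s + q. \<Sum>i<s. \<Sum>l<s. x ((l, c), True) * rs a x l i * x ((i, c), False))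
        = (\<Sum>i<s. \<Sum>l<s. \<Sum>c<s + q. rs a x l i * (x ((i, c), False) * x ((l, c), True)))"
        apply (subst sum.swap[of _ "{..<s}" "{..<s + q}"])
        apply (rule sum.cong[OF refl])
        apply (subst sum.swap[of _ "{..<s}" "{..<s + q}"])
        apply (simp add: mult_ac)
        done
      also have "\<dots> = (\<Sum>l<s. \<Sum>i<s. rs a x l i * AA x i l)"
        by (subst sum.swap) (simp add: sum_distrib_left[symmetric] A)
      also have "\<dots> = zz a x * rho a x - of_nat s"
        by (simp add: sum_AA_rs[OF x a] sum_subtractf rho_def sum_distrib_left)
      finally show "(\<Sum>c<s + q. 1 + (\<Sum>i<s. \<Sum>l<s. x ((l, c), True) * rs a x l i * x ((i, c), False))) = of_nat q + zz a x * rho a x"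
        by (simp add: sum.distrib)
    qed
    finally show ?thesis .
  qed
  note 2 = this
  have "Lap ({..<s} \<times> {..<s + q}) Phi x = (\<Sum>p<s. \<Sum>c<s + q. PD ((p, c), False) (PD ((p, c), True) Phi) x)"
    unfolding Lap_def by (simp add: sum.cartesian_product case_prod_beta)
  also have "\<dots> = (\<Sum>p<s. \<Sum>c<s + q. Phi x *
    ((\<Sum>a\<in>R. \<Sum>i<s. rs a x i p * x ((i, c), True)) * (\<Sum>a\<in>R. \<Sum>i<s. rs a x p i * x ((i, c), False))
     - (\<Sum>a\<in>R. rs a x p p * (1 + (\<Sum>i<s. \<Sum>l<s. x ((l, c), True) * rs a x l i * x ((i, c), False))))))"
    by (intro sum.cong refl PD2_Phi_X[OF x]) auto
  also have "\<dots> = Phi x * ((\<Sum>p<s. \<Sum>c<s + q. (\<Sum>a\<in>R. \<Sum>i<s. rs a x i p * x ((i, c), True)) * (\<Sum>b\<in>R. \<Sum>j<s. rs b x p j * x ((j, c), False)))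
    - (\<Sum>p<s. \<Sum>c<s + q. \<Sum>a\<in>R. rs a x p p * (1 + (\<Sum>i<s. \<Sum>l<s. x ((l, c), True) * rs a x l i * x ((i, c), False)))))"
    by (simp only: sum_distrib_left[symmetric] sum_subtractf)
  finally show ?thesis unfolding 1 2 .
qed

text \<open>The extra factor \<open>\<sigma> k\<close> cancels the sign of the first-order term and
  completes the sum of products of conjugate coordinates to \<open>zz k x\<close>.\<close>

lemma Lap_v:
  assumes x: "Phi x \<noteq> 0" and k: "k \<in> R"
  shows "\<sigma> k * Lap ({k} \<times> {..q}) Phi x = Phi x *
    (of_nat (Suc q) * (gg k x + rho k x) + zz k x *
       ((gg k x + rho k x)\<^sup>2 - tau k x - (\<Sum>b\<in>R - {k}. 1 / (zz k x - zz b x)\<^sup>2)))"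
proof -
  define K where "K = (gg k x + rho k x)\<^sup>2 - tau k x - (\<Sum>b\<in>R - {k}. 1 / (zz k x - zz b x)\<^sup>2)"
  have "Lap ({k} \<times> {..q}) Phi x = (\<Sum>p\<in>{k}. \<Sum>c\<le>q. PD ((p, c), False) (PD ((p, c), True) Phi) x)"
    unfolding Lap_def by (subst sum.cartesian_product) (simp add: case_prod_beta)
  also have "\<dots> = (\<Sum>c\<le>q. Phi x * (\<sigma> k * (gg k x + rho k x) + x ((k, c), False) * x ((k, c), True) * K))"
    unfolding K_def using k by (simp add: PD2_Phi_v[OF x k])
  also have "\<dots> = Phi x * (of_nat (Suc q) * (\<sigma> k * (gg k x + rho k x)) + (\<Sum>c\<le>q. x ((k, c), False) * x ((k, c), True)) * K)"
    by (simp add: sum_distrib_left[symmetric] sum.distrib sum_distrib_right)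
  finally have "\<sigma> k * Lap ({k} \<times> {..q}) Phi x = Phi x * (of_nat (Suc q) * ((\<sigma> k * \<sigma> k) * (gg k x + rho k x)) + zz k x * K)"
    by (simp add: zz_def algebra_simps)
  then show ?thesis by (simp add: sigma K_def)
qed

text \<open>All terms with \<open>rho\<close> or \<open>tau\<close> cancel. In the \<open>X\<close>
  part \<open>rho a\<close> occurs \<open>q\<close> times explicitly and once more from
  \<open>b = a\<close>, which is why the vectors need \<open>q + 1\<close> components. The rest is a
  function of the \<open>z\<^sub>a\<close> and vanishes by the two reciprocal sums above.\<close>

lemma Lap_generic:
  assumes x: "Phi x \<noteq> 0"
  shows "Lap ({..<s} \<times> {..<s + q}) Phi x + (\<Sum>a\<in>R. \<sigma> a * Lap ({a} \<times> {..q}) Phi x) = 0"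
proof -
  define z where "z a = zz a x" for a
  define \<rho> where "\<rho> a = rho a x" for a
  define g where "g a = gg a x" for a
  define \<tau> where "\<tau> a = tau a x" for a
  define e where "e a = (\<Sum>b\<in>R - {a}. 1 / (z a - z b)\<^sup>2)" for a
  have g: "g a = (\<Sum>b\<in>R - {a}. 1 / (z a - z b))" for a by (simp add: g_def z_def gg_def)
  have inj: "z a - z b \<noteq> 0" if "a \<in> R" "b \<in> R" "a \<noteq> b" for a b
    using Phi_nonzeroD(2)[OF x that] by (simp add: z_def)
  \<comment> \<open>The resolvent identity brings each off-diagonal term to the form required by
    \<open>sum_reciprocal_differences\<close>, with \<open>h a = z a * \<rho> a\<close>.\<close>
  have T: "z a * TT a b x - \<rho> b = (z a * \<rho> a - z b * \<rho> b) / (z b - z a)" if "a \<in> R" "b \<in> R" "a \<noteq> b" for a b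
  proof -
    have "TT a b x = (\<rho> a - \<rho> b) / (z b - z a)"
      using TT_eq[OF x that(1,2)] inj[OF that(2,1)] that(3) by (simp add: \<rho>_def z_def field_simps)
    then have "z a * TT a b x - \<rho> b = z a * ((\<rho> a - \<rho> b) / (z b - z a)) - \<rho> b" by simp
    also have "\<dots> = (z a * \<rho> a - z b * \<rho> b) / (z b - z a)"
      using inj[OF that(2,1)] that(3) by (simp add: field_simps)
    finally show ?thesis .
  qed
  have Taa: "TT a a x = \<tau> a" for a by (simp add: TT_def \<tau>_def tau_def)
  have "(\<Sum>a\<in>R. \<Sum>b\<in>R. z a * TT a b x - \<rho> b) = (\<Sum>a\<in>R. (z a * \<tau> a - \<rho> a) + (\<Sum>b\<in>R - {a}. (z a * \<rho> a - z b * \<rho> b) / (z b - z a)))"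
    using finite_R by (intro sum.cong refl) (subst sum.remove, auto simp: Taa T intro!: sum.cong)
  also have "\<dots> = (\<Sum>a\<in>R. z a * \<tau> a - \<rho> a) - 2 * (\<Sum>a\<in>R. z a * \<rho> a * g a)"
    unfolding sum.distrib sum_reciprocal_differences[OF finite_R, of "\<lambda>a. z a * \<rho> a" z] g by simp
  finally have 1: "(\<Sum>a\<in>R. \<Sum>b\<in>R. z a * TT a b x - \<rho> b) = (\<Sum>a\<in>R. z a * \<tau> a - \<rho> a) - 2 * (\<Sum>a\<in>R. z a * \<rho> a * g a)" .
  have 2: "(\<Sum>a\<in>R. g a) = 0"
    unfolding g by (rule sum_reciprocal_antisym[OF finite_R])
  have 3: "(\<Sum>a\<in>R. z a * ((g a)\<^sup>2 - e a)) = 0"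
    unfolding g e_def by (rule sum_triple_reciprocals[OF finite_R inj])
  define V where "V a = of_nat (Suc q) * (g a + \<rho> a) + z a * ((g a + \<rho> a)\<^sup>2 - \<tau> a - e a)" for a
  have V: "(\<Sum>a\<in>R. \<sigma> a * Lap ({a} \<times> {..q}) Phi x) = Phi x * (\<Sum>a\<in>R. V a)"
    unfolding sum_distrib_left V_def
    by (intro sum.cong refl) (simp only: Lap_v[OF x] z_def \<rho>_def g_def \<tau>_def e_def)
  have X: "Lap ({..<s} \<times> {..<s + q}) Phi x =
      Phi x * ((\<Sum>a\<in>R. \<Sum>b\<in>R. z a * TT a b x - \<rho> b) - (\<Sum>a\<in>R. \<rho> a * (of_nat q + z a * \<rho> a)))"
    unfolding Lap_X[OF x] z_def \<rho>_def ..
  have "((\<Sum>a\<in>R. \<Sum>b\<in>R. z a * TT a b x - \<rho> b) - (\<Sum>a\<in>R. \<rho> a * (of_nat q + z a * \<rho> a))) + (\<Sum>a\<in>R. V a)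
      = (\<Sum>a\<in>R. ((z a * \<tau> a - \<rho> a) - 2 * (z a * \<rho> a * g a) - \<rho> a * (of_nat q + z a * \<rho> a)) + V a)"
    unfolding 1 by (simp only: sum_distrib_left sum_subtractf[symmetric] sum.distrib[symmetric])
  also have "\<dots> = (\<Sum>a\<in>R. of_nat (Suc q) * g a + z a * ((g a)\<^sup>2 - e a))"
    by (intro sum.cong refl) (simp add: V_def power2_eq_square algebra_simps)
  also have "\<dots> = of_nat (Suc q) * (\<Sum>a\<in>R. g a) + (\<Sum>a\<in>R. z a * ((g a)\<^sup>2 - e a))"
    by (simp only: sum.distrib sum_distrib_left)
  also have "\<dots> = 0" unfolding 2 3 by simp
  finally show ?thesis unfolding X V distrib_left[symmetric] by simp
qed

lemma Phi_generic_point: "\<exists>w. Phi w \<noteq> 0"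
proof -
  \<comment> \<open>At \<open>X = 0\<close> the determinants are powers of the
    \<open>z\<^sub>a\<close>, so distinct nonzero values suffice. The conjugate slot
    \<open>\<sigma> a\<close> cancels the sign in \<open>zz\<close>, leaving
    \<open>Suc a\<close>.\<close>
  define w :: "(nat \<times> nat) \<times> bool \<Rightarrow> complex" where
    "w = (\<lambda>((a, c), b). if a \<in> R \<and> c = 0 then (if b then \<sigma> a else of_nat (Suc a)) else 0)"
  have z: "zz a w = of_nat (Suc a)" if "a \<in> R" for a
  proof -
    have "(\<Sum>c\<le>q. w ((a, c), False) * w ((a, c), True)) = (\<Sum>c\<le>q. if c = 0 then of_nat (Suc a) * \<sigma> a else 0)"
      using that by (intro sum.cong) (auto simp: w_def)
    then show ?thesis using sigma[of a] by (simp add: zz_def sum.delta algebra_simps)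
  qed
  have A: "AA w i j = 0" if "i < s" for i j
    using that disj[of i] by (auto simp: AA_def w_def intro!: sum.neutral)
  have "det (fmat s (BB a w)) \<noteq> 0" if "a \<in> R" for a
  proof -
    have "fmat s (BB a w) = of_nat (Suc a) \<cdot>\<^sub>m 1\<^sub>m s"
      by (rule eq_matI) (auto simp: BB_def A z[OF that])
    then show ?thesis by (simp add: of_nat_Suc[symmetric] del: of_nat_Suc)
  qed
  moreover have "zz a w - zz b w \<noteq> 0" if "(a, b) \<in> pairs" for a b
    using that by (auto simp: pairs_def z)
  ultimately have "Phi w \<noteq> 0"
    using finite_R finite_pairs by (auto simp: Phi_def prod_zero_iff)
  then show ?thesis by blast
qed

text \<open>The left side is again a polynomial, so the identity extends from the points where
  logarithmic derivatives make sense to all points.\<close>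

theorem Lap_Phi:
  "Lap ({..<s} \<times> {..<s + q}) Phi x + (\<Sum>a\<in>R. \<sigma> a * Lap ({a} \<times> {..q}) Phi x) = 0"
proof -
  obtain w where w: "Phi w \<noteq> 0" using Phi_generic_point by blast
  show ?thesis
    by (rule hpol_zero_if_generic_zero[OF hpol_add[OF hpol_Lap[OF hpol_Phi] hpol_sum[OF hpol_cmult[OF hpol_Lap[OF hpol_Phi]]]] hpol_Phi w Lap_generic])
qed

end

section \<open>Vandermonde determinants and products over independent rows\<close>

text \<open>Multiplication by the unitriangular coefficient matrix of the Newton polynomials
  \<open>p i\<close> produces an upper triangular matrix, since \<open>p i\<close> vanishes at
  \<open>u k\<close> for \<open>k < i\<close>.\<close>

lemma det_vandermonde:
  fixes u :: "nat \<Rightarrow> complex"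
  shows "det (fmat s (\<lambda>i k. u k ^ i)) = (\<Prod>i<s. \<Prod>j<i. u i - u j)"
proof -
  define p where "p i = (\<Prod>j<i. [:- u j, 1:])" for i
  have deg: "degree (p i) = i" for i
    unfolding p_def by (subst degree_prod_eq_sum_degree) auto
  have lead: "coeff (p i) i = 1" for i
    using lead_coeff_prod[of "\<lambda>j. [:- u j, 1:]" "{..<i}"] deg[of i] by (simp add: p_def)
  have pv: "poly (p i) x = (\<Prod>j<i. x - u j)" for i x
    by (simp add: p_def poly_prod)
  have "fmat s (\<lambda>i j. coeff (p i) j) * fmat s (\<lambda>i k. u k ^ i) = fmat s (\<lambda>i k. poly (p i) (u k))"
    unfolding fmat_mult
  proof (rule cong_mat, goal_cases)
    case (3 i k)
    have "poly (p i) (u k) = (\<Sum>j\<le>i. coeff (p i) j * u k ^ j)"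
      using poly_altdef[of "p i" "u k"] by (simp add: deg)
    also have "\<dots> = (\<Sum>j<s. coeff (p i) j * u k ^ j)"
      using 3 by (intro sum.mono_neutral_left) (auto intro!: coeff_eq_0 simp: deg)
    finally show ?case by simp
  qed auto
  then have "det (fmat s (\<lambda>i j. coeff (p i) j)) * det (fmat s (\<lambda>i k. u k ^ i)) = det (fmat s (\<lambda>i k. poly (p i) (u k)))"
    using det_mult[of "fmat s (\<lambda>i j. coeff (p i) j)" s "fmat s (\<lambda>i k. u k ^ i)"] by simp
  moreover have "det (fmat s (\<lambda>i j. coeff (p i) j)) = 1"
    by (subst det_lower_triangular[of s])
       (auto simp: diag_mat_def prod.distinct_set_conv_list[symmetric] lead deg intro!: coeff_eq_0)
  moreover have "det (fmat s (\<lambda>i k. poly (p i) (u k))) = (\<Prod>i<s. \<Prod>j<i. u i - u j)"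
  proof (subst det_upper_triangular[of _ s])
    show "upper_triangular (fmat s (\<lambda>i k. poly (p i) (u k)))"
      unfolding upper_triangular_def by (auto simp: pv intro!: prod_zero)
    show "prod_list (diag_mat (fmat s (\<lambda>i k. poly (p i) (u k)))) = (\<Prod>i<s. \<Prod>j<i. u i - u j)"
      by (simp add: diag_mat_def pv prod.distinct_set_conv_list[symmetric] atLeast0LessThan cong: map_cong)
  qed auto
  ultimately show ?thesis by simp
qed

lemma det_scale_columns:
  fixes B :: "nat \<Rightarrow> nat \<Rightarrow> complex"
  shows "det (fmat s (\<lambda>i k. B i k * f k)) = det (fmat s B) * (\<Prod>k<s. f k)"
proof -
  have "fmat s B * fmat s (\<lambda>i k. if i = k then f k else 0) = fmat s (\<lambda>i k. B i k * f k)"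
    unfolding fmat_mult by (rule cong_mat) (auto simp: if_distrib sum.delta cong: if_cong)
  then have "det (fmat s (\<lambda>i k. B i k * f k)) = det (fmat s B) * det (fmat s (\<lambda>i k. if i = k then f k else 0))"
    using det_mult[of "fmat s B" s "fmat s (\<lambda>i k. if i = k then f k else 0)"] by simp
  also have "det (fmat s (\<lambda>i k. if i = k then f k else 0)) = (\<Prod>k<s. f k)"
    by (subst det_upper_triangular[of _ s])
       (auto simp: diag_mat_def prod.distinct_set_conv_list[symmetric] atLeast0LessThan cong: map_cong)
  finally show ?thesis .
qed

text \<open>Independence of disjoint blocks. Integrability is assumed for all subfamilies because
  the induction splits off one block at a time.\<close>

lemma (in product_sigma_finite) integral_prod_rows:
  fixes g :: "'k \<Rightarrow> ('i \<Rightarrow> 'a) \<Rightarrow> complex" and J :: "'k \<Rightarrow> 'i set"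
  assumes K: "finite K" and J: "\<And>k. k \<in> K \<Longrightarrow> finite (J k)" "disjoint_family_on J K"
    and int: "\<And>K'. K' \<subseteq> K \<Longrightarrow> integrable (PiM (\<Union>k\<in>K'. J k) M) (\<lambda>\<zeta>. \<Prod>k\<in>K'. g k \<zeta>)"
    and dep: "\<And>k \<zeta> \<zeta>'. k \<in> K \<Longrightarrow> (\<And>c. c \<in> J k \<Longrightarrow> \<zeta> c = \<zeta>' c) \<Longrightarrow> g k \<zeta> = g k \<zeta>'"
  shows "(\<integral>\<zeta>. (\<Prod>k\<in>K. g k \<zeta>) \<partial>PiM (\<Union>k\<in>K. J k) M) = (\<Prod>k\<in>K. \<integral>\<zeta>. g k \<zeta> \<partial>PiM (J k) M)"
  using assms
proof (induction K rule: finite_induct)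
  case empty
  interpret P: prob_space "PiM {} M"
    by (rule prob_spaceI) (simp add: space_PiM_empty emeasure_PiM_empty)
  show ?case by (simp add: P.prob_space)
next
  case (insert k K)
  let ?U = "\<Union>k\<in>K. J k"
  have disj: "J k \<inter> ?U = {}"
    using insert.prems(2) insert.hyps by (auto simp: disjoint_family_on_def)
  have fin: "finite (J k)" "finite ?U" using insert.prems(1) insert.hyps by auto
  have IH: "(\<integral>\<zeta>. (\<Prod>k\<in>K. g k \<zeta>) \<partial>PiM ?U M) = (\<Prod>k\<in>K. \<integral>\<zeta>. g k \<zeta> \<partial>PiM (J k) M)"
  proof (rule insert.IH)
    show "disjoint_family_on J K" by (rule disjoint_family_on_mono[OF _ insert.prems(2)]) auto
    show "integrable (PiM (\<Union>k\<in>K'. J k) M) (\<lambda>\<zeta>. \<Prod>k\<in>K'. g k \<zeta>)" if "K' \<subseteq> K" for K'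
      using insert.prems(3)[of K'] that by auto
    show "finite (J k')" if "k' \<in> K" for k' using insert.prems(1) that by auto
    show "g k' \<zeta> = g k' \<zeta>'" if "k' \<in> K" "\<And>c. c \<in> J k' \<Longrightarrow> \<zeta> c = \<zeta>' c" for k' \<zeta> \<zeta>'
      by (rule insert.prems(4)) (use that in auto)
  qed
  have m1: "g k (merge (J k) ?U (x, y)) = g k x" for x y
    by (rule insert.prems(4)) (auto simp: merge_def)
  have m2: "g k' (merge (J k) ?U (x, y)) = g k' y" if "k' \<in> K" for k' x y
    using disj that by (intro insert.prems(4)) (auto simp: merge_def)
  have "(\<integral>\<zeta>. (\<Prod>k\<in>insert k K. g k \<zeta>) \<partial>PiM (\<Union>k\<in>insert k K. J k) M) =
     (\<integral>\<zeta>. (\<Prod>k\<in>insert k K. g k \<zeta>) \<partial>PiM (J k \<union> ?U) M)" by simp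
  also have "\<dots> = (\<integral>x. (\<integral>y. (\<Prod>k'\<in>insert k K. g k' (merge (J k) ?U (x, y))) \<partial>PiM ?U M) \<partial>PiM (J k) M)"
    using insert.prems(3)[of "insert k K"] by (intro product_integral_fold disj fin) simp
  also have "\<dots> = (\<integral>x. (\<integral>y. g k x * (\<Prod>k'\<in>K. g k' y) \<partial>PiM ?U M) \<partial>PiM (J k) M)"
    using insert.hyps by (simp add: m1 m2)
  also have "\<dots> = (\<integral>x. g k x \<partial>PiM (J k) M) * (\<integral>y. (\<Prod>k'\<in>K. g k' y) \<partial>PiM ?U M)"
    by simp
  finally show ?case using insert.hyps by (simp add: IH)
qed

section \<open>Moments of a noncentral chi-square variable\<close>

text \<open>Multiplied by \<open>exp (- l)\<close>, this is the \<open>m\<close>-th moment of the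
  squared length of a complex Gaussian vector with \<open>q + 1\<close> components and squared mean
  length \<open>l\<close>.\<close>

definition mom_series :: "nat \<Rightarrow> nat \<Rightarrow> real \<Rightarrow> real" where
  "mom_series q m l = (\<Sum>k. l ^ k * fact (m + q + k) / (fact k * fact (k + q)))"

lemma mom_series_summable: "summable (\<lambda>k. l ^ k * fact (m + q + k) / (fact k * fact (k + q)) :: real)"
proof -
  define c where "c k = (l ^ k * fact (m + q + k) / (fact k * fact (k + q)) :: real)" for k
  \<comment> \<open>From \<open>N\<close> on the ratio of consecutive terms is at most 1/2, because
    \<open>m + q + k + 1\<close> is at most \<open>(m + 1) * (k + 1 + q)\<close>.\<close>
  obtain N :: nat where N: "2 * \<bar>l\<bar> * real (m + 1) \<le> real N" using real_arch_simple by blast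
  have "norm (c (Suc k)) \<le> 1 / 2 * norm (c k)" if "k \<ge> N" for k
  proof -
    have "real (m + q + k + 1) \<le> real (m + 1) * real (k + 1 + q)"
      by (simp add: algebra_simps)
    then have "\<bar>l\<bar> * real (m + q + k + 1) \<le> \<bar>l\<bar> * (real (m + 1) * real (k + 1 + q))"
      by (intro mult_left_mono) auto
    also have "\<dots> \<le> (real (k + 1) / 2) * real (k + 1 + q)"
      using N that by (subst mult.assoc[symmetric], intro mult_right_mono) auto
    finally have r: "\<bar>l\<bar> * real (m + q + k + 1) / (real (k + 1) * real (k + 1 + q)) \<le> 1 / 2"
      by (subst pos_divide_le_eq) (auto simp del: of_nat_add of_nat_Suc)
    have "c (Suc k) = c k * (l * real (m + q + k + 1) / (real (k + 1) * real (k + 1 + q)))"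
      unfolding c_def by (simp add: divide_simps)
    then have "norm (c (Suc k)) = norm (c k) * (\<bar>l\<bar> * real (m + q + k + 1) / (real (k + 1) * real (k + 1 + q)))"
      by (simp add: abs_mult)
    also have "\<dots> \<le> norm (c k) * (1 / 2)" using r by (intro mult_left_mono) auto
    finally show ?thesis by simp
  qed
  then have "summable c" by (intro summable_ratio_test[of "1/2" N]) auto
  then show ?thesis unfolding c_def .
qed

text \<open>The series counterpart of the cross moment \<open>b\<close> in
  \<open>gexp_uu_power\<close>. Termwise it inserts a factor \<open>k\<close>, as \<open>ax\<close>
  below shows.\<close>

definition mom_aux :: "nat \<Rightarrow> nat \<Rightarrow> real \<Rightarrow> real" where
  "mom_aux q m l = mom_series q (Suc m) l - real (Suc (q + m)) * mom_series q m l"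

text \<open>A comparison of coefficients after shifting \<open>k\<close> to \<open>Suc k\<close>;
  the lost term \<open>k = 0\<close> carries the factor 0.\<close>

lemma mom_aux_rec:
  "mom_aux q m l = l * mom_series q m l + real m * mom_aux q (m - 1) l"
proof -
  define c where "c m k = (l ^ k * fact (m + q + k) / (fact k * fact (k + q)) :: real)" for m k
  have S: "c m sums mom_series q m l" for m
    using mom_series_summable[of l m q] unfolding c_def mom_series_def by (simp add: summable_sums)
  have ax: "(\<lambda>k. real k * c m k) sums mom_aux q m l" for m
  proof -
    have "(\<lambda>k. c (Suc m) k - real (Suc (q + m)) * c m k) sums mom_aux q m l"
      unfolding mom_aux_def by (intro sums_diff sums_mult S)
    also have "(\<lambda>k. c (Suc m) k - real (Suc (q + m)) * c m k) = (\<lambda>k. real k * c m k)"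
      by (auto simp: c_def fun_eq_iff divide_simps) (simp add: algebra_simps)
    finally show ?thesis .
  qed
  show ?thesis
  proof (cases m)
    case 0
    have "(\<lambda>k. real (Suc k) * c 0 (Suc k)) sums (l * mom_series q 0 l)"
    proof -
      have "real (Suc k) * c 0 (Suc k) = l * c 0 k" for k
        by (simp add: c_def divide_simps)
      then show ?thesis using sums_mult[OF S[of 0], of l] by simp
    qed
    then have "(\<lambda>k. real k * c 0 k) sums (l * mom_series q 0 l)"
      by (subst (asm) sums_Suc_iff) simp
    then show ?thesis using ax[of 0] sums_unique2 0 by fastforce
  next
    case (Suc n)
    have 1: "(\<lambda>k. real (Suc k) * c m (Suc k) - real m * (real (Suc k) * c n (Suc k))) sums (l * mom_series q m l)"
    proof -
      have "real (Suc k) * c m (Suc k) - real m * (real (Suc k) * c n (Suc k)) = l * c m k" for k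
        unfolding c_def Suc by (simp add: divide_simps) (simp add: algebra_simps)
      then show ?thesis using sums_mult[OF S[of m], of l] by simp
    qed
    then have "(\<lambda>k. real k * c m k - real m * (real k * c n k)) sums (l * mom_series q m l)"
      using sums_Suc_iff[of "\<lambda>k. real k * c m k - real m * (real k * c n k)"] by simp
    moreover have "(\<lambda>k. real k * c m k - real m * (real k * c n k)) sums (mom_aux q m l - real m * mom_aux q n l)"
      by (intro sums_diff sums_mult ax)
    ultimately show ?thesis using sums_unique2 Suc by fastforce
  qed
qed

lemma mom_series_0: "mom_series q 0 l = exp l"
proof -
  have "(\<lambda>k. l ^ k * fact (0 + q + k) / (fact k * fact (k + q))) = (\<lambda>k. l ^ k /\<^sub>R fact k)"
    by (auto simp: divide_simps add.commute)
  then show ?thesis unfolding mom_series_def exp_def by simp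
qed

definition uu :: "nat \<Rightarrow> nat \<Rightarrow> ((nat \<times> nat) \<times> bool \<Rightarrow> complex) \<Rightarrow> complex" where
  "uu q k x = (\<Sum>c\<le>q. x ((k, c), False) * x ((k, c), True))"

lemma hpol_power: "hpol A d f \<Longrightarrow> hpol A (m * d) (\<lambda>x. f x ^ m)"
  by (induction m) (auto intro: hpol_const hpol_mult)

lemma PD_power: "hpol A d f \<Longrightarrow> PD a (\<lambda>x. f x ^ m) = (\<lambda>x. of_nat m * f x ^ (m - 1) * PD a f x)"
proof (induction m)
  case (Suc m)
  have "PD a (\<lambda>x. f x * f x ^ m) = (\<lambda>x. PD a f x * f x ^ m + f x * PD a (\<lambda>x. f x ^ m) x)"
    by (rule PD_mult[OF Suc.prems hpol_power[OF Suc.prems]])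
  then show ?case using Suc by (cases m) (auto simp: fun_eq_iff algebra_simps)
qed (auto simp: PD_const)

lemma PD_uu: "c \<le> q \<Longrightarrow> PD ((k, c), b) (uu q k) = (\<lambda>x. x ((k, c), \<not> b))"
proof (rule ext, rule PD_I)
  fix x :: "(nat \<times> nat) \<times> bool \<Rightarrow> complex"
  assume c: "c \<le> q"
  define e where "e = ((k, c), b)"
  have 1: "((\<lambda>t. (x(e := t)) ((k, c'), b')) has_field_derivative (if c' = c \<and> b' = b then 1 else 0)) (at (x e))"
    for c' b' by (auto simp: e_def)
  have "((\<lambda>t. uu q k (x(e := t))) has_field_derivative
     (\<Sum>c'\<le>q. (if c' = c \<and> False = b then 1 else 0) * x ((k, c'), True)
       + (if c' = c \<and> True = b then 1 else 0) * x ((k, c'), False))) (at (x e))"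
    unfolding uu_def
    by (intro DERIV_sum DERIV_cong[OF DERIV_mult[OF 1 1]]) simp
  also have "(\<Sum>c'\<le>q. (if c' = c \<and> False = b then 1 else 0) * x ((k, c'), True)
       + (if c' = c \<and> True = b then 1 else 0) * x ((k, c'), False))
     = (\<Sum>c'\<le>q. if c' = c then x ((k, c), \<not> b) else 0)"
    by (intro sum.cong) auto
  also have "\<dots> = x ((k, c), \<not> b)"
    using c by (simp add: sum.delta)
  finally show "((\<lambda>t. uu q k (x(((k, c), b) := t))) has_field_derivative x ((k, c), \<not> b)) (at (x ((k, c), b)))"
    unfolding e_def .
qed

text \<open>Gaussian integration by parts gives \<open>E u\<^bsup>m+1\<^esup> = b\<^sub>m + (q+1+m) E u\<^sup>m\<close> and
  \<open>b\<^sub>m = l E u\<^sup>m + m b\<^bsub>m-1\<^esub>\<close>; the series satisfies the same recursion.\<close>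
lemma gexp_uu_power:
  assumes "uu q k P = of_real l"
  shows "gexp ({k} \<times> {..q}) (\<lambda>_. 0) (\<lambda>x. uu q k x ^ m) P = of_real (exp (- l) * mom_series q m l)"
proof -
  let ?J = "{k} \<times> {..q}"
  define A where "A = ?J \<times> (UNIV :: bool set)"
  have A: "finite A" "finite ?J" by (auto simp: A_def)
  have cA: "((k, c), b) \<in> A" if "c \<le> q" for c b using that by (auto simp: A_def)
  have P: "P = (\<lambda>a. P a + dbl ?J (\<lambda>_. 0) a)" by (auto simp: dbl_def)
  note hp = hpol_PD
  have hu: "hpol A 2 (uu q k)"
    unfolding uu_def[abs_def] by (intro hpol_sum hpol_mult'[OF hpol_var hpol_var] cA) auto
  note hum = hpol_power[OF hu]
  have hx: "hpol A (Suc 0) (\<lambda>x. x ((k, c), b))" if "c \<le> q" for c b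
    by (rule hpol_var[OF cA[OF that]])
  define a where "a m = gexp ?J (\<lambda>_. 0) (\<lambda>x. uu q k x ^ m) P" for m
  \<comment> \<open>One conjugate coordinate times the power of the squared length; \<open>b\<close>
    pairs these with the mean vector. Integration by parts closes on \<open>a\<close> and
    \<open>b\<close>.\<close>
  define y where "y c m = gexp ?J (\<lambda>_. 0) (\<lambda>x. x ((k, c), True) * uu q k x ^ m) P" for c m
  define b where "b m = (\<Sum>c\<le>q. P ((k, c), False) * y c m)" for m
  have y: "y c m = P ((k, c), True) * a m + of_nat m * y c (m - 1)" if c: "c \<le> q" for c m
  proof -
    have "y c m = P ((k, c), True) * a m + gexp ?J (\<lambda>_. 0) (PD ((k, c), False) (\<lambda>x. uu q k x ^ m)) P"
      unfolding y_def a_def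
      using gexp_stein[OF A(1) hum A(2) _ cA[OF c] cA[OF c] P, where b = True] c by simp
    also have "gexp ?J (\<lambda>_. 0) (PD ((k, c), False) (\<lambda>x. uu q k x ^ m)) P = of_nat m * y c (m - 1)"
      unfolding PD_power[OF hu] PD_uu[OF c] y_def
      by (simp add: gexp_def mult.assoc mult.commute[of "_ ^ _"])
    finally show ?thesis .
  qed
  have b: "b m = of_real l * a m + of_nat m * b (m - 1)" for m
  proof -
    have "b m = (\<Sum>c\<le>q. P ((k, c), False) * P ((k, c), True) * a m + of_nat m * (P ((k, c), False) * y c (m - 1)))"
      unfolding b_def by (intro sum.cong refl, subst y) (auto simp: algebra_simps)
    also have "\<dots> = of_real l * a m + of_nat m * b (m - 1)"
      using assms by (simp add: sum.distrib b_def sum_distrib_left sum_distrib_right[symmetric] uu_def)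
    finally show ?thesis .
  qed
  have am: "a (Suc m) = b m + of_nat (Suc (q + m)) * a m" for m
  proof -
    have "a (Suc m) = gexp ?J (\<lambda>_. 0) (\<lambda>x. \<Sum>c\<le>q. x ((k, c), False) * (x ((k, c), True) * uu q k x ^ m)) P"
      unfolding a_def by (simp add: uu_def sum_distrib_right mult.assoc)
    also have "\<dots> = (\<Sum>c\<le>q. gexp ?J (\<lambda>_. 0) (\<lambda>x. x ((k, c), False) * (x ((k, c), True) * uu q k x ^ m)) P)"
      by (rule gexp_sum[OF A hpol_mult[OF hx hpol_mult[OF hx hum]]]) auto
    also have "\<dots> = (\<Sum>c\<le>q. P ((k, c), False) * y c m +
       gexp ?J (\<lambda>_. 0) (PD ((k, c), True) (\<lambda>x. x ((k, c), True) * uu q k x ^ m)) P)"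
      unfolding y_def
      by (intro sum.cong refl, subst gexp_stein[OF A(1) hpol_mult[OF hx hum] A(2) _ cA cA P, where b = False]) auto
    also have "\<dots> = b m + (\<Sum>c\<le>q. gexp ?J (\<lambda>_. 0) (PD ((k, c), True) (\<lambda>x. x ((k, c), True) * uu q k x ^ m)) P)"
      by (simp add: sum.distrib b_def)
    also have "(\<Sum>c\<le>q. gexp ?J (\<lambda>_. 0) (PD ((k, c), True) (\<lambda>x. x ((k, c), True) * uu q k x ^ m)) P) =
      gexp ?J (\<lambda>_. 0) (\<lambda>x. \<Sum>c\<le>q. PD ((k, c), True) (\<lambda>x. x ((k, c), True) * uu q k x ^ m) x) P"
      by (rule gexp_sum[OF A hpol_PD[OF hpol_mult[OF hx hum]], symmetric]) auto
    also have "(\<lambda>x. \<Sum>c\<le>q. PD ((k, c), True) (\<lambda>x. x ((k, c), True) * uu q k x ^ m) x) =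
       (\<lambda>x. of_nat (Suc (q + m)) * uu q k x ^ m)"
    proof
      fix x
      have "(\<Sum>c\<le>q. PD ((k, c), True) (\<lambda>x. x ((k, c), True) * uu q k x ^ m) x) =
        (\<Sum>c\<le>q. uu q k x ^ m + of_nat m * uu q k x ^ (m - 1) * (x ((k, c), False) * x ((k, c), True)))"
        by (intro sum.cong refl)
           (simp add: PD_mult[OF hx hum] PD_power[OF hu] PD_uu PD_var algebra_simps)
      also have "\<dots> = of_nat (Suc q) * uu q k x ^ m + of_nat m * uu q k x ^ (m - 1) * uu q k x"
        by (simp add: sum.distrib uu_def sum_distrib_left)
      also have "\<dots> = of_nat (Suc (q + m)) * uu q k x ^ m"
        by (cases m) (auto simp: algebra_simps)
      finally show "(\<Sum>c\<le>q. PD ((k, c), True) (\<lambda>x. x ((k, c), True) * uu q k x ^ m) x) =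
         of_nat (Suc (q + m)) * uu q k x ^ m" .
    qed
    also have "gexp ?J (\<lambda>_. 0) (\<lambda>x. of_nat (Suc (q + m)) * uu q k x ^ m) P = of_nat (Suc (q + m)) * a m"
      by (simp add: gexp_def a_def)
    finally show ?thesis .
  qed
  have ps: "prob_space (PiM ?J (\<lambda>_. cgauss 0))"
    by (rule prob_space_PiM[OF prob_space_cgauss])
  have a0: "a 0 = 1"
    by (simp add: a_def gexp_def prob_space.prob_space[OF ps])
  have "a m = of_real (exp (- l) * mom_series q m l) \<and> b m = of_real (exp (- l) * mom_aux q m l)" for m
  proof (induction m)
    case 0
    have "a 0 = of_real (exp (- l) * mom_series q 0 l)"
      by (simp add: a0 mom_series_0 flip: exp_add)
    then show ?case by (subst b, subst mom_aux_rec) simp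
  next
    case (Suc m)
    have "a (Suc m) = of_real (exp (- l) * mom_series q (Suc m) l)"
      unfolding am using Suc by (simp add: mom_aux_def algebra_simps)
    then show ?case using Suc by (subst b, subst mom_aux_rec) (simp add: algebra_simps)
  qed
  then show ?thesis by (simp add: a_def)
qed

section \<open>The two exchanges: from the matrix to vectors, and from vectors to chi-square
  moments\<close>

definition gram :: "nat \<Rightarrow> (nat \<times> nat \<Rightarrow> complex) \<Rightarrow> nat \<Rightarrow> nat \<Rightarrow> complex" where
  "gram t X i j = (\<Sum>b<t. X (i, b) * cnj (X (j, b)))"

definition vdiff :: "nat set \<Rightarrow> (nat \<Rightarrow> complex) \<Rightarrow> complex" where
  "vdiff R f = (\<Prod>p\<in>{(a, b). a \<in> R \<and> b \<in> R \<and> b < a}. f (fst p) - f (snd p))"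

text \<open>The point at which the squared length in row \<open>a\<close> is \<open>y a\<close>.\<close>
definition base :: "(nat \<Rightarrow> complex) \<Rightarrow> (nat \<times> nat) \<times> bool \<Rightarrow> complex" where
  "base y = (\<lambda>((a, c), b). if c = 0 then (if b then 1 else y a) else 0)"

lemma uu_base [simp]: "uu q a (base y) = y a"
proof -
  have "uu q a (base y) = (\<Sum>c\<le>q. if c = 0 then y a else 0)"
    unfolding uu_def by (intro sum.cong) (auto simp: base_def)
  then show ?thesis by (simp add: sum.delta)
qed

lemma uu_cong: "(\<And>c b. x ((k, c), b) = y ((k, c), b)) \<Longrightarrow> uu q k x = uu q k y"
  by (simp add: uu_def)

definition Cfun :: "nat \<Rightarrow> ((nat \<times> nat) \<times> bool \<Rightarrow> complex) \<Rightarrow> nat set \<Rightarrow> nat \<Rightarrow> (nat \<Rightarrow> complex) \<Rightarrow> complex" where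
  "Cfun q x R s l = vdiff R (\<lambda>a. - uu q a x) * (\<Prod>a\<in>R. \<Prod>k<s. - uu q a x - l k)"

text \<open>The middle term that links the two exchanges: the eigenvalues are frozen at
  \<open>l\<close>, and only the vectors of the rows in \<open>R\<close> are random, around mean
  vectors for which \<open>zz a\<close> equals \<open>z a\<close>.\<close>

definition Cexp :: "nat \<Rightarrow> nat set \<Rightarrow> nat \<Rightarrow> (nat \<Rightarrow> complex) \<Rightarrow> (nat \<Rightarrow> complex) \<Rightarrow> complex" where
  "Cexp q R s z l = gexp (R \<times> {..q}) (\<lambda>_. 0) (\<lambda>x. Cfun q x R s l) (base (\<lambda>a. - z a))"

lemma gexp_cong:
  "(\<And>\<zeta>. f (\<lambda>a. Q a + dbl J \<zeta> a) = g (\<lambda>a. Q' a + dbl J \<zeta> a)) \<Longrightarrow> gexp J m f Q = gexp J m g Q'"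
  by (simp add: gexp_def)

lemma Lap_Times: "Lap (K \<times> C) f x = (\<Sum>a\<in>K. Lap ({a} \<times> C) f x)"
proof -
  have "Lap (K \<times> C) f x = (\<Sum>a\<in>K. \<Sum>c\<in>C. PD ((a, c), False) (PD ((a, c), True) f) x)" for K
    by (simp add: Lap_def sum.cartesian_product case_prod_beta)
  from this[of K] this[of "{_}"] show ?thesis by simp
qed

text \<open>The exchange with all signs -1. With the vectors frozen one averages the characteristic
  determinants of the random matrix; with the matrix frozen at its mean, its determinants factor
  through \<open>l\<close> and only squared lengths remain random.\<close>

lemma gauss_side:
  fixes m :: "nat \<times> nat \<Rightarrow> complex" and z l :: "nat \<Rightarrow> complex"
  assumes R: "finite R" "\<And>a. a \<in> R \<Longrightarrow> s \<le> a"
    and l: "\<And>w. det (fmat s (\<lambda>i j. (if i = j then 1 else 0) * w - gram (s + q) m i j)) = (\<Prod>k<s. w - l k)"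
  shows "vdiff R z * (\<integral>X. (\<Prod>a\<in>R. det (fmat s (\<lambda>i j. (if i = j then 1 else 0) * z a - gram (s + q) X i j)))
      \<partial>PiM ({..<s} \<times> {..<s + q}) (\<lambda>c. cgauss (m c))) = Cexp q R s z l"
proof -
  interpret A: radial s q "\<lambda>_. -1" R by unfold_locales (use R in auto)
  let ?J1 = "{..<s} \<times> {..<s + q}" and ?J2 = "R \<times> {..q}"
  \<comment> \<open>The matrix slots start at 0 because their mean \<open>m\<close> sits in the
    measure. In \<open>P\<close> that mean has been moved to the offset, and the vectors are
    centred.\<close>
  define Q where "Q = (\<lambda>((a, c), b). if a < s then 0 else base (\<lambda>a. - z a) ((a, c), b))"
  define P where "P = (\<lambda>a. Q a + dbl ?J1 m a)"
  have zz: "A.zz a x = - uu q a x" for a x by (simp add: A.zz_def uu_def)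
  have Phi: "A.Phi x = vdiff R (\<lambda>a. - uu q a x) * (\<Prod>a\<in>R. det (fmat s (A.BB a x)))" for x
    by (simp add: A.Phi_def vdiff_def A.pairs_def zz)
  have "gexp ?J1 m A.Phi Q = gexp ?J2 (\<lambda>_. 0) A.Phi P"
  proof (rule gexp_exchange[OF A.finite_vars A.hpol_Phi, where P = P])
    show "Lap ?J1 A.Phi x = Lap ?J2 A.Phi x" for x
      using A.Lap_Phi[of x] Lap_Times[of R "{..q}" A.Phi x] by (simp add: sum_negf)
  qed (use R in \<open>auto simp: A.vars_def P_def dbl_def\<close>)
  moreover have "gexp ?J1 m A.Phi Q = vdiff R z * (\<integral>X. (\<Prod>a\<in>R. det (fmat s (\<lambda>i j. (if i = j then 1 else 0) * z a - gram (s + q) X i j)))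
      \<partial>PiM ?J1 (\<lambda>c. cgauss (m c)))"
  proof -
    have "A.Phi (\<lambda>a. Q a + dbl ?J1 X a) = vdiff R z * (\<Prod>a\<in>R. det (fmat s (\<lambda>i j. (if i = j then 1 else 0) * z a - gram (s + q) X i j)))" for X
    proof -
      have u: "uu q a (\<lambda>a. Q a + dbl ?J1 X a) = - z a" if "a \<in> R" for a
      proof -
        have "uu q a (\<lambda>a. Q a + dbl ?J1 X a) = uu q a (base (\<lambda>a. - z a))"
          using R(2)[OF that] by (intro uu_cong) (auto simp: Q_def dbl_def)
        then show ?thesis by simp
      qed
      have "fmat s (A.BB a (\<lambda>a. Q a + dbl ?J1 X a)) = fmat s (\<lambda>i j. (if i = j then 1 else 0) * z a - gram (s + q) X i j)" if "a \<in> R" for a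
      proof (rule cong_mat, goal_cases)
        case (3 i j)
        have "A.AA (\<lambda>a. Q a + dbl ?J1 X a) i j = gram (s + q) X i j"
          unfolding A.AA_def gram_def using 3 by (intro sum.cong) (auto simp: Q_def dbl_def)
        then show ?case by (simp add: A.BB_def zz u[OF that])
      qed auto
      moreover have "vdiff R (\<lambda>a. - uu q a (\<lambda>a. Q a + dbl ?J1 X a)) = vdiff R z"
        unfolding vdiff_def by (intro prod.cong) (auto simp: u)
      ultimately show ?thesis unfolding Phi by simp
    qed
    then show ?thesis by (simp add: gexp_def)
  qed
  moreover have "gexp ?J2 (\<lambda>_. 0) A.Phi P = Cexp q R s z l"
    unfolding Cexp_def
  proof (rule gexp_cong)
    fix \<zeta>
    let ?x = "\<lambda>a. P a + dbl ?J2 \<zeta> a" and ?y = "\<lambda>a. base (\<lambda>a. - z a) a + dbl ?J2 \<zeta> a"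
    have u: "uu q a ?x = uu q a ?y" if "a \<in> R" for a
      using R(2)[OF that] by (intro uu_cong) (auto simp: P_def Q_def dbl_def)
    have "det (fmat s (A.BB a ?x)) = (\<Prod>k<s. - uu q a ?y - l k)" if "a \<in> R" for a
    proof -
      have "fmat s (A.BB a ?x) = fmat s (\<lambda>i j. (if i = j then 1 else 0) * (- uu q a ?y) - gram (s + q) m i j)"
      proof (rule cong_mat, goal_cases)
        case (3 i j)
        have "A.AA ?x i j = gram (s + q) m i j"
          unfolding A.AA_def gram_def using 3 R(2)[of i] R(2)[of j]
          by (intro sum.cong) (auto simp: P_def Q_def dbl_def)
        then show ?case by (simp add: A.BB_def zz u[OF that])
      qed auto
      then show ?thesis by (simp only: l)
    qed
    moreover have "vdiff R (\<lambda>a. - uu q a ?x) = vdiff R (\<lambda>a. - uu q a ?y)"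
      unfolding vdiff_def by (intro prod.cong) (auto simp: u)
    ultimately show "A.Phi ?x = Cfun q ?y R s l"
      unfolding Phi Cfun_def by simp
  qed
  ultimately show ?thesis by simp
qed

text \<open>The moment functional of the noncentral chi-square law without its normalising factor
  \<open>exp (- l)\<close>.\<close>

definition Emom :: "nat \<Rightarrow> real \<Rightarrow> complex poly \<Rightarrow> complex" where
  "Emom q l p = (\<Sum>m\<le>degree p. coeff p m * of_real (mom_series q m l))"

lemma gexp_uu_poly:
  assumes "uu q k P = of_real l"
  shows "gexp ({k} \<times> {..q}) (\<lambda>_. 0) (\<lambda>x. poly p (uu q k x)) P = of_real (exp (- l)) * Emom q l p"
proof -
  define A where "A = ({k} \<times> {..q}) \<times> (UNIV :: bool set)"
  have A: "finite A" "finite ({k} \<times> {..q})" by (auto simp: A_def)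
  have hu: "hpol A 2 (uu q k)"
    unfolding uu_def[abs_def] by (intro hpol_sum hpol_mult'[OF hpol_var hpol_var]) (auto simp: A_def)
  have i: "integrable (PiM ({k} \<times> {..q}) (\<lambda>_. cgauss 0)) (\<lambda>\<zeta>. c * uu q k (\<lambda>a. P a + dbl ({k} \<times> {..q}) \<zeta> a) ^ m)" for m c
    by (rule integrable_gexp[OF A(1) hpol_cmult[OF hpol_power[OF hu]] A(2)])
  have "gexp ({k} \<times> {..q}) (\<lambda>_. 0) (\<lambda>x. poly p (uu q k x)) P =
    (\<Sum>m\<le>degree p. coeff p m * gexp ({k} \<times> {..q}) (\<lambda>_. 0) (\<lambda>x. uu q k x ^ m) P)"
    unfolding gexp_def poly_altdef by (subst Bochner_Integration.integral_sum) (auto intro: i)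
  then show ?thesis
    by (simp add: gexp_uu_power[OF assms] Emom_def sum_distrib_left mult_ac)
qed

lemma vdiff_Un:
  assumes "finite R" "\<And>a. a \<in> R \<Longrightarrow> s \<le> a"
  shows "vdiff ({..<s} \<union> R) f = vdiff {..<s} f * (\<Prod>a\<in>R. \<Prod>k<s. f a - f k) * vdiff R f"
proof -
  let ?P = "\<lambda>R. {(a, b). a \<in> R \<and> b \<in> R \<and> b < a}"
  have fin: "finite (?P R)" if "finite R" for R :: "nat set"
    by (rule finite_subset[of _ "R \<times> R"]) (use that in auto)
  have "?P ({..<s} \<union> R) = (?P {..<s} \<union> R \<times> {..<s}) \<union> ?P R"
    using assms(2) by fastforce
  then have "vdiff ({..<s} \<union> R) f = (\<Prod>p\<in>(?P {..<s} \<union> R \<times> {..<s}) \<union> ?P R. f (fst p) - f (snd p))"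
    by (simp add: vdiff_def)
  also have "\<dots> = (\<Prod>p\<in>?P {..<s} \<union> R \<times> {..<s}. f (fst p) - f (snd p)) * vdiff R f"
    unfolding vdiff_def using assms fin[of R] fin[of "{..<s}"]
    by (intro prod.union_disjoint) force+
  also have "(\<Prod>p\<in>?P {..<s} \<union> R \<times> {..<s}. f (fst p) - f (snd p)) = vdiff {..<s} f * (\<Prod>p\<in>R \<times> {..<s}. f (fst p) - f (snd p))"
    unfolding vdiff_def using assms fin[of "{..<s}"]
    by (intro prod.union_disjoint) force+
  also have "(\<Prod>p\<in>R \<times> {..<s}. f (fst p) - f (snd p)) = (\<Prod>a\<in>R. \<Prod>k<s. f a - f k)"
    by (simp add: prod.cartesian_product case_prod_beta)
  finally show ?thesis .
qed

lemma vdiff_lessThan: "vdiff {..<s} f = (\<Prod>i<s. \<Prod>j<i. f i - f j)"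
proof -
  have "{(a, b). a \<in> {..<s} \<and> b \<in> {..<s} \<and> b < a} = Sigma {..<s} (\<lambda>a. {..<a})"
    by auto
  then show ?thesis unfolding vdiff_def by (simp add: prod.Sigma case_prod_beta)
qed

text \<open>The exchange without a matrix: sign +1 on the rows below \<open>s\<close>, sign -1 on
  \<open>R\<close>, so that the vanishing signed sum of Laplacians equates the two blocks.
  \<open>Phi\<close> is now a Vandermonde determinant. Randomising the first \<open>s\<close> rows
  makes its columns independent, hence the determinant of one-dimensional moments.\<close>

lemma chi_side:
  fixes z :: "nat \<Rightarrow> complex" and l :: "nat \<Rightarrow> real"
  assumes R: "finite R" "\<And>a. a \<in> R \<Longrightarrow> s \<le> a"
  defines "\<phi> \<equiv> (\<Prod>a\<in>R. [:z a, -1:])"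
  shows "vdiff {..<s} (\<lambda>k. of_real (l k)) * Cexp q R s z (\<lambda>k. of_real (l k)) =
    vdiff R z * det (fmat s (\<lambda>i k. of_real (exp (- l k)) * Emom q (l k) (monom 1 i * \<phi>)))"
proof -
  define \<sigma> :: "nat \<Rightarrow> complex" where "\<sigma> a = (if a < s then 1 else - 1)" for a
  interpret B: radial 0 q \<sigma> "{..<s} \<union> R" by unfold_locales (use R in \<open>auto simp: \<sigma>_def\<close>)
  let ?J1 = "{..<s} \<times> {..q}" and ?J2 = "R \<times> {..q}"
  define l' where "l' k = complex_of_real (l k)" for k
  define P where "P = base (\<lambda>a. if a < s then l' a else - z a)"
  have zz: "B.zz a x = (if a < s then uu q a x else - uu q a x)" for a x
    by (simp add: B.zz_def uu_def \<sigma>_def)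
  have Phi: "B.Phi x = vdiff {..<s} (\<lambda>a. uu q a x) * (\<Prod>a\<in>R. \<Prod>k<s. - uu q a x - uu q k x) * vdiff R (\<lambda>a. - uu q a x)" for x
  proof -
    have "B.Phi x = vdiff ({..<s} \<union> R) (\<lambda>a. B.zz a x)"
      by (simp add: B.Phi_def vdiff_def B.pairs_def)
    also have "\<dots> = vdiff {..<s} (\<lambda>a. B.zz a x) * (\<Prod>a\<in>R. \<Prod>k<s. B.zz a x - B.zz k x) * vdiff R (\<lambda>a. B.zz a x)"
      by (rule vdiff_Un[OF R])
    also have "vdiff {..<s} (\<lambda>a. B.zz a x) = vdiff {..<s} (\<lambda>a. uu q a x)"
      unfolding vdiff_def by (intro prod.cong) (auto simp: zz)
    also have "vdiff R (\<lambda>a. B.zz a x) = vdiff R (\<lambda>a. - uu q a x)"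
      unfolding vdiff_def using R(2) by (intro prod.cong) (auto simp: zz dest!: R(2))
    also have "(\<Prod>a\<in>R. \<Prod>k<s. B.zz a x - B.zz k x) = (\<Prod>a\<in>R. \<Prod>k<s. - uu q a x - uu q k x)"
      by (intro prod.cong) (auto simp: zz dest!: R(2))
    finally show ?thesis .
  qed
  have "gexp ?J1 (\<lambda>_. 0) B.Phi P = gexp ?J2 (\<lambda>_. 0) B.Phi P"
  proof (rule gexp_exchange[OF B.finite_vars B.hpol_Phi, where P = P])
    show "Lap ?J1 B.Phi x = Lap ?J2 B.Phi x" for x
    proof -
      have "0 = (\<Sum>a\<in>{..<s} \<union> R. \<sigma> a * Lap ({a} \<times> {..q}) B.Phi x)"
        using B.Lap_Phi[of x] by (simp add: Lap_def)
      also have "\<dots> = (\<Sum>a\<in>{..<s}. \<sigma> a * Lap ({a} \<times> {..q}) B.Phi x) + (\<Sum>a\<in>R. \<sigma> a * Lap ({a} \<times> {..q}) B.Phi x)"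
        using R by (intro sum.union_disjoint) force+
      also have "(\<Sum>a\<in>{..<s}. \<sigma> a * Lap ({a} \<times> {..q}) B.Phi x) = Lap ?J1 B.Phi x"
        unfolding Lap_Times[of "{..<s}"] by (simp add: \<sigma>_def)
      also have "(\<Sum>a\<in>R. \<sigma> a * Lap ({a} \<times> {..q}) B.Phi x) = (\<Sum>a\<in>R. - Lap ({a} \<times> {..q}) B.Phi x)"
        by (intro sum.cong) (auto simp: \<sigma>_def dest!: R(2))
      finally show ?thesis unfolding Lap_Times[of R] by (simp add: sum_negf)
    qed
  qed (use R in \<open>auto simp: B.vars_def dbl_def\<close>)
  moreover have "gexp ?J2 (\<lambda>_. 0) B.Phi P = vdiff {..<s} l' * Cexp q R s z l'"
  proof -
    have "gexp ?J2 (\<lambda>_. 0) B.Phi P = gexp ?J2 (\<lambda>_. 0) (\<lambda>x. vdiff {..<s} l' * Cfun q x R s l') (base (\<lambda>a. - z a))"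
    proof (rule gexp_cong)
      fix \<zeta>
      let ?x = "\<lambda>a. P a + dbl ?J2 \<zeta> a" and ?y = "\<lambda>a. base (\<lambda>a. - z a) a + dbl ?J2 \<zeta> a"
      have u: "uu q a ?x = uu q a ?y" if "a \<in> R" for a
        using R(2)[OF that] by (intro uu_cong) (auto simp: P_def base_def dbl_def)
      have l: "uu q k ?x = l' k" if "k < s" for k
      proof -
        have "uu q k ?x = uu q k P"
          using R(2)[of k] that by (intro uu_cong) (auto simp: dbl_def)
        then show ?thesis using that by (simp add: P_def)
      qed
      have "vdiff {..<s} (\<lambda>a. uu q a ?x) = vdiff {..<s} l'" "vdiff R (\<lambda>a. - uu q a ?x) = vdiff R (\<lambda>a. - uu q a ?y)"
        unfolding vdiff_def by (intro prod.cong; auto simp: u l)+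
      then show "B.Phi ?x = vdiff {..<s} l' * Cfun q ?y R s l'"
        by (simp add: Phi Cfun_def u l)
    qed
    then show ?thesis by (simp add: gexp_def Cexp_def)
  qed
  moreover have "gexp ?J1 (\<lambda>_. 0) B.Phi P = vdiff R z * det (fmat s (\<lambda>i k. of_real (exp (- l k)) * Emom q (l k) (monom 1 i * \<phi>)))"
  proof -
    interpret product_sigma_finite "\<lambda>c :: nat \<times> nat. cgauss 0" by (rule product_sigma_finite_cgauss)
    define A where "A = ?J1 \<times> (UNIV :: bool set) \<union> ?J2 \<times> (UNIV :: bool set)"
    have A: "finite A" using R by (auto simp: A_def)
    have hu: "hpol A 2 (uu q k)" if "k < s \<or> k \<in> R" for k
      unfolding uu_def[abs_def] using that
      by (intro hpol_sum hpol_mult'[OF hpol_var hpol_var]) (auto simp: A_def)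
    let ?x = "\<lambda>\<zeta> a. P a + dbl ?J1 \<zeta> a"
    have uR: "uu q a (?x \<zeta>) = - z a" if "a \<in> R" for a \<zeta>
    proof -
      have "uu q a (?x \<zeta>) = uu q a P"
        using R(2)[OF that] by (intro uu_cong) (auto simp: dbl_def)
      then show ?thesis using R(2)[OF that] by (simp add: P_def)
    qed
    have ph: "poly \<phi> u = (\<Prod>a\<in>R. z a - u)" for u by (simp add: \<phi>_def poly_prod)
    define g where "g p k \<zeta> = poly (monom 1 (p k) * \<phi>) (uu q k (?x \<zeta>))" for p :: "nat \<Rightarrow> nat" and k \<zeta>
    have gint: "integrable (PiM (K \<times> {..q}) (\<lambda>c. cgauss 0)) (\<lambda>\<zeta>. \<Prod>k\<in>K. g p k \<zeta>)" if K: "K \<subseteq> {..<s}" for K p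
    proof -
      have "hpol A (\<Sum>k\<in>K. p k * 2 + (\<Sum>a\<in>R. 2)) (\<lambda>x. \<Prod>k\<in>K. uu q k x ^ p k * (\<Prod>a\<in>R. - uu q a x - uu q k x))"
        using K by (intro hpol_prod hpol_mult hpol_power hpol_diff hpol_uminus hu) auto
      from integrable_gexp[OF A this, of "K \<times> {..q}" "\<lambda>_. 0" P]
      have "integrable (PiM (K \<times> {..q}) (\<lambda>c. cgauss 0)) (\<lambda>\<zeta>. \<Prod>k\<in>K. uu q k (\<lambda>a. P a + dbl (K \<times> {..q}) \<zeta> a) ^ p k *
          (\<Prod>a\<in>R. - uu q a (\<lambda>a. P a + dbl (K \<times> {..q}) \<zeta> a) - uu q k (\<lambda>a. P a + dbl (K \<times> {..q}) \<zeta> a)))"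
        using finite_subset[OF K] by simp
      moreover have "uu q k (\<lambda>a. P a + dbl (K \<times> {..q}) \<zeta> a) = uu q k (?x \<zeta>)" if "k \<in> K" for k \<zeta>
        using that K by (intro uu_cong) (auto simp: dbl_def)
      moreover have "uu q a (\<lambda>a. P a + dbl (K \<times> {..q}) \<zeta> a) = - z a" if "a \<in> R" for a \<zeta>
      proof -
        have "uu q a (\<lambda>a. P a + dbl (K \<times> {..q}) \<zeta> a) = uu q a P"
          using R(2)[OF that] K by (intro uu_cong) (auto simp: dbl_def)
        then show ?thesis using R(2)[OF that] by (simp add: P_def)
      qed
      ultimately show ?thesis
        by (simp add: g_def ph poly_monom cong: prod.cong)
    qed
    have J1: "?J1 = (\<Union>k\<in>{..<s}. {k} \<times> {..q})" by auto
    have rows: "(\<integral>\<zeta>. (\<Prod>k<s. g p k \<zeta>) \<partial>PiM ?J1 (\<lambda>c. cgauss 0)) = (\<Prod>k<s. of_real (exp (- l k)) * Emom q (l k) (monom 1 (p k) * \<phi>))" for p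
    proof -
      have "(\<integral>\<zeta>. (\<Prod>k<s. g p k \<zeta>) \<partial>PiM ?J1 (\<lambda>c. cgauss 0)) = (\<Prod>k<s. \<integral>\<zeta>. g p k \<zeta> \<partial>PiM ({k} \<times> {..q}) (\<lambda>c. cgauss 0))"
        unfolding J1
      proof (rule integral_prod_rows)
        show "disjoint_family_on (\<lambda>k. {k} \<times> {..q}) {..<s}" by (auto simp: disjoint_family_on_def)
        show "integrable (PiM (\<Union>k\<in>K'. {k} \<times> {..q}) (\<lambda>c. cgauss 0)) (\<lambda>\<zeta>. \<Prod>k\<in>K'. g p k \<zeta>)" if "K' \<subseteq> {..<s}" for K'
        proof -
          have "(\<Union>k\<in>K'. {k} \<times> {..q}) = K' \<times> {..q}" by auto
          then show ?thesis using gint[OF that] by simp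
        qed
        show "g p k \<zeta> = g p k \<zeta>'" if "k \<in> {..<s}" "\<And>c. c \<in> {k} \<times> {..q} \<Longrightarrow> \<zeta> c = \<zeta>' c" for k \<zeta> \<zeta>'
        proof -
          have "uu q k (?x \<zeta>) = uu q k (?x \<zeta>')"
            unfolding uu_def using that by (intro sum.cong) (auto simp: dbl_def)
          then show ?thesis by (simp add: g_def)
        qed
      qed auto
      also have "\<dots> = (\<Prod>k<s. gexp ({k} \<times> {..q}) (\<lambda>_. 0) (\<lambda>x. poly (monom 1 (p k) * \<phi>) (uu q k x)) P)"
      proof (intro prod.cong refl)
        fix k assume k: "k \<in> {..<s}"
        have "uu q k (?x \<zeta>) = uu q k (\<lambda>a. P a + dbl ({k} \<times> {..q}) \<zeta> a)" for \<zeta>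
          using k by (intro uu_cong) (auto simp: dbl_def)
        then show "(\<integral>\<zeta>. g p k \<zeta> \<partial>PiM ({k} \<times> {..q}) (\<lambda>c. cgauss 0)) =
           gexp ({k} \<times> {..q}) (\<lambda>_. 0) (\<lambda>x. poly (monom 1 (p k) * \<phi>) (uu q k x)) P"
          by (simp add: g_def gexp_def)
      qed
      also have "\<dots> = (\<Prod>k<s. of_real (exp (- l k)) * Emom q (l k) (monom 1 (p k) * \<phi>))"
        by (intro prod.cong refl gexp_uu_poly) (auto simp: P_def l'_def)
      finally show ?thesis .
    qed
    \<comment> \<open>The Leibniz formula with factors indexed by columns: each factor then depends
      on one row of variables only, as \<open>integral_prod_rows\<close> requires.\<close>
    have detT: "det (fmat s B) = (\<Sum>p | p permutes {..<s}. signof p * (\<Prod>k<s. B (p k) k))" for B :: "nat \<Rightarrow> nat \<Rightarrow> complex"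
      by (subst det_col[of _ s]) (auto simp: atLeast0LessThan intro!: sum.cong prod.cong arg_cong2[where f = "(*)"] dest: permutes_in_image)
    have "B.Phi (?x \<zeta>) = vdiff R z * (\<Sum>p | p permutes {..<s}. signof p * (\<Prod>k<s. g p k \<zeta>))" for \<zeta>
    proof -
      have "vdiff R (\<lambda>a. - uu q a (?x \<zeta>)) = vdiff R z"
        unfolding vdiff_def by (intro prod.cong) (auto simp: uR)
      moreover have "(\<Prod>a\<in>R. \<Prod>k<s. - uu q a (?x \<zeta>) - uu q k (?x \<zeta>)) = (\<Prod>k<s. poly \<phi> (uu q k (?x \<zeta>)))"
        unfolding ph by (subst prod.swap) (simp add: uR)
      moreover have "vdiff {..<s} (\<lambda>a. uu q a (?x \<zeta>)) * (\<Prod>k<s. poly \<phi> (uu q k (?x \<zeta>))) =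
         (\<Sum>p | p permutes {..<s}. signof p * (\<Prod>k<s. g p k \<zeta>))"
        unfolding vdiff_lessThan det_vandermonde[symmetric] det_scale_columns[symmetric] detT
        by (simp add: g_def poly_monom prod.distrib sum_distrib_right mult.assoc)
      ultimately show ?thesis unfolding Phi by (simp add: mult_ac)
    qed
    then have "gexp ?J1 (\<lambda>_. 0) B.Phi P = vdiff R z * (\<integral>\<zeta>. (\<Sum>p | p permutes {..<s}. signof p * (\<Prod>k<s. g p k \<zeta>)) \<partial>PiM ?J1 (\<lambda>c. cgauss 0))"
      by (simp add: gexp_def)
    also have "(\<integral>\<zeta>. (\<Sum>p | p permutes {..<s}. signof p * (\<Prod>k<s. g p k \<zeta>)) \<partial>PiM ?J1 (\<lambda>c. cgauss 0)) =
       (\<Sum>p | p permutes {..<s}. signof p * (\<integral>\<zeta>. (\<Prod>k<s. g p k \<zeta>) \<partial>PiM ?J1 (\<lambda>c. cgauss 0)))"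
      using gint[of "{..<s}"] by (subst Bochner_Integration.integral_sum) auto
    also have "\<dots> = det (fmat s (\<lambda>i k. of_real (exp (- l k)) * Emom q (l k) (monom 1 i * \<phi>)))"
      unfolding rows detT ..
    finally show ?thesis .
  qed
  ultimately show ?thesis by (simp add: l'_def[abs_def])
qed

lemma hpol_tendsto:
  assumes "hpol A d f" "\<And>a. a \<in> A \<Longrightarrow> ((\<lambda>n. X n a) \<longlongrightarrow> x a) F"
  shows "((\<lambda>n. f (X n)) \<longlongrightarrow> f x) F"
  using assms(1) by (induction rule: hpol.induct) (auto intro!: tendsto_intros assms(2))

lemma gexp_tendsto:
  assumes A: "finite A" and f: "hpol A d f" and J: "finite J"
    and Q: "\<And>a. a \<in> A \<Longrightarrow> (\<lambda>n. Qn n a) \<longlonglongrightarrow> Q a"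
  shows "(\<lambda>n. gexp J m f (Qn n)) \<longlonglongrightarrow> gexp J m f Q"
proof -
  interpret product_sigma_finite "\<lambda>c. cgauss (m c)" by (rule product_sigma_finite_cgauss)
  obtain C k where C: "C \<ge> 0"
    "\<And>Q \<zeta>. norm (f (\<lambda>a. Q a + dbl J \<zeta> a)) \<le> C * (\<Prod>a\<in>A. 1 + norm (Q a)) ^ k * (\<Prod>c\<in>J. (1 + cmod (\<zeta> c)) ^ (2 * k))"
    using gexp_bound[OF A f J] by blast
  have "(\<lambda>n. C * (\<Prod>a\<in>A. 1 + norm (Qn n a)) ^ k) \<longlonglongrightarrow> C * (\<Prod>a\<in>A. 1 + norm (Q a)) ^ k"
    by (intro tendsto_intros Q)
  then have "Bseq (\<lambda>n. C * (\<Prod>a\<in>A. 1 + norm (Qn n a)) ^ k)"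
    by (intro convergent_imp_Bseq convergentI)
  then obtain B where B: "\<And>n. \<bar>C * (\<Prod>a\<in>A. 1 + norm (Qn n a)) ^ k\<bar> \<le> B"
    by (auto simp: Bseq_def)
  show ?thesis
    unfolding gexp_def
  proof (rule integral_dominated_convergence)
    show "integrable (PiM J (\<lambda>c. cgauss (m c))) (\<lambda>\<zeta>. B * (\<Prod>c\<in>J. (1 + cmod (\<zeta> c)) ^ (2 * k)))"
      using integrable_cgauss_power J by (intro integrable_mult_right product_integrable_prod)
    show "AE \<zeta> in PiM J (\<lambda>c. cgauss (m c)). (\<lambda>n. f (\<lambda>a. Qn n a + dbl J \<zeta> a)) \<longlonglongrightarrow> f (\<lambda>a. Q a + dbl J \<zeta> a)"
      by (intro AE_I2 hpol_tendsto[OF f] tendsto_intros Q)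
    show "AE \<zeta> in PiM J (\<lambda>c. cgauss (m c)). norm (f (\<lambda>a. Qn n a + dbl J \<zeta> a)) \<le> B * (\<Prod>c\<in>J. (1 + cmod (\<zeta> c)) ^ (2 * k))" for n
    proof (intro AE_I2 order.trans[OF C(2)] mult_right_mono)
      show "C * (\<Prod>a\<in>A. 1 + norm (Qn n a)) ^ k \<le> B" using B[of n] by simp
    qed (auto intro!: prod_nonneg)
    show "(\<lambda>\<zeta>. f (\<lambda>a. Qn n a + dbl J \<zeta> a)) \<in> borel_measurable (PiM J (\<lambda>c. cgauss (m c)))"
      "(\<lambda>\<zeta>. f (\<lambda>a. Q a + dbl J \<zeta> a)) \<in> borel_measurable (PiM J (\<lambda>c. cgauss (m c)))" for n
      by (intro measurable_hpol[OF f] borel_measurable_dbl)+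
  qed
qed

text \<open>Each \<open>l k\<close> is stored as the product of the two frozen slots of
  \<open>(k, 0)\<close>, so continuity in \<open>l\<close> becomes continuity of \<open>gexp\<close>
  in its offset.\<close>

lemma Cexp_tendsto:
  assumes R: "finite R" "\<And>a. a \<in> R \<Longrightarrow> s \<le> a"
    and l: "\<And>k. k < s \<Longrightarrow> (\<lambda>n. l' n k) \<longlonglongrightarrow> l k"
  shows "(\<lambda>n. Cexp q R s z (l' n)) \<longlonglongrightarrow> Cexp q R s z l"
proof -
  define A where "A = (R \<times> {..q} \<union> {..<s} \<times> {0}) \<times> (UNIV :: bool set)"
  define f where "f x = vdiff R (\<lambda>a. - uu q a x) * (\<Prod>a\<in>R. \<Prod>k<s. - uu q a x - x ((k, 0), False) * x ((k, 0), True))" for x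
  define B where "B l = base (\<lambda>a. if a < s then l a else - z a)" for l
  have A: "finite A" using R by (auto simp: A_def)
  have hu: "hpol A 2 (uu q k)" if "k \<in> R" for k
    unfolding uu_def[abs_def] using that
    by (intro hpol_sum hpol_mult'[OF hpol_var hpol_var]) (auto simp: A_def)
  have "hpol A ((\<Sum>p\<in>{(a, b). a \<in> R \<and> b \<in> R \<and> b < a}. 2) + (\<Sum>a\<in>R. \<Sum>k<s. 2)) f"
    unfolding f_def[abs_def] vdiff_def
    by (intro hpol_mult hpol_prod hpol_diff hpol_uminus hu hpol_mult'[OF hpol_var hpol_var]) (auto simp: A_def)
  note f = this
  have eq: "Cexp q R s z l = gexp (R \<times> {..q}) (\<lambda>_. 0) f (B l)" for l
    unfolding Cexp_def
  proof (rule gexp_cong)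
    fix \<zeta>
    let ?x = "\<lambda>a. base (\<lambda>a. - z a) a + dbl (R \<times> {..q}) \<zeta> a"
    let ?y = "\<lambda>a. B l a + dbl (R \<times> {..q}) \<zeta> a"
    have u: "uu q a ?x = uu q a ?y" if "a \<in> R" for a
      using R(2)[OF that] by (intro uu_cong) (auto simp: B_def base_def)
    have "?y ((k, 0), False) * ?y ((k, 0), True) = l k" if "k < s" for k
      using R(2)[of k] that by (auto simp: B_def base_def dbl_def)
    moreover have "vdiff R (\<lambda>a. - uu q a ?x) = vdiff R (\<lambda>a. - uu q a ?y)"
      unfolding vdiff_def by (intro prod.cong) (auto simp: u)
    moreover have "(\<Prod>a\<in>R. \<Prod>k<s. - uu q a ?x - l k) =
        (\<Prod>a\<in>R. \<Prod>k<s. - uu q a ?y - ?y ((k, 0), False) * ?y ((k, 0), True))"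
      by (intro prod.cong refl) (simp add: u calculation(1))
    ultimately show "Cfun q ?x R s l = f ?y"
      by (simp only: Cfun_def f_def)
  qed
  show ?thesis unfolding eq
    by (rule gexp_tendsto[OF A f]) (use R l in \<open>auto simp: B_def base_def\<close>)
qed

section \<open>Confluence of the columns belonging to vanishing eigenvalues\<close>

text \<open>The moment functional of the weight \<open>u ^ (q + p) * exp (- u)\<close>, which up to
  factorials is the \<open>p\<close>-th Taylor coefficient of \<open>Emom\<close> at
  \<open>l = 0\<close>.\<close>

definition Umom :: "nat \<Rightarrow> nat \<Rightarrow> complex poly \<Rightarrow> complex" where
  "Umom q p \<psi> = (\<Sum>m\<le>degree \<psi>. coeff \<psi> m * fact (m + q + p))"

text \<open>After division by \<open>e ^ p\<close> only the tail of the power series is left, and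
  its value at 0 is the coefficient of order \<open>p\<close>.\<close>

lemma mom_series_expand:
  "((\<lambda>e. (mom_series q m e - (\<Sum>j<p. e ^ j * (fact (m + q + j) / (fact j * fact (j + q))))) / e ^ p)
    \<longlongrightarrow> fact (m + q + p) / (fact p * fact (p + q))) (at (0 :: real))"
proof -
  define c where "c k = (fact (m + q + k) / (fact k * fact (k + q)) :: real)" for k
  have S: "summable (\<lambda>k. c k * e ^ k)" for e
    using mom_series_summable[of e m q] by (simp add: c_def mult.commute)
  have eq: "(mom_series q m e - (\<Sum>j<p. e ^ j * c j)) / e ^ p = (\<Sum>k. c (k + p) * e ^ k)" if "e \<noteq> 0" for e
  proof -
    have "mom_series q m e = (\<Sum>k. c (k + p) * e ^ (k + p)) + (\<Sum>j<p. c j * e ^ j)"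
      using suminf_split_initial_segment[OF S[of e], of p] by (simp add: mom_series_def c_def mult.commute)
    also have "(\<Sum>k. c (k + p) * e ^ (k + p)) = e ^ p * (\<Sum>k. c (k + p) * e ^ k)"
    proof (subst suminf_mult[symmetric])
      have "summable (\<lambda>k. c (k + p) * e ^ (k + p))" using S[of e] by (rule summable_ignore_initial_segment)
      then have "summable (\<lambda>k. (c (k + p) * e ^ (k + p)) / e ^ p)" by (rule summable_divide)
      then show "summable (\<lambda>k. c (k + p) * e ^ k)" using that by (simp add: power_add)
    qed (simp add: power_add mult_ac)
    finally show ?thesis using that by (simp add: mult.commute)
  qed
  have "((\<lambda>e. \<Sum>k. c (k + p) * e ^ k) \<longlongrightarrow> c (0 + p)) (at 0)"
  proof (rule powser_limit_0[of 1])
    fix e :: real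
    have "summable (\<lambda>k. c (k + p) * e ^ k)"
    proof (cases "e = 0")
      case False
      have "summable (\<lambda>k. c (k + p) * e ^ (k + p))" using S[of e] by (rule summable_ignore_initial_segment)
      then have "summable (\<lambda>k. (c (k + p) * e ^ (k + p)) / e ^ p)" by (rule summable_divide)
      then show ?thesis using False by (simp add: power_add)
    qed (rule summable_finite[of "{0}"]; auto)
    then show "(\<lambda>k. c (k + p) * e ^ k) sums (\<Sum>k. c (k + p) * e ^ k)" by (rule summable_sums)
  qed simp
  then have *: "((\<lambda>e. \<Sum>k. c (k + p) * e ^ k) \<longlongrightarrow> c p) (at 0)" by simp
  have "((\<lambda>e. (mom_series q m e - (\<Sum>j<p. e ^ j * c j)) / e ^ p) \<longlongrightarrow> c p) (at 0)"
    by (rule Lim_transform_eventually[OF *]) (auto simp: eventually_at_filter eq)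
  then show ?thesis unfolding c_def .
qed

lemma Emom_expand:
  "((\<lambda>e. (Emom q e \<psi> - (\<Sum>j<p. of_real (e ^ j / (fact j * fact (j + q))) * Umom q j \<psi>)) / of_real (e ^ p))
    \<longlongrightarrow> Umom q p \<psi> / (fact p * fact (p + q))) (at (0 :: real))"
proof -
  have eq: "(Emom q e \<psi> - (\<Sum>j<p. of_real (e ^ j / (fact j * fact (j + q))) * Umom q j \<psi>)) / of_real (e ^ p) =
    (\<Sum>m\<le>degree \<psi>. coeff \<psi> m * of_real ((mom_series q m e - (\<Sum>j<p. e ^ j * (fact (m + q + j) / (fact j * fact (j + q))))) / e ^ p))" for e
  proof -
    have "(\<Sum>j<p. of_real (e ^ j / (fact j * fact (j + q))) * Umom q j \<psi>) =
      (\<Sum>m\<le>degree \<psi>. coeff \<psi> m * of_real (\<Sum>j<p. e ^ j * (fact (m + q + j) / (fact j * fact (j + q)))))"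
      unfolding Umom_def sum_distrib_left of_real_sum
      by (subst sum.swap) (simp add: mult_ac)
    then have "Emom q e \<psi> - (\<Sum>j<p. of_real (e ^ j / (fact j * fact (j + q))) * Umom q j \<psi>) =
      (\<Sum>m\<le>degree \<psi>. coeff \<psi> m * of_real (mom_series q m e - (\<Sum>j<p. e ^ j * (fact (m + q + j) / (fact j * fact (j + q))))))"
      by (simp add: Emom_def sum_subtractf right_diff_distrib)
    then show ?thesis by (simp add: sum_divide_distrib)
  qed
  have "((\<lambda>e. \<Sum>m\<le>degree \<psi>. coeff \<psi> m * of_real ((mom_series q m e - (\<Sum>j<p. e ^ j * (fact (m + q + j) / (fact j * fact (j + q))))) / e ^ p))
     \<longlongrightarrow> (\<Sum>m\<le>degree \<psi>. coeff \<psi> m * of_real (fact (m + q + p) / (fact p * fact (p + q))))) (at 0)"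
    by (intro tendsto_intros mom_series_expand)
  also have "(\<Sum>m\<le>degree \<psi>. coeff \<psi> m * of_real (fact (m + q + p) / (fact p * fact (p + q)))) = Umom q p \<psi> / (fact p * fact (p + q))"
    by (simp add: Umom_def sum_divide_distrib)
  finally show ?thesis unfolding eq .
qed

text \<open>The cofactors along column \<open>k0\<close> do not see that column, so the coefficients
  \<open>c\<close> are independent of \<open>v\<close>.\<close>

lemma det_column_linear:
  fixes B :: "nat \<Rightarrow> nat \<Rightarrow> complex"
  assumes "k0 < s"
  obtains c where "\<And>v. det (fmat s (\<lambda>i k. if k = k0 then v i else B i k)) = (\<Sum>i<s. v i * c i)"
proof -
  have "det (fmat s (\<lambda>i k. if k = k0 then v i else B i k)) =
      (\<Sum>i<s. v i * cofactor (fmat s (\<lambda>i k. if k = k0 then 0 else B i k)) i k0)" for v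
  proof -
    let ?M = "fmat s (\<lambda>i k. if k = k0 then v i else B i k)"
    have "det ?M = (\<Sum>i<s. ?M $$ (i, k0) * cofactor ?M i k0)"
      using assms by (intro laplace_expansion_column) auto
    also have "\<dots> = (\<Sum>i<s. v i * cofactor (fmat s (\<lambda>i k. if k = k0 then 0 else B i k)) i k0)"
    proof (intro sum.cong refl arg_cong2[where f = "(*)"])
      fix i assume "i \<in> {..<s}"
      then have "mat_delete ?M i k0 = mat_delete (fmat s (\<lambda>i k. if k = k0 then 0 else B i k)) i k0"
        using assms by (intro eq_matI) (auto simp: mat_delete_def)
      then show "cofactor ?M i k0 = cofactor (fmat s (\<lambda>i k. if k = k0 then 0 else B i k)) i k0"
        by (simp add: cofactor_def)
    qed (use assms in auto)
    finally show ?thesis .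
  qed
  then show ?thesis by (rule that)
qed

text \<open>The last \<open>m\<close> columns are in confluent form.\<close>
definition Dconf :: "nat \<Rightarrow> nat \<Rightarrow> (nat \<Rightarrow> complex poly) \<Rightarrow> nat \<Rightarrow> (nat \<Rightarrow> real) \<Rightarrow> complex" where
  "Dconf q s \<psi> m l = det (fmat s (\<lambda>i k. if k < s - m then Emom q (l k) (\<psi> i) else Umom q (s - 1 - k) (\<psi> i)))"

text \<open>The Taylor terms of column \<open>k0\<close> of order below \<open>m\<close> are
  multiples of the columns already in confluent form and drop out of the determinant. The first
  surviving order is \<open>e ^ m\<close>.\<close>

lemma Dconf_step:
  assumes m: "m < s"
  shows "((\<lambda>e. Dconf q s \<psi> m (l(s - m - 1 := e)) / of_real (e ^ m)) \<longlongrightarrow>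
      Dconf q s \<psi> (Suc m) l / (fact m * fact (m + q))) (at 0)"
proof -
  define k0 where "k0 = s - m - 1"
  have k0: "k0 < s" using m by (auto simp: k0_def)
  define B where "B i k = (if k < s - m then Emom q (l k) (\<psi> i) else Umom q (s - 1 - k) (\<psi> i))" for i k
  obtain c where c: "\<And>v. det (fmat s (\<lambda>i k. if k = k0 then v i else B i k)) = (\<Sum>i<s. v i * c i)"
    using det_column_linear[OF k0] by blast
  have D: "Dconf q s \<psi> m (l(k0 := e)) = (\<Sum>i<s. Emom q e (\<psi> i) * c i)" for e
    unfolding c[symmetric] Dconf_def
    by (intro arg_cong[where f = det] cong_mat) (use m in \<open>auto simp: B_def k0_def\<close>)
  have D': "Dconf q s \<psi> (Suc m) l = (\<Sum>i<s. Umom q m (\<psi> i) * c i)"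
    unfolding c[symmetric] Dconf_def
    by (intro arg_cong[where f = det] cong_mat) (use m in \<open>auto simp: B_def k0_def\<close>)
  have Z: "(\<Sum>i<s. Umom q j (\<psi> i) * c i) = 0" if "j < m" for j
    unfolding c[symmetric]
  proof (rule det_identical_columns)
    show "k0 \<noteq> s - 1 - j" "k0 < s" "s - 1 - j < s" using that m by (auto simp: k0_def)
    show "col (fmat s (\<lambda>i k. if k = k0 then Umom q j (\<psi> i) else B i k)) k0 =
      col (fmat s (\<lambda>i k. if k = k0 then Umom q j (\<psi> i) else B i k)) (s - 1 - j)"
      using that m k0 by (intro eq_vecI) (auto simp: B_def k0_def)
  qed auto
  have eq: "Dconf q s \<psi> m (l(k0 := e)) / of_real (e ^ m) =
    (\<Sum>i<s. (Emom q e (\<psi> i) - (\<Sum>j<m. of_real (e ^ j / (fact j * fact (j + q))) * Umom q j (\<psi> i))) / of_real (e ^ m) * c i)" for e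
  proof -
    have "(\<Sum>i<s. (\<Sum>j<m. of_real (e ^ j / (fact j * fact (j + q))) * Umom q j (\<psi> i)) * c i) =
      (\<Sum>j<m. of_real (e ^ j / (fact j * fact (j + q))) * (\<Sum>i<s. Umom q j (\<psi> i) * c i))"
      unfolding sum_distrib_left sum_distrib_right by (subst sum.swap) (simp add: mult.assoc)
    also have "\<dots> = 0" by (simp add: Z)
    finally show ?thesis
      unfolding D by (simp add: sum_divide_distrib[symmetric] left_diff_distrib sum_subtractf)
  qed
  have "((\<lambda>e. Dconf q s \<psi> m (l(k0 := e)) / of_real (e ^ m)) \<longlongrightarrow>
      (\<Sum>i<s. Umom q m (\<psi> i) / (fact m * fact (m + q)) * c i)) (at 0)"
    unfolding eq by (intro tendsto_intros Emom_expand)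
  then show ?thesis unfolding D' by (simp add: k0_def sum_divide_distrib)
qed

lemma tendsto_at_zero_seq:
  assumes "(f \<longlongrightarrow> L) (at (0 :: real))"
  shows "(\<lambda>n. f (inverse (real (Suc n)))) \<longlonglongrightarrow> L"
  using LIMSEQ_inverse_real_of_nat
  by (intro filterlim_compose[OF assms]) (auto simp: filterlim_at)

lemma Cexp_empty: "Cexp q {} s z l = 1"
proof -
  interpret prob_space "PiM {} (\<lambda>c :: nat \<times> nat. cgauss 0)"
    by (rule prob_space_PiM[OF prob_space_cgauss])
  have "measure (PiM {} (\<lambda>c :: nat \<times> nat. cgauss 0)) (space (PiM {} (\<lambda>c :: nat \<times> nat. cgauss 0))) = 1"
    by (rule prob_space)
  then show ?thesis by (simp add: Cexp_def gexp_def Cfun_def vdiff_def)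
qed

text \<open>Vanishing eigenvalues are split off one at a time; the power of the small parameter that
  cancels on both sides is the number of columns already in confluent form.\<close>
lemma Dconf_identity:
  fixes z :: "nat \<Rightarrow> complex"
  assumes R: "finite R" "\<And>a. a \<in> R \<Longrightarrow> s \<le> a" and m: "m \<le> s"
    and l: "\<And>k. s - m \<le> k \<Longrightarrow> k < s \<Longrightarrow> l k = 0"
  shows "Cexp q R s z (\<lambda>k. of_real (l k)) * Dconf q s (\<lambda>i. monom 1 i) m l =
    vdiff R z * Dconf q s (\<lambda>i. monom 1 i * (\<Prod>a\<in>R. [:z a, -1:])) m l"
  using m l
proof (induction m arbitrary: l)
  case 0
  define E where "E = (\<Prod>k<s. complex_of_real (exp (- l k)))"
  have E: "E \<noteq> 0" by (simp add: E_def)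
  have D: "det (fmat s (\<lambda>i k. of_real (exp (- l k)) * Emom q (l k) (\<psi> i))) = E * Dconf q s \<psi> 0 l" for \<psi>
  proof -
    have "det (fmat s (\<lambda>i k. of_real (exp (- l k)) * Emom q (l k) (\<psi> i))) =
      det (fmat s (\<lambda>i k. Emom q (l k) (\<psi> i) * of_real (exp (- l k))))"
      by (simp add: mult.commute)
    also have "\<dots> = det (fmat s (\<lambda>i k. Emom q (l k) (\<psi> i))) * E"
      unfolding E_def by (rule det_scale_columns)
    also have "det (fmat s (\<lambda>i k. Emom q (l k) (\<psi> i))) = Dconf q s \<psi> 0 l"
      unfolding Dconf_def by (intro arg_cong[where f = det] cong_mat) auto
    finally show ?thesis by simp
  qed
  \<comment> \<open>The case \<open>R = {}\<close> of \<open>chi_side\<close> expresses the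
    Vandermonde determinant of \<open>l\<close> by the moments and thereby supplies the
    normalisation.\<close>
  have "vdiff {..<s} (\<lambda>k. of_real (l k)) = E * Dconf q s (\<lambda>i. monom 1 i) 0 l"
    using chi_side[of "{}" s l q z] by (simp add: Cexp_empty D vdiff_def)
  then have "E * (Cexp q R s z (\<lambda>k. of_real (l k)) * Dconf q s (\<lambda>i. monom 1 i) 0 l) =
    E * (vdiff R z * Dconf q s (\<lambda>i. monom 1 i * (\<Prod>a\<in>R. [:z a, -1:])) 0 l)"
    using chi_side[OF R, of l q z] by (simp add: D mult_ac)
  then show ?case using E by simp
next
  case (Suc m)
  define k0 where "k0 = s - m - 1"
  have m: "m < s" using Suc.prems by simp
  define e where "e n = inverse (real (Suc n))" for n
  have e: "e n \<noteq> 0" for n by (simp add: e_def)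
  have e0: "e \<longlonglongrightarrow> 0" unfolding e_def by (rule LIMSEQ_inverse_real_of_nat)
  define l' where "l' n = l(k0 := e n)" for n
  let ?C = "\<lambda>l :: nat \<Rightarrow> real. Cexp q R s z (\<lambda>k. of_real (l k))"
  have lim: "(\<lambda>n. Dconf q s \<psi> m (l' n) / of_real (e n ^ m)) \<longlonglongrightarrow> Dconf q s \<psi> (Suc m) l / (fact m * fact (m + q))" for \<psi>
    using tendsto_at_zero_seq[OF Dconf_step[OF m, of q \<psi> l]] by (simp add: l'_def e_def k0_def)
  have C: "(\<lambda>n. ?C (l' n)) \<longlonglongrightarrow> ?C l"
  proof (rule Cexp_tendsto[OF R])
    fix k assume "k < s"
    show "(\<lambda>n. complex_of_real (l' n k)) \<longlonglongrightarrow> of_real (l k)"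
      using e0 Suc.prems(2)[of k0] m by (cases "k = k0") (auto simp: l'_def k0_def intro!: tendsto_eq_intros)
  qed
  have IH: "?C (l' n) * Dconf q s (\<lambda>i. monom 1 i) m (l' n) =
    vdiff R z * Dconf q s (\<lambda>i. monom 1 i * (\<Prod>a\<in>R. [:z a, -1:])) m (l' n)" for n
    using Suc.prems m by (intro Suc.IH) (auto simp: l'_def k0_def)
  have a1: "(\<lambda>n. ?C (l' n) * (Dconf q s (\<lambda>i. monom 1 i) m (l' n) / of_real (e n ^ m))) \<longlonglongrightarrow>
      ?C l * (Dconf q s (\<lambda>i. monom 1 i) (Suc m) l / (fact m * fact (m + q)))"
    by (intro tendsto_mult C lim)
  have a2: "(\<lambda>n. vdiff R z * (Dconf q s (\<lambda>i. monom 1 i * (\<Prod>a\<in>R. [:z a, -1:])) m (l' n) / of_real (e n ^ m))) \<longlonglongrightarrow>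
      vdiff R z * (Dconf q s (\<lambda>i. monom 1 i * (\<Prod>a\<in>R. [:z a, -1:])) (Suc m) l / (fact m * fact (m + q)))"
    by (intro tendsto_mult tendsto_const lim)
  have eq: "(\<lambda>n. ?C (l' n) * (Dconf q s (\<lambda>i. monom 1 i) m (l' n) / of_real (e n ^ m))) =
    (\<lambda>n. vdiff R z * (Dconf q s (\<lambda>i. monom 1 i * (\<Prod>a\<in>R. [:z a, -1:])) m (l' n) / of_real (e n ^ m)))"
    unfolding times_divide_eq_right IH ..
  have "?C l * (Dconf q s (\<lambda>i. monom 1 i) (Suc m) l / (fact m * fact (m + q))) =
     vdiff R z * (Dconf q s (\<lambda>i. monom 1 i * (\<Prod>a\<in>R. [:z a, -1:])) (Suc m) l / (fact m * fact (m + q)))"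
    by (rule LIMSEQ_unique[OF a1[unfolded eq] a2])
  then show ?case by (simp add: divide_simps)
qed

text \<open>This yields nonvanishing for distinct positive eigenvalues. Sending the last remaining
  variable to 0 turns its Vandermonde factors into \<open>- l k\<close>: one more power of every
  remaining \<open>l k\<close>, and the sign \<open>(-1) ^ k0\<close>.\<close>

lemma Dconf_product:
  assumes m: "m \<le> s"
  shows "\<exists>c\<noteq>0. \<forall>l. Dconf q s (\<lambda>i. monom 1 i) m l =
    c * (\<Prod>k<s - m. of_real (exp (l k) * l k ^ m)) * vdiff {..<s - m} (\<lambda>k. of_real (l k))"
  using m
proof (induction m)
  case 0
  have "Dconf q s (\<lambda>i. monom 1 i) 0 l = 1 * (\<Prod>k<s - 0. of_real (exp (l k) * l k ^ 0)) * vdiff {..<s - 0} (\<lambda>k. of_real (l k))" for l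
  proof -
    have "vdiff {..<s} (\<lambda>k. of_real (l k)) = det (fmat s (\<lambda>i k. of_real (exp (- l k)) * Emom q (l k) (monom 1 i)))"
      using chi_side[of "{}" s l q "\<lambda>_. 0"] by (simp add: Cexp_empty vdiff_def)
    also have "\<dots> = det (fmat s (\<lambda>i k. Emom q (l k) (monom 1 i) * of_real (exp (- l k))))"
      by (simp add: mult.commute)
    also have "\<dots> = det (fmat s (\<lambda>i k. Emom q (l k) (monom 1 i))) * (\<Prod>k<s. complex_of_real (exp (- l k)))"
      by (rule det_scale_columns)
    also have "det (fmat s (\<lambda>i k. Emom q (l k) (monom 1 i))) = Dconf q s (\<lambda>i. monom 1 i) 0 l"
      unfolding Dconf_def by (intro arg_cong[where f = det] cong_mat) auto
    finally have "(\<Prod>k<s. of_real (exp (l k))) * vdiff {..<s} (\<lambda>k. of_real (l k)) =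
       Dconf q s (\<lambda>i. monom 1 i) 0 l * ((\<Prod>k<s. of_real (exp (l k))) * (\<Prod>k<s. complex_of_real (exp (- l k))))"
      by (simp only: mult_ac)
    also have "(\<Prod>k<s. of_real (exp (l k))) * (\<Prod>k<s. complex_of_real (exp (- l k))) = 1"
      unfolding prod.distrib[symmetric] by (simp flip: of_real_mult exp_add)
    finally show ?thesis by simp
  qed
  then show ?case by (intro exI[of _ 1]) simp
next
  case (Suc m)
  then have m: "m < s" by simp
  define k0 where "k0 = s - m - 1"
  have k0: "s - m = Suc k0" "s - Suc m = k0" using m by (auto simp: k0_def)
  obtain c where c: "c \<noteq> 0" "\<And>l. Dconf q s (\<lambda>i. monom 1 i) m l =
    c * (\<Prod>k<s - m. of_real (exp (l k) * l k ^ m)) * vdiff {..<s - m} (\<lambda>k. of_real (l k))"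
    using Suc by auto
  define c' :: complex where "c' = c * fact m * fact (m + q) * (-1) ^ k0"
  have "Dconf q s (\<lambda>i. monom 1 i) (Suc m) l =
    c' * (\<Prod>k<s - Suc m. of_real (exp (l k) * l k ^ Suc m)) * vdiff {..<s - Suc m} (\<lambda>k. of_real (l k))" for l
  proof -
    define K :: complex where "K = (\<Prod>k<k0. of_real (exp (l k) * l k ^ m))"
    define V where "V = vdiff {..<k0} (\<lambda>k. of_real (l k))"
    have "Dconf q s (\<lambda>i. monom 1 i) m (l(k0 := e)) / of_real (e ^ m) =
      c * K * of_real (exp e) * V * (\<Prod>k<k0. of_real (e - l k))" if "e \<noteq> 0" for e
    proof -
      have "Dconf q s (\<lambda>i. monom 1 i) m (l(k0 := e)) = c * K * of_real (exp e * e ^ m) * (V * (\<Prod>k<k0. of_real (e - l k)))"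
        unfolding c(2) k0 K_def V_def vdiff_lessThan by simp
      then show ?thesis using that by simp
    qed
    moreover have "((\<lambda>e. c * K * of_real (exp e) * V * (\<Prod>k<k0. of_real (e - l k))) \<longlongrightarrow>
       c * K * of_real (exp 0) * V * (\<Prod>k<k0. of_real (0 - l k))) (at 0)"
      by (intro tendsto_intros)
    ultimately have "((\<lambda>e. Dconf q s (\<lambda>i. monom 1 i) m (l(k0 := e)) / of_real (e ^ m)) \<longlongrightarrow>
       c * K * V * (\<Prod>k<k0. of_real (- l k))) (at 0)"
      by (subst Lim_cong_within[OF refl refl refl]) (auto)
    then have "Dconf q s (\<lambda>i. monom 1 i) (Suc m) l / (fact m * fact (m + q)) = c * K * V * (\<Prod>k<k0. of_real (- l k))"
      using Dconf_step[OF m, of q "\<lambda>i. monom 1 i" l] unfolding k0_def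
      by (intro tendsto_unique[of "at (0 :: real)"]) auto
    then have "Dconf q s (\<lambda>i. monom 1 i) (Suc m) l = fact m * fact (m + q) * (c * K * V * (\<Prod>k<k0. of_real (- l k)))"
      by (simp add: field_simps)
    also have "(\<Prod>k<k0. complex_of_real (- l k)) = (-1) ^ k0 * (\<Prod>k<k0. of_real (l k))"
      by (simp add: prod_uminus)
    also have "fact m * fact (m + q) * (c * K * V * ((-1) ^ k0 * (\<Prod>k<k0. of_real (l k)))) =
        c' * (K * (\<Prod>k<k0. of_real (l k))) * V"
      by (simp only: c'_def mult_ac)
    also have "K * (\<Prod>k<k0. of_real (l k)) = (\<Prod>k<k0. of_real (exp (l k) * l k ^ Suc m))"
      unfolding K_def prod.distrib[symmetric] by (simp add: mult_ac)
    finally show ?thesis unfolding k0 V_def .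
  qed
  moreover have "c' \<noteq> 0" using c(1) by (simp add: c'_def)
  ultimately show ?case by blast
qed

section \<open>The column weights and their moments\<close>

text \<open>\<open>z\<^bsup>q/2\<^esup> * gser q z\<close> is the Bessel function \<open>I\<^sub>q (2 * sqrt z)\<close>.\<close>
definition gser :: "nat \<Rightarrow> real \<Rightarrow> real" where
  "gser q z = (\<Sum>k. z ^ k / (fact k * fact (k + q)))"

lemma gser_summable: "summable (\<lambda>k. z ^ k / (fact k * fact (k + q)) :: real)"
proof (rule summable_comparison_test')
  show "summable (\<lambda>k. \<bar>z\<bar> ^ k /\<^sub>R fact k)" by (rule summable_exp_generic)
  fix k :: nat
  have "\<bar>z\<bar> ^ k / (fact k * fact (k + q)) \<le> \<bar>z\<bar> ^ k / (fact k * 1)"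
    by (intro divide_left_mono mult_left_mono fact_ge_1 mult_pos_pos) auto
  then show "norm (z ^ k / (fact k * fact (k + q))) \<le> \<bar>z\<bar> ^ k /\<^sub>R fact k"
    by (simp add: abs_mult power_abs divide_inverse mult.commute)
qed

lemma gser_nonneg: "0 \<le> z \<Longrightarrow> 0 \<le> gser q z"
  unfolding gser_def by (intro suminf_nonneg gser_summable) auto

lemma gser_measurable [measurable]: "gser q \<in> borel_measurable borel"
  unfolding gser_def[abs_def] by measurable

text \<open>Termwise \<open>(l u)\<^sup>k / k!\<^sup>2 = ((u/4)\<^sup>k / k!) * ((4 l)\<^sup>k / k!)\<close>.\<close>
lemma gser_bound:
  assumes "0 \<le> l" "0 \<le> u"
  shows "gser q (l * u) \<le> exp (4 * l) * exp (u / 4)"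
proof -
  define a where "a k = (u / 4) ^ k / fact k" for k
  define b where "b k = (4 * l) ^ k / fact k" for k
  have "a = (\<lambda>k. (u / 4) ^ k /\<^sub>R fact k)"
    by (rule ext) (simp only: a_def divide_inverse_commute real_scaleR_def)
  then have a1: "a sums exp (u / 4)" by (simp only: exp_converges)
  have a2: "0 \<le> a k" for k using assms unfolding a_def by (intro divide_nonneg_nonneg zero_le_power) auto
  note a = a1 a2
  have "b = (\<lambda>k. (4 * l) ^ k /\<^sub>R fact k)"
    by (rule ext) (simp only: b_def divide_inverse_commute real_scaleR_def)
  then have b1: "b sums exp (4 * l)" by (simp only: exp_converges)
  have b2: "0 \<le> b k" for k using assms unfolding b_def by (intro divide_nonneg_nonneg zero_le_power) auto
  note b = b1 b2
  have bk: "b k \<le> exp (4 * l)" for k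
    using sum_le_suminf[of b "{k}"] b by (auto simp: sums_iff)
  have "(l * u) ^ k / (fact k * fact (k + q)) \<le> exp (4 * l) * a k" for k
  proof -
    have "(l * u) ^ k / (fact k * fact (k + q)) \<le> (l * u) ^ k / (fact k * fact k)"
      using assms by (intro divide_left_mono mult_left_mono fact_mono mult_pos_pos) auto
    also have "\<dots> = b k * a k"
      by (simp add: a_def b_def power_mult_distrib power_divide)
    also have "\<dots> \<le> exp (4 * l) * a k" by (intro mult_right_mono bk a)
    finally show ?thesis .
  qed
  then have "gser q (l * u) \<le> (\<Sum>k. exp (4 * l) * a k)"
    unfolding gser_def using a by (intro suminf_le gser_summable summable_mult) (auto simp: sums_iff)
  also have "\<dots> = exp (4 * l) * exp (u / 4)"
    using a by (subst suminf_mult) (auto simp: sums_iff)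
  finally show ?thesis .
qed

text \<open>With \<open>w u = gser q (l * u)\<close> this is \<open>exp l\<close> times the
  noncentral chi-square law of \<open>gexp_uu_power\<close>; with \<open>w u = u ^ p\<close> it is
  the weight of a confluent column.\<close>

definition colm :: "nat \<Rightarrow> (real \<Rightarrow> real) \<Rightarrow> real measure" where
  "colm q w = density lborel (\<lambda>u. ennreal (indicator {0..} u * (u ^ q * exp (- u) * w u)))"

text \<open>The weight and the test function each consume a quarter of the decay of
  \<open>exp (- u)\<close>, which leaves \<open>exp (- (u / 2))\<close>.\<close>

lemma nn_integral_colm_exp:
  assumes w: "\<And>u. 0 \<le> u \<Longrightarrow> w u \<le> K * exp (u / 4)" and [measurable]: "w \<in> borel_measurable borel"
    and K: "K \<ge> 0"
  shows "(\<integral>\<^sup>+u. ennreal (exp (u / 4)) \<partial>colm q w) < \<infinity>"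
proof -
  have "(\<integral>\<^sup>+u. ennreal (exp (u / 4)) \<partial>colm q w) =
      (\<integral>\<^sup>+u. ennreal (indicator {0..} u * (u ^ q * exp (- u) * w u)) * ennreal (exp (u / 4)) \<partial>lborel)"
    unfolding colm_def by (subst nn_integral_density) auto
  also have "\<dots> \<le> (\<integral>\<^sup>+u. ennreal K * (ennreal (u ^ q * exp (- (u / 2))) * indicator {0..} u) \<partial>lborel)"
  proof (intro nn_integral_mono)
    fix u :: real
    show "ennreal (indicator {0..} u * (u ^ q * exp (- u) * w u)) * ennreal (exp (u / 4)) \<le>
      ennreal K * (ennreal (u ^ q * exp (- (u / 2))) * indicator {0..} u)"
    proof (cases "u \<ge> 0")
      case True
      have "u ^ q * exp (- u) * w u * exp (u / 4) \<le> u ^ q * exp (- u) * (K * exp (u / 4)) * exp (u / 4)"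
        using True w[OF True] by (intro mult_right_mono mult_left_mono) auto
      also have "\<dots> = K * (u ^ q * (exp (- u) * (exp (u / 4) * exp (u / 4))))" by (simp add: mult_ac)
      also have "exp (- u) * (exp (u / 4) * exp (u / 4)) = exp (- (u / 2))"
        by (simp flip: exp_add)
      finally show ?thesis using True K
        by (simp add: ennreal_mult''[symmetric] ennreal_mult'[symmetric] ennreal_leI)
    qed simp
  qed
  also have "\<dots> = ennreal K * (\<integral>\<^sup>+u. ennreal (u ^ q * exp (- (u / 2))) * indicator {0..} u \<partial>lborel)"
    by (rule nn_integral_cmult) measurable
  also have "(\<integral>\<^sup>+u. ennreal (u ^ q * exp (- (u / 2))) * indicator {0..} u \<partial>lborel) =
      2 * (\<integral>\<^sup>+u. ennreal ((2 * u) ^ q * exp (- u)) * indicator {0..} (2 * u) \<partial>lborel)"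
    by (subst nn_integral_real_affine[of _ 2 0]) auto
  also have "(\<integral>\<^sup>+u. ennreal ((2 * u) ^ q * exp (- u)) * indicator {0..} (2 * u) \<partial>lborel) =
      (\<integral>\<^sup>+u. ennreal (2 ^ q) * (ennreal (u ^ q * exp (- u)) * indicator {0..} u) \<partial>lborel)"
    by (intro nn_integral_cong) (auto simp: indicator_def power_mult_distrib ennreal_mult'[symmetric] mult.assoc)
  also have "\<dots> = ennreal (2 ^ q) * ennreal (fact q)"
    by (subst nn_integral_cmult) (auto simp: nn_intergal_power_times_exp_Ici)
  finally show ?thesis
    by (rule order.strict_trans1) (auto simp: ennreal_mult_less_top ennreal_mult_eq_top_iff less_top[symmetric])
qed

lemma colm_sets [measurable_cong, simp]: "sets (colm q w) = sets borel"
  by (simp add: colm_def)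

lemma AE_colm_nonneg: "w \<in> borel_measurable borel \<Longrightarrow> AE u in colm q w. 0 \<le> u"
  unfolding colm_def by (subst AE_density) (auto simp: indicator_def)

text \<open>A common interface to the Bessel weights and the power weights: both are nonnegative and
  grow at rate at most 1/4.\<close>

locale column =
  fixes q :: nat and w :: "real \<Rightarrow> real" and K :: real
  assumes w_measurable [measurable]: "w \<in> borel_measurable borel"
    and w_nonneg: "\<And>u. 0 \<le> u \<Longrightarrow> 0 \<le> w u"
    and w_bound: "\<And>u. 0 \<le> u \<Longrightarrow> w u \<le> K * exp (u / 4)"
begin

lemma K_nonneg: "K \<ge> 0"
  using w_nonneg[of 0] w_bound[of 0] by simp

lemma integrable_exp: "integrable (colm q w) (\<lambda>u. exp (u / 4))"
  using nn_integral_colm_exp[OF w_bound w_measurable K_nonneg]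
  by (intro integrableI_bounded) auto

lemma integrable_bound:
  fixes f :: "real \<Rightarrow> 'b :: {banach, second_countable_topology}"
  assumes f: "f \<in> borel_measurable borel" and b: "\<And>u. 0 \<le> u \<Longrightarrow> norm (f u) \<le> C * exp (u / 4)"
  shows "integrable (colm q w) f"
proof (rule Bochner_Integration.integrable_bound)
  show "integrable (colm q w) (\<lambda>u. C * exp (u / 4))" using integrable_exp by simp
  show "AE u in colm q w. norm (f u) \<le> norm (C * exp (u / 4))"
    using AE_colm_nonneg[OF w_measurable] by eventually_elim (use b in force)
qed (use f in auto)

end

lemma power_le_exp: "\<exists>C::real. \<forall>u\<ge>0. u ^ n \<le> C * exp (u * d)" if "d > 0" for d :: real
proof (intro exI[of _ "fact n / d ^ n"] allI impI)
  fix u :: real assume u: "0 \<le> u"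
  have e: "(\<lambda>k. (u * d) ^ k /\<^sub>R fact k) sums exp (u * d)" by (rule exp_converges)
  have "(u * d) ^ n /\<^sub>R fact n \<le> exp (u * d)"
    using sum_le_suminf[of "\<lambda>k. (u * d) ^ k /\<^sub>R fact k" "{n}"] e u that by (auto simp: sums_iff)
  then show "u ^ n \<le> fact n / d ^ n * exp (u * d)"
    using that by (simp add: field_simps power_mult_distrib)
qed

lemma poly_le_exp:
  fixes p :: "complex poly"
  assumes "d > 0"
  shows "\<exists>C. \<forall>u\<ge>0. norm (poly p (of_real u)) \<le> C * exp (u * d)"
proof -
  have "\<forall>n. \<exists>C::real. \<forall>u\<ge>0. u ^ n \<le> C * exp (u * d)" using power_le_exp[OF assms] by blast
  then obtain C where C: "\<And>n u. 0 \<le> u \<Longrightarrow> u ^ n \<le> C n * exp (u * d)" by metis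
  have "norm (poly p (of_real u)) \<le> (\<Sum>i\<le>degree p. norm (coeff p i) * C i) * exp (u * d)" if "0 \<le> u" for u
  proof -
    have "norm (poly p (of_real u)) \<le> (\<Sum>i\<le>degree p. norm (coeff p i) * u ^ i)"
      unfolding poly_altdef using that by (intro sum_norm_le) (simp add: norm_mult norm_power)
    also have "\<dots> \<le> (\<Sum>i\<le>degree p. norm (coeff p i) * (C i * exp (u * d)))"
      using C that by (intro sum_mono mult_left_mono) auto
    finally show ?thesis by (simp add: sum_distrib_right mult.assoc)
  qed
  then show ?thesis by blast
qed

lemma column_power: "\<exists>K. column (\<lambda>u. u ^ p) K"
proof -
  obtain C where "\<And>u::real. 0 \<le> u \<Longrightarrow> u ^ p \<le> C * exp (u / 4)"
    using power_le_exp[of "1/4" p] by auto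
  then have "column (\<lambda>u. u ^ p) C" by unfold_locales auto
  then show ?thesis by blast
qed

lemma column_gser: "0 \<le> l \<Longrightarrow> column (\<lambda>u. gser q (l * u)) (exp (4 * l))"
  by unfold_locales (auto intro: gser_nonneg gser_bound)

lemma (in column) integral_poly:
  assumes "\<And>m. (\<integral>u. u ^ m \<partial>colm q w) = M m"
  shows "(\<integral>u. poly p (complex_of_real u) \<partial>colm q w) = (\<Sum>m\<le>degree p. coeff p m * of_real (M m))"
proof -
  have i: "integrable (colm q w) (\<lambda>u. u ^ m)" for m
  proof -
    obtain C where "\<And>u::real. 0 \<le> u \<Longrightarrow> u ^ m \<le> C * exp (u / 4)"
      using power_le_exp[of "1/4" m] by auto
    then show ?thesis by (intro integrable_bound[of _ C]) auto
  qed
  have "(\<integral>u. poly p (complex_of_real u) \<partial>colm q w) = (\<Sum>m\<le>degree p. \<integral>u. coeff p m * complex_of_real (u ^ m) \<partial>colm q w)"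
    unfolding poly_altdef of_real_power[symmetric]
    by (intro Bochner_Integration.integral_sum integrable_mult_right integrable_of_real i)
  then show ?thesis by (simp add: assms flip: of_real_power)
qed

lemma integral_colm_power:
  "(\<integral>u. u ^ m \<partial>colm q (\<lambda>u. u ^ p)) = fact (m + q + p)"
proof -
  have "(\<integral>u. u ^ m \<partial>colm q (\<lambda>u. u ^ p)) = (\<integral>u. indicator {0..} u * (u ^ q * exp (- u) * u ^ p) * u ^ m \<partial>lborel)"
    unfolding colm_def by (subst integral_density) (auto simp: indicator_def)
  also have "\<dots> = (\<integral>u. u ^ (m + q + p) * exp (- u) * indicator {0..} u \<partial>lborel)"
    by (intro Bochner_Integration.integral_cong) (auto simp: power_add)
  also have "\<dots> = enn2real (\<integral>\<^sup>+u. ennreal (u ^ (m + q + p) * exp (- u)) * indicator {0..} u \<partial>lborel)"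
    by (subst integral_eq_nn_integral) (auto simp: indicator_def intro!: arg_cong[where f = enn2real] nn_integral_cong)
  also have "\<dots> = fact (m + q + p)"
    by (simp add: nn_intergal_power_times_exp_Ici)
  finally show ?thesis .
qed

text \<open>All terms are nonnegative, so series and integral are interchanged in
  \<open>ennreal\<close>, and each term is a factorial integral.\<close>

lemma integral_colm_gser:
  assumes l: "0 \<le> l"
  shows "(\<integral>u. u ^ m \<partial>colm q (\<lambda>u. gser q (l * u))) = mom_series q m l"
proof -
  define c where "c k = l ^ k / (fact k * fact (k + q))" for k
  have c: "0 \<le> c k" for k using l by (simp add: c_def)
  have "(\<integral>u. u ^ m \<partial>colm q (\<lambda>u. gser q (l * u))) =
      (\<integral>u. indicator {0..} u * (u ^ q * exp (- u) * gser q (l * u)) * u ^ m \<partial>lborel)"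
    unfolding colm_def using l by (subst integral_density) (auto simp: indicator_def gser_nonneg)
  also have "\<dots> = enn2real (\<integral>\<^sup>+u. ennreal (indicator {0..} u * (u ^ q * exp (- u) * gser q (l * u)) * u ^ m) \<partial>lborel)"
    using l by (subst integral_eq_nn_integral) (auto simp: indicator_def gser_nonneg)
  also have "(\<integral>\<^sup>+u. ennreal (indicator {0..} u * (u ^ q * exp (- u) * gser q (l * u)) * u ^ m) \<partial>lborel) =
     (\<integral>\<^sup>+u. (\<Sum>k. ennreal (c k) * (ennreal (u ^ (m + q + k) * exp (- u)) * indicator {0..} u)) \<partial>lborel)"
  proof (intro nn_integral_cong)
    fix u :: real
    show "ennreal (indicator {0..} u * (u ^ q * exp (- u) * gser q (l * u)) * u ^ m) =
      (\<Sum>k. ennreal (c k) * (ennreal (u ^ (m + q + k) * exp (- u)) * indicator {0..} u))"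
    proof (cases "u \<ge> 0")
      case True
      have eq: "c k * (u ^ (m + q + k) * exp (- u)) = (u ^ q * exp (- u) * u ^ m) * ((l * u) ^ k / (fact k * fact (k + q)))" for k
        by (simp add: c_def power_add power_mult_distrib)
      have s: "summable (\<lambda>k. c k * (u ^ (m + q + k) * exp (- u)))"
        unfolding eq by (intro summable_mult gser_summable)
      have "(\<Sum>k. ennreal (c k * (u ^ (m + q + k) * exp (- u)))) = ennreal (\<Sum>k. c k * (u ^ (m + q + k) * exp (- u)))"
        using c True by (intro suminf_ennreal2 s) auto
      also have "(\<Sum>k. c k * (u ^ (m + q + k) * exp (- u))) = (u ^ q * exp (- u) * u ^ m) * gser q (l * u)"
        unfolding eq gser_def by (rule suminf_mult[OF gser_summable])
      finally show ?thesis using True c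
        by (simp add: ennreal_mult'[symmetric] mult_ac)
    qed simp
  qed
  also have "\<dots> = (\<Sum>k. \<integral>\<^sup>+u. ennreal (c k) * (ennreal (u ^ (m + q + k) * exp (- u)) * indicator {0..} u) \<partial>lborel)"
    by (rule nn_integral_suminf) measurable
  also have "\<dots> = (\<Sum>k. ennreal (c k) * ennreal (fact (m + q + k)))"
    by (subst nn_integral_cmult) (auto simp: nn_intergal_power_times_exp_Ici)
  also have "\<dots> = (\<Sum>k. ennreal (l ^ k * fact (m + q + k) / (fact k * fact (k + q))))"
    using c by (intro arg_cong[where f = suminf] ext)
      (simp add: c_def ennreal_mult'[symmetric])
  also have "\<dots> = ennreal (mom_series q m l)"
    unfolding mom_series_def using l by (intro suminf_ennreal2 mom_series_summable) auto
  also have "enn2real \<dots> = mom_series q m l"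
    unfolding mom_series_def using l by (intro enn2real_ennreal suminf_nonneg mom_series_summable) auto
  finally show ?thesis .
qed

section \<open>Weighted polynomial approximation on the half-line\<close>

text \<open>Polynomials grow on the half-line, so closeness can only be asked relative to an
  exponential; the rate \<theta> is later matched to the integrability of the Gaussian
  matrix.\<close>

definition wapprox :: "real \<Rightarrow> (real \<Rightarrow> real) \<Rightarrow> bool" where
  "wapprox \<theta> h \<longleftrightarrow> (\<forall>\<epsilon>>0. \<exists>p. \<forall>u\<ge>0. \<bar>h u - poly p u\<bar> \<le> \<epsilon> * exp (\<theta> * u))"

lemma wapprox_closed:
  assumes "\<And>\<epsilon>. \<epsilon> > 0 \<Longrightarrow> \<exists>g. wapprox \<theta> g \<and> (\<forall>u\<ge>0. \<bar>h u - g u\<bar> \<le> \<epsilon> * exp (\<theta> * u))"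
  shows "wapprox \<theta> h"
  unfolding wapprox_def
proof (intro allI impI)
  fix \<epsilon> :: real assume e: "\<epsilon> > 0"
  obtain g where g: "wapprox \<theta> g" "\<And>u. u \<ge> 0 \<Longrightarrow> \<bar>h u - g u\<bar> \<le> \<epsilon> / 2 * exp (\<theta> * u)"
    using assms[of "\<epsilon> / 2"] e by auto
  obtain p where p: "\<And>u. u \<ge> 0 \<Longrightarrow> \<bar>g u - poly p u\<bar> \<le> \<epsilon> / 2 * exp (\<theta> * u)"
    using g(1) e unfolding wapprox_def by (meson half_gt_zero)
  have "\<bar>h u - poly p u\<bar> \<le> \<epsilon> * exp (\<theta> * u)" if "u \<ge> 0" for u
  proof -
    have "\<bar>h u - poly p u\<bar> \<le> \<bar>h u - g u\<bar> + \<bar>g u - poly p u\<bar>" by simp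
    also have "\<dots> \<le> \<epsilon> / 2 * exp (\<theta> * u) + \<epsilon> / 2 * exp (\<theta> * u)"
      by (intro add_mono g(2) p that)
    finally show ?thesis by simp
  qed
  then show "\<exists>p. \<forall>u\<ge>0. \<bar>h u - poly p u\<bar> \<le> \<epsilon> * exp (\<theta> * u)" by blast
qed

lemma wapprox_add: "wapprox \<theta> f \<Longrightarrow> wapprox \<theta> g \<Longrightarrow> wapprox \<theta> (\<lambda>u. f u + g u)"
  unfolding wapprox_def
proof (intro allI impI)
  fix \<epsilon> :: real assume e: "\<epsilon> > 0" and
    f: "\<forall>\<epsilon>>0. \<exists>p. \<forall>u\<ge>0. \<bar>f u - poly p u\<bar> \<le> \<epsilon> * exp (\<theta> * u)" and
    g: "\<forall>\<epsilon>>0. \<exists>p. \<forall>u\<ge>0. \<bar>g u - poly p u\<bar> \<le> \<epsilon> * exp (\<theta> * u)"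
  obtain p where p: "\<And>u. u \<ge> 0 \<Longrightarrow> \<bar>f u - poly p u\<bar> \<le> \<epsilon> / 2 * exp (\<theta> * u)"
    using f e by (meson half_gt_zero)
  obtain r where r: "\<And>u. u \<ge> 0 \<Longrightarrow> \<bar>g u - poly r u\<bar> \<le> \<epsilon> / 2 * exp (\<theta> * u)"
    using g e by (meson half_gt_zero)
  have "\<bar>(f u + g u) - poly (p + r) u\<bar> \<le> \<epsilon> * exp (\<theta> * u)" if "u \<ge> 0" for u
  proof -
    have "\<bar>(f u + g u) - poly (p + r) u\<bar> \<le> \<bar>f u - poly p u\<bar> + \<bar>g u - poly r u\<bar>" by simp
    also have "\<dots> \<le> \<epsilon> / 2 * exp (\<theta> * u) + \<epsilon> / 2 * exp (\<theta> * u)"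
      by (intro add_mono p r that)
    finally show ?thesis by simp
  qed
  then show "\<exists>p. \<forall>u\<ge>0. \<bar>(f u + g u) - poly p u\<bar> \<le> \<epsilon> * exp (\<theta> * u)" by blast
qed

lemma wapprox_poly: "wapprox \<theta> (poly p)"
  unfolding wapprox_def by (auto intro!: exI[of _ p])

lemma wapprox_sum: "(\<And>i. i \<in> I \<Longrightarrow> wapprox \<theta> (f i)) \<Longrightarrow> wapprox \<theta> (\<lambda>u. \<Sum>i\<in>I. f i u)"
proof (induction I rule: infinite_finite_induct)
  case (insert i I)
  then show ?case by (simp add: wapprox_add)
qed (auto simp: wapprox_def intro!: exI[of _ 0])

lemma exp_taylor_bound:
  fixes x :: real
  assumes "x \<ge> 0"
  shows "\<bar>exp (- x) - (\<Sum>i<n. (- x) ^ i / fact i)\<bar> \<le> exp x * (x ^ n / fact n)"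
proof -
  obtain t where t: "\<bar>t\<bar> \<le> \<bar>- x\<bar>" "exp (- x) = (\<Sum>i<n. (- x) ^ i / fact i) + exp t / fact n * (- x) ^ n"
    using Maclaurin_exp_le[of "- x" n] by blast
  have "\<bar>exp (- x) - (\<Sum>i<n. (- x) ^ i / fact i)\<bar> = exp t * (x ^ n / fact n)"
    using t(2) assms by (simp add: abs_mult power_abs)
  also have "\<dots> \<le> exp x * (x ^ n / fact n)"
    using t(1) assms by (intro mult_right_mono) auto
  finally show ?thesis .
qed

text \<open>The Taylor polynomials of \<open>exp (- \<theta> u / 4)\<close> converge to it in the norm weighted by
  \<open>exp (- \<theta> u)\<close>, at a geometric rate.\<close>
lemma wapprox_exp_poly:
  assumes \<theta>: "\<theta> > 0"
  shows "wapprox \<theta> (\<lambda>u. exp (- (real m * (\<theta> / 4 * u))) * poly p u)"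
proof (induction m arbitrary: p)
  case 0
  then show ?case using wapprox_poly by simp
next
  case (Suc m)
  \<comment> \<open>The budget \<theta> is split in four: one \<delta> bounds \<open>p\<close>, one
    the factor \<open>exp x\<close> of the Taylor remainder, and two bound
    \<open>(\<delta> * u) ^ n / fact n\<close> with a gain of \<open>(1 / 2) ^ n\<close>.\<close>
  define \<delta> where "\<delta> = \<theta> / 4"
  have \<delta>: "\<delta> > 0" using \<theta> by (simp add: \<delta>_def)
  obtain C where C: "\<And>u. u \<ge> 0 \<Longrightarrow> norm (poly (map_poly complex_of_real p) (of_real u)) \<le> C * exp (u * \<delta>)"
    using poly_le_exp[OF \<delta>, of "map_poly complex_of_real p"] by blast
  have C: "\<bar>poly p u\<bar> \<le> C * exp (\<delta> * u)" if "u \<ge> 0" for u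
    using C[OF that] by (simp add: mult.commute)
  have C0: "C \<ge> 0" using C[of 0] by simp
  show ?case
  proof (rule wapprox_closed)
    fix \<epsilon> :: real assume \<epsilon>: "\<epsilon> > 0"
    obtain n where n: "C * (1 / 2) ^ n < \<epsilon>"
    proof -
      have "(\<lambda>n. C * (1 / 2 :: real) ^ n) \<longlonglongrightarrow> C * 0"
        by (intro tendsto_intros LIMSEQ_realpow_zero) auto
      then have "\<forall>\<^sub>F n in sequentially. C * (1 / 2 :: real) ^ n < \<epsilon>"
        using \<epsilon> by (intro order_tendstoD) auto
      then show ?thesis using that by (auto simp: eventually_sequentially)
    qed
    define T where "T = (\<Sum>i<n. monom ((- \<delta>) ^ i / fact i) i)"
    have T: "poly T u = (\<Sum>i<n. (- (\<delta> * u)) ^ i / fact i)" for u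
      unfolding T_def poly_sum by (intro sum.cong) (auto simp: poly_monom simp flip: power_mult_distrib)
    define g where "g u = exp (- (real m * (\<theta> / 4 * u))) * poly (p * T) u" for u
    have "\<bar>exp (- (real (Suc m) * (\<theta> / 4 * u))) * poly p u - g u\<bar> \<le> \<epsilon> * exp (\<theta> * u)" if u: "u \<ge> 0" for u
    proof -
      have x: "\<delta> * u \<ge> 0" using u \<delta> by simp
      have p2: "(\<delta> * u) ^ n / fact n \<le> (1 / 2) ^ n * exp (2 * (\<delta> * u))"
      proof -
        have e: "(\<lambda>k. (2 * (\<delta> * u)) ^ k /\<^sub>R fact k) sums exp (2 * (\<delta> * u))" by (rule exp_converges)
        have "(2 * (\<delta> * u)) ^ n /\<^sub>R fact n \<le> exp (2 * (\<delta> * u))"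
          using sum_le_suminf[of "\<lambda>k. (2 * (\<delta> * u)) ^ k /\<^sub>R fact k" "{n}"] e x by (auto simp: sums_iff)
        then show ?thesis by (simp add: power_mult_distrib field_simps)
      qed
      have "exp (- (real (Suc m) * (\<theta> / 4 * u))) = exp (- (real m * (\<theta> / 4 * u))) * exp (- (\<delta> * u))"
        by (simp add: \<delta>_def algebra_simps add_divide_distrib flip: exp_add)
      then have "exp (- (real (Suc m) * (\<theta> / 4 * u))) * poly p u - g u =
        exp (- (real m * (\<theta> / 4 * u))) * (poly p u * (exp (- (\<delta> * u)) - poly T u))"
        by (simp add: g_def right_diff_distrib mult_ac)
      then have "\<bar>exp (- (real (Suc m) * (\<theta> / 4 * u))) * poly p u - g u\<bar> =
        exp (- (real m * (\<theta> / 4 * u))) * (\<bar>poly p u\<bar> * \<bar>exp (- (\<delta> * u)) - poly T u\<bar>)"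
        by (simp add: abs_mult)
      also have "\<dots> \<le> 1 * ((C * exp (\<delta> * u)) * (exp (\<delta> * u) * ((1 / 2) ^ n * exp (2 * (\<delta> * u)))))"
      proof (intro mult_mono C u)
        show "\<bar>exp (- (\<delta> * u)) - poly T u\<bar> \<le> exp (\<delta> * u) * ((1 / 2) ^ n * exp (2 * (\<delta> * u)))"
          unfolding T by (rule order.trans[OF exp_taylor_bound[OF x]]) (intro mult_left_mono p2, simp)
      qed (use u \<theta> C0 in auto)
      also have "\<dots> = (C * (1 / 2) ^ n) * exp (\<theta> * u)"
        by (simp add: \<delta>_def flip: exp_add)
      also have "\<dots> \<le> \<epsilon> * exp (\<theta> * u)"
        using n by (intro mult_right_mono) auto
      finally show ?thesis .
    qed
    then show "\<exists>g. wapprox \<theta> g \<and> (\<forall>u\<ge>0. \<bar>exp (- (real (Suc m) * (\<theta> / 4 * u))) * poly p u - g u\<bar> \<le> \<epsilon> * exp (\<theta> * u))"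
      using Suc.IH[of "p * T"] unfolding g_def by blast
  qed
qed

text \<open>Substitute \<open>y = exp (- (\<delta> * u))\<close>. Since \<open>h\<close> vanishes
  from \<open>B\<close> on, it becomes a continuous function on \<open>{0..1}\<close> that is 0 up
  to \<open>c\<close>. Weierstrass polynomials in \<open>y\<close> are combinations of the
  exponentials treated in \<open>wapprox_exp_poly\<close>.\<close>

lemma wapprox_continuous:
  assumes \<theta>: "\<theta> > 0" and h: "continuous_on {0..} h" and B: "B > 0" "\<And>u. u \<ge> B \<Longrightarrow> h u = 0"
  shows "wapprox \<theta> h"
proof (rule wapprox_closed)
  fix \<epsilon> :: real assume \<epsilon>: "\<epsilon> > 0"
  define \<delta> where "\<delta> = \<theta> / 4"
  have \<delta>: "\<delta> > 0" using \<theta> by (simp add: \<delta>_def)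
  define c where "c = exp (- (\<delta> * B))"
  have c: "0 < c" "c < 1" using \<delta> B by (auto simp: c_def)
  define k where "k y = (if y \<le> c then 0 else h (- ln y / \<delta>))" for y
  have "continuous_on {0..1} k"
    unfolding k_def
  proof (rule continuous_on_cases_le)
    have "continuous_on {y. y \<in> {0..1} \<and> c \<le> y} (\<lambda>y. - ln y / \<delta>)"
      using c \<delta> by (intro continuous_intros) auto
    moreover have "(\<lambda>y. - ln y / \<delta>) ` {y. y \<in> {0..1} \<and> c \<le> y} \<subseteq> {0..}"
      using c \<delta> by (auto intro!: divide_nonpos_pos)
    ultimately show "continuous_on {y. y \<in> {0..1} \<and> c \<le> y} (\<lambda>y. h (- ln y / \<delta>))"
      by (rule continuous_on_compose2[OF h])
    show "0 = h (- ln y / \<delta>)" if "y \<in> {0..1}" "y = c" for y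
      using that B \<delta> by (simp add: c_def)
  qed (auto intro: continuous_intros)
  then obtain g where g: "real_polynomial_function g" "\<And>y. y \<in> {0..1} \<Longrightarrow> \<bar>k y - g y\<bar> < \<epsilon>"
    using Stone_Weierstrass_real_polynomial_function[of "{0..1}" k \<epsilon>] \<epsilon> by auto
  obtain a n where an: "g = (\<lambda>x. \<Sum>i\<le>n. a i * x ^ i)"
    using g(1) unfolding real_polynomial_function_iff_sum by blast
  define G where "G u = (\<Sum>i\<le>n. exp (- (real i * (\<theta> / 4 * u))) * poly [:a i:] u)" for u
  have "wapprox \<theta> G"
    unfolding G_def[abs_def] by (intro wapprox_sum wapprox_exp_poly \<theta>)
  moreover have "\<bar>h u - G u\<bar> \<le> \<epsilon> * exp (\<theta> * u)" if u: "u \<ge> 0" for u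
  proof -
    define y where "y = exp (- (\<delta> * u))"
    have y: "y \<in> {0..1}" using u \<delta> by (auto simp: y_def)
    have "k y = h u"
    proof (cases "y \<le> c")
      case True
      then have "B \<le> u" using \<delta> by (simp add: y_def c_def)
      then show ?thesis using True B by (simp add: k_def)
    next
      case False
      then show ?thesis using \<delta> by (simp add: k_def y_def)
    qed
    moreover have "g y = G u"
      unfolding an G_def by (intro sum.cong) (auto simp: y_def \<delta>_def exp_of_nat_mult[symmetric])
    ultimately have "\<bar>h u - G u\<bar> < \<epsilon>" using g(2)[OF y] by simp
    also have "\<epsilon> \<le> \<epsilon> * exp (\<theta> * u)" using \<epsilon> \<theta> u by simp
    finally show ?thesis by simp
  qed
  ultimately show "\<exists>g. wapprox \<theta> g \<and> (\<forall>u\<ge>0. \<bar>h u - g u\<bar> \<le> \<epsilon> * exp (\<theta> * u))" by blast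
qed

section \<open>The spectrum of a Gram matrix\<close>

text \<open>A list keeps multiplicities. Only symmetric functions of it are integrated, so the
  arbitrary choice of the order does not matter.\<close>

definition spec :: "nat \<Rightarrow> nat \<Rightarrow> (nat \<times> nat \<Rightarrow> complex) \<Rightarrow> complex list" where
  "spec s t X = (SOME es. char_poly (fmat s (gram t X)) = (\<Prod>a\<leftarrow>es. [:- a, 1:]) \<and> length es = s)"

lemma spec:
  "char_poly (fmat s (gram t X)) = (\<Prod>a\<leftarrow>spec s t X. [:- a, 1:])" "length (spec s t X) = s"
  using someI_ex[OF char_poly_factorized[of "fmat s (gram t X)" s]] unfolding spec_def by auto

lemma poly_char_poly_fmat:
  fixes B :: "nat \<Rightarrow> nat \<Rightarrow> complex"
  shows "poly (char_poly (fmat s B)) w = det (fmat s (\<lambda>i j. (if i = j then 1 else 0) * w - B i j))"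
  unfolding char_poly_def
  by (rule poly_det_cong[of _ s]) (auto simp: char_poly_matrix_def)

lemma det_gram_spec:
  "det (fmat s (\<lambda>i j. (if i = j then 1 else 0) * w - gram t X i j)) = (\<Prod>e\<leftarrow>spec s t X. w - e)"
  unfolding poly_char_poly_fmat[symmetric] spec(1)
  by (induction "spec s t X") (auto simp: poly_prod_list o_def)

text \<open>A Rayleigh quotient: for an eigenvector \<open>v\<close>, \<open>e * N\<close> equals
  the squared length \<open>Y\<close> of the vector \<open>y\<close>. Cauchy-Schwarz bounds
  \<open>Y\<close> by \<open>N\<close> times the squared Frobenius norm.\<close>

lemma spec_real:
  assumes e: "e \<in> set (spec s t X)"
  shows "e = of_real (Re e)" "0 \<le> Re e" "Re e \<le> (\<Sum>c\<in>{..<s} \<times> {..<t}. (cmod (X c))\<^sup>2)"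
proof -
  let ?A = "fmat s (gram t X)"
  have "poly (char_poly ?A) e = 0"
    using e unfolding spec(1) poly_prod_list prod_list_zero_iff by force
  then have "eigenvalue ?A e" by (simp add: eigenvalue_root_char_poly[of _ s])
  then obtain v where v: "v \<in> carrier_vec s" "v \<noteq> 0\<^sub>v s" "?A *\<^sub>v v = e \<cdot>\<^sub>v v"
    unfolding eigenvalue_def eigenvector_def by auto
  have eq: "(\<Sum>j<s. gram t X i j * v $ j) = e * v $ i" if i: "i < s" for i
  proof -
    have "(?A *\<^sub>v v) $ i = (e \<cdot>\<^sub>v v) $ i" by (simp add: v(3))
    then show ?thesis using i v(1) by (simp add: scalar_prod_def atLeast0LessThan)
  qed
  define N where "N = (\<Sum>i<s. (cmod (v $ i))\<^sup>2)"
  define y where "y b = (\<Sum>i<s. cnj (v $ i) * X (i, b))" for b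
  define Y where "Y = (\<Sum>b<t. (cmod (y b))\<^sup>2)"
  obtain i where i: "i < s" "v $ i \<noteq> 0" using v(1,2) by (metis carrier_vecD eq_vecI index_zero_vec)
  have "0 < (cmod (v $ i))\<^sup>2" using i by simp
  also have "\<dots> \<le> N" unfolding N_def using i by (intro member_le_sum) auto
  finally have N: "N > 0" .
  have "e * of_real N = (\<Sum>i<s. cnj (v $ i) * (e * v $ i))"
    by (simp add: N_def sum_distrib_left complex_norm_square mult_ac del: of_real_power)
  also have "\<dots> = (\<Sum>i<s. cnj (v $ i) * (\<Sum>j<s. gram t X i j * v $ j))"
    by (intro sum.cong) (auto simp: eq)
  also have "\<dots> = (\<Sum>i<s. \<Sum>j<s. \<Sum>b<t. (cnj (v $ i) * X (i, b)) * (cnj (X (j, b)) * v $ j))"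
    by (simp add: gram_def sum_distrib_left sum_distrib_right mult_ac)
  also have "\<dots> = (\<Sum>i<s. \<Sum>b<t. \<Sum>j<s. (cnj (v $ i) * X (i, b)) * (cnj (X (j, b)) * v $ j))"
    by (intro sum.cong refl sum.swap)
  also have "\<dots> = (\<Sum>b<t. \<Sum>i<s. \<Sum>j<s. (cnj (v $ i) * X (i, b)) * (cnj (X (j, b)) * v $ j))"
    by (rule sum.swap)
  also have "\<dots> = (\<Sum>b<t. y b * cnj (y b))"
    by (simp add: y_def sum_product mult.commute[of "cnj (X _)"])
  also have "\<dots> = of_real Y"
    by (simp add: Y_def complex_norm_square del: of_real_power)
  finally have eN: "e = of_real (Y / N)" using N by (simp add: field_simps)
  then have "Re e = Y / N" by simp
  moreover have "0 \<le> Y" by (simp add: Y_def sum_nonneg)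
  moreover have "Y \<le> N * (\<Sum>c\<in>{..<s} \<times> {..<t}. (cmod (X c))\<^sup>2)"
  proof -
    have "(cmod (y b))\<^sup>2 \<le> N * (\<Sum>i<s. (cmod (X (i, b)))\<^sup>2)" for b
    proof -
      have "cmod (y b) \<le> (\<Sum>i<s. cmod (v $ i) * cmod (X (i, b)))"
        unfolding y_def by (intro sum_norm_le) (simp add: norm_mult)
      then have "(cmod (y b))\<^sup>2 \<le> (\<Sum>i<s. cmod (v $ i) * cmod (X (i, b)))\<^sup>2"
        by (intro power_mono) auto
      also have "\<dots> \<le> N * (\<Sum>i<s. (cmod (X (i, b)))\<^sup>2)"
        unfolding N_def by (rule Cauchy_Schwarz_ineq_sum)
      finally show ?thesis .
    qed
    then have "Y \<le> (\<Sum>b<t. N * (\<Sum>i<s. (cmod (X (i, b)))\<^sup>2))"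
      unfolding Y_def by (intro sum_mono)
    also have "\<dots> = N * (\<Sum>i<s. \<Sum>b<t. (cmod (X (i, b)))\<^sup>2)"
      unfolding sum_distrib_left[symmetric] by (subst sum.swap) simp
    finally show ?thesis by (simp add: sum.cartesian_product)
  qed
  ultimately show "e = of_real (Re e)" "0 \<le> Re e" "Re e \<le> (\<Sum>c\<in>{..<s} \<times> {..<t}. (cmod (X c))\<^sup>2)"
    using N eN by (auto simp: divide_le_eq mult.commute)
qed

definition specprod :: "nat \<Rightarrow> nat \<Rightarrow> (real \<Rightarrow> complex) \<Rightarrow> (nat \<times> nat \<Rightarrow> complex) \<Rightarrow> complex" where
  "specprod s t \<phi> X = (\<Prod>e\<leftarrow>spec s t X. \<phi> (Re e))"

lemma specprod_poly:
  "specprod s t (\<lambda>u. \<Prod>a\<in>R. z a - of_real u) X =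
    (\<Prod>a\<in>R. det (fmat s (\<lambda>i j. (if i = j then 1 else 0) * z a - gram t X i j)))"
proof -
  have "(\<Prod>e\<leftarrow>es. \<Prod>a\<in>R. z a - complex_of_real (Re e)) = (\<Prod>a\<in>R. \<Prod>e\<leftarrow>es. z a - e)"
    if "\<And>e. e \<in> set es \<Longrightarrow> e = of_real (Re e)" for es
    using that by (induction es) (auto simp: prod.distrib)
  from this[OF spec_real(1)] show ?thesis
    unfolding specprod_def det_gram_spec by auto
qed

text \<open>Each of the \<open>s\<close> eigenvalues is at most the squared Frobenius norm
  \<open>F\<close>, so rate \<open>1 / (8 * s)\<close> per factor multiplies up to
  \<open>exp (F / 8)\<close>, within the integrable \<open>exp (F / 4)\<close>.\<close>

lemma norm_specprod_le:
  assumes "\<And>u. 0 \<le> u \<Longrightarrow> norm (\<phi> u) \<le> C * exp (u / (8 * real s))" "0 < s" "C \<ge> 0"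
  shows "norm (specprod s t \<phi> X) \<le> C ^ s * (\<Prod>c\<in>{..<s} \<times> {..<t}. exp ((cmod (X c))\<^sup>2 / 4))"
proof -
  define F where "F = (\<Sum>c\<in>{..<s} \<times> {..<t}. (cmod (X c))\<^sup>2)"
  have F: "F \<ge> 0" by (simp add: F_def sum_nonneg)
  have "norm (\<Prod>e\<leftarrow>es. \<phi> (Re e)) \<le> (C * exp (F / (8 * real s))) ^ length es"
    if "\<And>e. e \<in> set es \<Longrightarrow> 0 \<le> Re e \<and> Re e \<le> F" for es
    using that
  proof (induction es)
    case (Cons e es)
    have "norm (\<phi> (Re e)) \<le> C * exp (Re e / (8 * real s))" using Cons.prems assms(1) by auto
    also have "\<dots> \<le> C * exp (F / (8 * real s))"
      using Cons.prems assms by (intro mult_left_mono) (auto intro!: divide_right_mono)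
    finally have "norm (\<phi> (Re e)) \<le> C * exp (F / (8 * real s))" .
    then show ?case using Cons assms(3) by (auto simp: norm_mult intro!: mult_mono)
  qed simp
  then have "norm (specprod s t \<phi> X) \<le> (C * exp (F / (8 * real s))) ^ s"
    using spec_real(2,3)[of _ s t X] spec(2)[of s t X] unfolding specprod_def F_def by metis
  also have "\<dots> = C ^ s * exp (F / 8)"
    using assms(2) by (simp add: power_mult_distrib exp_of_nat_mult[symmetric])
  also have "\<dots> \<le> C ^ s * exp (F / 4)" using F assms(3) by (intro mult_left_mono) auto
  also have "exp (F / 4) = (\<Prod>c\<in>{..<s} \<times> {..<t}. exp ((cmod (X c))\<^sup>2 / 4))"
    unfolding F_def by (simp add: exp_sum sum_divide_distrib)
  finally show ?thesis .
qed

lemma specprod_tendsto: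
  assumes "\<And>u. 0 \<le> u \<Longrightarrow> (\<lambda>n. \<phi>n n u) \<longlonglongrightarrow> \<phi> u"
  shows "(\<lambda>n. specprod s t (\<phi>n n) X) \<longlonglongrightarrow> specprod s t \<phi> X"
proof -
  have "(\<lambda>n. \<Prod>e\<leftarrow>es. \<phi>n n (Re e)) \<longlonglongrightarrow> (\<Prod>e\<leftarrow>es. \<phi> (Re e))" if "\<And>e. e \<in> set es \<Longrightarrow> 0 \<le> Re e" for es
    using that by (induction es) (auto intro!: tendsto_intros assms)
  then show ?thesis unfolding specprod_def using spec_real(2) by blast
qed

lemma specprod_cmult: "specprod s t (\<lambda>u. c * \<phi> u) X = c ^ s * specprod s t \<phi> X"
proof -
  have "(\<Prod>e\<leftarrow>es. c * \<phi> (Re e)) = c ^ length es * (\<Prod>e\<leftarrow>es. \<phi> (Re e))" for es :: "complex list"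
    by (induction es) (auto simp: mult_ac)
  then show ?thesis unfolding specprod_def by (simp add: spec(2))
qed

section \<open>From polynomial test functions to the indicator of a half-line\<close>

text \<open>Indices start at 0 and the zero eigenvalues come last. The matrix of means enters only
  through the characteristic polynomial of its Gram matrix.\<close>

locale wishart =
  fixes s q L :: nat and m :: "nat \<times> nat \<Rightarrow> complex" and l :: "nat \<Rightarrow> real"
  assumes s_pos: "0 < s" and L_le: "L \<le> s"
    and l_pos: "\<And>k. k < L \<Longrightarrow> 0 < l k" and l_zero: "\<And>k. L \<le> k \<Longrightarrow> k < s \<Longrightarrow> l k = 0"
    and l_inj: "inj_on l {..<L}"
    and l_det: "\<And>w. det (fmat s (\<lambda>i j. (if i = j then 1 else 0) * w - gram (s + q) m i j)) = (\<Prod>k<s. w - of_real (l k))"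
begin

text \<open>The confluent columns are counted from the right, as in \<open>Dconf\<close>: the last
  column has exponent 0.\<close>

definition W :: "nat \<Rightarrow> real \<Rightarrow> real" where
  "W k u = (if k < L then gser q (l k * u) else u ^ (s - 1 - k))"

abbreviation "cm k \<equiv> colm q (W k)"

abbreviation "G \<equiv> PiM ({..<s} \<times> {..<s + q}) (\<lambda>c. cgauss (m c))"

definition Nmat :: "(real \<Rightarrow> complex) \<Rightarrow> complex" where
  "Nmat \<phi> = det (fmat s (\<lambda>i k. \<integral>u. of_real (u ^ i) * \<phi> u \<partial>cm k))"

text \<open>The identity to be proved, for one test function. Measurability is bundled with it
  because the spectrum is chosen by \<open>SOME\<close>: it is clear for polynomials and is then
  carried along by limits.\<close>

definition Good :: "(real \<Rightarrow> complex) \<Rightarrow> bool" where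
  "Good \<phi> \<longleftrightarrow> \<phi> \<in> borel_measurable borel \<and> specprod s (s + q) \<phi> \<in> borel_measurable G \<and>
     (\<integral>X. specprod s (s + q) \<phi> X \<partial>G) * Nmat (\<lambda>_. 1) = Nmat \<phi>"

lemma column_W: "\<exists>K. column (W k) K"
proof (cases "k < L")
  case True
  then have "column (\<lambda>u. gser q (l k * u)) (exp (4 * l k))" using l_pos[of k] by (intro column_gser) auto
  then show ?thesis using True by (auto simp: W_def[abs_def])
next
  case False
  then show ?thesis using column_power[of "s - 1 - k"] by (simp add: W_def[abs_def])
qed

lemma integral_cm_poly:
  "(\<integral>u. poly p (complex_of_real u) \<partial>cm k) = (if k < L then Emom q (l k) p else Umom q (s - 1 - k) p)"
proof -
  obtain K where "column (W k) K" using column_W by blast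
  then interpret column q "W k" K .
  show ?thesis
  proof (cases "k < L")
    case True
    have "(\<integral>u. u ^ n \<partial>cm k) = mom_series q n (l k)" for n
      using integral_colm_gser[of "l k"] l_pos[OF True] True by (simp add: W_def[abs_def])
    from integral_poly[OF this] show ?thesis using True by (simp add: Emom_def)
  next
    case False
    have "(\<integral>u. u ^ n \<partial>cm k) = fact (n + q + (s - 1 - k))" for n
      using integral_colm_power False by (simp add: W_def[abs_def])
    from integral_poly[OF this] show ?thesis using False by (simp add: Umom_def)
  qed
qed

lemma Nmat_poly: "Nmat (\<lambda>u. poly p (of_real u)) = Dconf q s (\<lambda>i. monom 1 i * p) (s - L) l"
proof -
  have "(\<integral>u. of_real (u ^ i) * poly p (of_real u) \<partial>cm k) =
     (if k < s - (s - L) then Emom q (l k) (monom 1 i * p) else Umom q (s - 1 - k) (monom 1 i * p))" for i k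
    using integral_cm_poly[of k "monom 1 i * p"] L_le by (simp add: poly_monom)
  then show ?thesis unfolding Nmat_def Dconf_def by simp
qed

lemma Nmat_one: "Nmat (\<lambda>_. 1) = Dconf q s (\<lambda>i. monom 1 i) (s - L) l"
  using Nmat_poly[of 1] by simp

lemma Nmat_one_nonzero: "Nmat (\<lambda>_. 1) \<noteq> 0"
proof -
  obtain c where c: "c \<noteq> 0" "Dconf q s (\<lambda>i. monom 1 i) (s - L) l =
    c * (\<Prod>k<s - (s - L). of_real (exp (l k) * l k ^ (s - L))) * vdiff {..<s - (s - L)} (\<lambda>k. of_real (l k))"
    using Dconf_product[of "s - L" s q] by auto
  have "vdiff {..<L} (\<lambda>k. complex_of_real (l k)) \<noteq> 0"
  proof -
    have "complex_of_real (l i) - of_real (l j) \<noteq> 0" if "i < L" "j < i" for i j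
      using inj_onD[OF l_inj, of i j] that by auto
    then show ?thesis unfolding vdiff_lessThan by simp
  qed
  moreover have "(\<Prod>k<L. complex_of_real (exp (l k) * l k ^ (s - L))) \<noteq> 0"
    using l_pos by (auto simp: less_imp_neq[symmetric])
  ultimately show ?thesis using c L_le by (simp add: Nmat_one)
qed

lemma component_measurable:
  "c \<in> {..<s} \<times> {..<s + q} \<Longrightarrow> (\<lambda>X. X c) \<in> borel_measurable G"
  using measurable_component_singleton[of c "{..<s} \<times> {..<s + q}" "\<lambda>c. cgauss (m c)"]
  by (simp cong: measurable_cong_sets)

text \<open>\<open>gauss_side\<close> and \<open>Dconf_identity\<close> combine to the claim
  multiplied by \<open>vdiff R z\<close>; distinct \<open>z a\<close> allow this factor to be
  cancelled.\<close>

lemma Good_prod_distinct: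
  assumes R: "finite R" "\<And>a. a \<in> R \<Longrightarrow> s \<le> a" and z: "inj_on z R"
  shows "Good (\<lambda>u. \<Prod>a\<in>R. z a - of_real u)"
proof -
  have V: "vdiff R z \<noteq> 0"
  proof -
    have "finite {(a, b). a \<in> R \<and> b \<in> R \<and> b < a}"
      by (rule finite_subset[of _ "R \<times> R"]) (use R in auto)
    then show ?thesis unfolding vdiff_def using z by (auto simp: inj_on_def)
  qed
  have S: "specprod s (s + q) (\<lambda>u. \<Prod>a\<in>R. z a - of_real u) =
     (\<lambda>X. \<Prod>a\<in>R. det (fmat s (\<lambda>i j. (if i = j then 1 else 0) * z a - gram (s + q) X i j)))"
    by (rule ext) (rule specprod_poly)
  have "vdiff R z * ((\<integral>X. specprod s (s + q) (\<lambda>u. \<Prod>a\<in>R. z a - of_real u) X \<partial>G) * Nmat (\<lambda>_. 1)) =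
     Cexp q R s z (\<lambda>k. of_real (l k)) * Nmat (\<lambda>_. 1)"
    using gauss_side[OF R l_det, of z] by (simp add: S mult.assoc)
  also have "\<dots> = vdiff R z * Nmat (\<lambda>u. poly (\<Prod>a\<in>R. [:z a, -1:]) (of_real u))"
    unfolding Nmat_one Nmat_poly using L_le l_zero by (intro Dconf_identity R) auto
  finally have "(\<integral>X. specprod s (s + q) (\<lambda>u. \<Prod>a\<in>R. z a - of_real u) X \<partial>G) * Nmat (\<lambda>_. 1) =
     Nmat (\<lambda>u. \<Prod>a\<in>R. z a - of_real u)"
    using V by (simp add: poly_prod)
  moreover have "specprod s (s + q) (\<lambda>u. \<Prod>a\<in>R. z a - of_real u) \<in> borel_measurable G"
  proof -
    have E: "(\<lambda>X. (if i = p i then 1 else 0) * z a - gram (s + q) X i (p i)) \<in> borel_measurable G"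
      if "p permutes {..<s}" "i < s" for p i a
      unfolding gram_def using that permutes_in_image[OF that(1), of i]
      by (intro borel_measurable_diff borel_measurable_const borel_measurable_sum borel_measurable_times
          borel_measurable_cnj component_measurable) auto
    have D: "(\<lambda>X. signof p * (\<Prod>i<s. (if i = p i then 1 else 0) * z a - gram (s + q) X i (p i))) \<in> borel_measurable G"
      if "p permutes {..<s}" for p a
      by (intro borel_measurable_times borel_measurable_const borel_measurable_prod E[OF that]) simp
    have "(\<lambda>X. det (fmat s (\<lambda>i j. (if i = j then 1 else 0) * z a - gram (s + q) X i j))) \<in> borel_measurable G" for a
      unfolding det_fmat by (intro borel_measurable_sum D) simp
    then show ?thesis unfolding S by (intro borel_measurable_prod)
  qed
  ultimately show ?thesis unfolding Good_def by auto
qed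

text \<open>One growth rate serves both sides. For the matrix it is the rate of
  \<open>norm_specprod_le\<close>; for a column, \<open>u ^ i\<close> costs a further 1/8, and the
  total is at most 1/4.\<close>

lemma Good_limit:
  assumes G: "\<And>n. Good (\<phi>n n)" and \<phi>: "\<phi> \<in> borel_measurable borel"
    and lim: "\<And>u. 0 \<le> u \<Longrightarrow> (\<lambda>n. \<phi>n n u) \<longlonglongrightarrow> \<phi> u"
    and b: "\<And>n u. 0 \<le> u \<Longrightarrow> norm (\<phi>n n u) \<le> C * exp (u / (8 * real s))"
  shows "Good \<phi>"
proof -
  interpret product_sigma_finite "\<lambda>c. cgauss (m c)" by (rule product_sigma_finite_cgauss)
  have C: "0 \<le> C" using order.trans[OF norm_ge_zero b[of 0 0]] by simp
  have m: "(\<lambda>u. \<phi>n n u) \<in> borel_measurable borel" "specprod s (s + q) (\<phi>n n) \<in> borel_measurable G" for n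
    using G[of n] by (auto simp: Good_def)
  have sl: "(\<lambda>n. specprod s (s + q) (\<phi>n n) X) \<longlonglongrightarrow> specprod s (s + q) \<phi> X" for X
    by (rule specprod_tendsto[OF lim])
  have m2: "specprod s (s + q) \<phi> \<in> borel_measurable G"
    by (rule borel_measurable_LIMSEQ_metric[OF m(2) sl])
  have "(\<lambda>n. \<integral>X. specprod s (s + q) (\<phi>n n) X \<partial>G) \<longlonglongrightarrow> (\<integral>X. specprod s (s + q) \<phi> X \<partial>G)"
  proof (rule integral_dominated_convergence)
    show "integrable G (\<lambda>X. C ^ s * (\<Prod>c\<in>{..<s} \<times> {..<s + q}. exp ((cmod (X c))\<^sup>2 / 4)))"
      by (intro integrable_mult_right product_integrable_prod integrable_cgauss_exp) auto
    show "AE X in G. norm (specprod s (s + q) (\<phi>n n) X) \<le> C ^ s * (\<Prod>c\<in>{..<s} \<times> {..<s + q}. exp ((cmod (X c))\<^sup>2 / 4))" for n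
      using norm_specprod_le[OF b s_pos C] by auto
  qed (use m m2 sl in auto)
  moreover have "(\<lambda>n. Nmat (\<phi>n n)) \<longlonglongrightarrow> Nmat \<phi>"
  proof -
    have "(\<lambda>n. \<integral>u. of_real (u ^ i) * \<phi>n n u \<partial>cm k) \<longlonglongrightarrow> (\<integral>u. of_real (u ^ i) * \<phi> u \<partial>cm k)" for i k
    proof -
      obtain K where "column (W k) K" using column_W by blast
      then interpret column q "W k" K .
      obtain D where D: "\<And>u::real. 0 \<le> u \<Longrightarrow> u ^ i \<le> D * exp (u * (1 / 8))"
        using power_le_exp[of "1/8" i] by auto
      have D0: "0 \<le> D" using D[of 0] by (simp add: power_0_left split: if_splits)
      have bb: "norm (of_real (u ^ i) * \<phi>n n u) \<le> D * C * exp (u / 4)" if u: "0 \<le> u" for u n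
      proof -
        have "norm (of_real (u ^ i) * \<phi>n n u) = u ^ i * norm (\<phi>n n u)"
          using u by (simp add: norm_mult norm_power)
        also have "\<dots> \<le> (D * exp (u * (1 / 8))) * (C * exp (u / (8 * real s)))"
          using u D0 by (intro mult_mono D b) auto
        also have "\<dots> = D * C * exp (u / 8 + u / (8 * real s))" by (simp add: exp_add)
        also have "\<dots> \<le> D * C * exp (u / 4)"
        proof -
          have "u / (8 * real s) \<le> u / (8 * 1)" using u s_pos by (intro divide_left_mono) auto
          then show ?thesis using C D0 by (intro mult_left_mono) auto
        qed
        finally show ?thesis .
      qed
      show ?thesis
      proof (rule integral_dominated_convergence)
        show "integrable (cm k) (\<lambda>u. D * C * exp (u / 4))" using integrable_exp by simp
        show "AE u in cm k. (\<lambda>n. of_real (u ^ i) * \<phi>n n u) \<longlonglongrightarrow> of_real (u ^ i) * \<phi> u"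
          using AE_colm_nonneg[OF w_measurable] by eventually_elim (intro tendsto_intros lim)
        show "AE u in cm k. norm (of_real (u ^ i) * \<phi>n n u) \<le> D * C * exp (u / 4)" for n
          using AE_colm_nonneg[OF w_measurable] by eventually_elim (rule bb)
      qed (use m(1) \<phi> in auto)
    qed
    then show ?thesis unfolding Nmat_def det_fmat by (intro tendsto_intros)
  qed
  ultimately have "(\<integral>X. specprod s (s + q) \<phi> X \<partial>G) * Nmat (\<lambda>_. 1) = Nmat \<phi>"
    using G by (intro LIMSEQ_unique[of "\<lambda>n. (\<integral>X. specprod s (s + q) (\<phi>n n) X \<partial>G) * Nmat (\<lambda>_. 1)"] tendsto_intros)
      (auto simp: Good_def)
  then show ?thesis using \<phi> m2 by (simp add: Good_def)
qed

text \<open>Both sides gain \<open>c ^ s\<close>: one factor per eigenvalue on the left, one per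
  column of the determinant on the right.\<close>

lemma Good_cmult: "Good \<phi> \<Longrightarrow> Good (\<lambda>u. c * \<phi> u)"
proof -
  assume G: "Good \<phi>"
  have "specprod s (s + q) (\<lambda>u. c * \<phi> u) = (\<lambda>X. c ^ s * specprod s (s + q) \<phi> X)"
    by (rule ext) (rule specprod_cmult)
  moreover have "Nmat (\<lambda>u. c * \<phi> u) = c ^ s * Nmat \<phi>"
  proof -
    have "Nmat (\<lambda>u. c * \<phi> u) = det (fmat s (\<lambda>i k. (\<integral>u. of_real (u ^ i) * \<phi> u \<partial>cm k) * c))"
      unfolding Nmat_def by (simp add: mult_ac flip: integral_mult_right_zero)
    then show ?thesis unfolding det_scale_columns Nmat_def by simp
  qed
  ultimately show ?thesis using G by (auto simp: Good_def)
qed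

text \<open>Coinciding roots are separated by adding \<open>a / (n + 1)\<close> to
  \<open>z a\<close>. For each pair a coincidence forces \<open>1 / (n + 1)\<close> to equal one
  fixed number \<open>r\<close>, which is eventually excluded; \<open>R\<close> is finite.\<close>

lemma Good_prod:
  assumes R: "finite R" "\<And>a. a \<in> R \<Longrightarrow> s \<le> a"
  shows "Good (\<lambda>u. \<Prod>a\<in>R. z a - of_real u)"
proof -
  define zn where "zn n a = z a + of_real (real a * inverse (real (Suc n)))" for n a
  have "\<forall>\<^sub>F n in sequentially. zn n a \<noteq> zn n b" if ab: "a \<noteq> b" for a b
  proof -
    define r where "r = (z b - z a) / of_real (real a - real b)"
    have "zn n a \<noteq> zn n b" if "complex_of_real (inverse (real (Suc n))) \<noteq> r" for n
    proof
      assume "zn n a = zn n b"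
      then have "of_real (real a - real b) * complex_of_real (inverse (real (Suc n))) = z b - z a"
        by (simp add: zn_def algebra_simps)
      then show False using that ab by (simp add: r_def field_simps)
    qed
    moreover have "\<forall>\<^sub>F n in sequentially. complex_of_real (inverse (real (Suc n))) \<noteq> r"
    proof (cases "r = 0")
      case False
      have "(\<lambda>n. complex_of_real (inverse (real (Suc n)))) \<longlonglongrightarrow> of_real 0"
        by (intro tendsto_of_real LIMSEQ_inverse_real_of_nat)
      then show ?thesis using False by (intro tendsto_imp_eventually_ne) auto
    next
      case True
      then show ?thesis by (intro always_eventually allI) (simp del: of_nat_Suc)
    qed
    ultimately show ?thesis by (auto elim: eventually_mono)
  qed
  then have "\<forall>\<^sub>F n in sequentially. \<forall>p\<in>{p\<in>R \<times> R. fst p \<noteq> snd p}. zn n (fst p) \<noteq> zn n (snd p)"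
    using R by (intro eventually_ball_finite) auto
  then obtain N where N: "\<And>n. n \<ge> N \<Longrightarrow> inj_on (zn n) R"
    unfolding eventually_sequentially inj_on_def by fastforce
  \<comment> \<open>A majorant for all \<open>n\<close> at once: the perturbation of
    \<open>z a\<close> has modulus at most \<open>a\<close>.\<close>
  define p where "p = (\<Prod>a\<in>R. [:complex_of_real (norm (z a) + real a), 1:])"
  obtain C where C: "\<And>u. 0 \<le> u \<Longrightarrow> norm (poly p (of_real u)) \<le> C * exp (u * (1 / (8 * real s)))"
    using poly_le_exp[of "1 / (8 * real s)" p] s_pos by auto
  show ?thesis
  proof (rule Good_limit)
    show "Good (\<lambda>u. \<Prod>a\<in>R. zn (n + N) a - of_real u)" for n
      by (rule Good_prod_distinct[OF R N]) auto
    have "(\<lambda>n. zn (n + N) a) \<longlonglongrightarrow> z a + of_real (real a * 0)" for a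
      unfolding zn_def
      by (intro tendsto_intros tendsto_of_real LIMSEQ_ignore_initial_segment[OF LIMSEQ_inverse_real_of_nat])
    then show "(\<lambda>n. \<Prod>a\<in>R. zn (n + N) a - of_real u) \<longlonglongrightarrow> (\<Prod>a\<in>R. z a - of_real u)" for u
      by (intro tendsto_prod tendsto_diff tendsto_const) simp
    show "norm (\<Prod>a\<in>R. zn (n + N) a - of_real u) \<le> C * exp (u / (8 * real s))" if u: "0 \<le> u" for n u
    proof -
      have "norm (\<Prod>a\<in>R. zn (n + N) a - of_real u) \<le> (\<Prod>a\<in>R. norm (z a) + real a + u)"
        unfolding prod_norm[symmetric]
      proof (intro prod_mono conjI norm_ge_zero)
        fix a
        have "inverse (real (Suc (n + N))) \<le> 1" by (simp add: inverse_eq_divide)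
        then have "real a * inverse (real (Suc (n + N))) \<le> real a * 1" by (intro mult_left_mono) auto
        moreover have "norm (zn (n + N) a - of_real u) \<le> norm (z a) + norm (complex_of_real (real a * inverse (real (Suc (n + N))))) + norm (complex_of_real u)"
          unfolding zn_def by (intro norm_triangle_le_diff add_mono norm_triangle_ineq order_refl)
        ultimately show "norm (zn (n + N) a - of_real u) \<le> norm (z a) + real a + u"
          using u by (simp only: norm_of_real) simp
      qed
      also have "\<dots> = norm (poly p (of_real u))"
      proof -
        have "poly p (of_real u) = of_real (\<Prod>a\<in>R. norm (z a) + real a + u)"
          by (simp add: p_def poly_prod)
        then show ?thesis using u by (simp only: norm_of_real) (simp add: prod_nonneg)
      qed
      finally show ?thesis using C[OF u] by simp
    qed
  qed auto
qed

lemma Good_poly: "Good (\<lambda>u. poly p (of_real u))"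
proof -
  obtain as where as: "p = Polynomial.smult (lead_coeff p) (\<Prod>a\<leftarrow>as. [:- a, 1:])"
    using fundamental_theorem_algebra_factorized[of p] by metis
  \<comment> \<open>One label per root with multiplicity, starting at \<open>s\<close> to keep clear
    of the rows of the matrix.\<close>
  define R where "R = {s..<s + length as}"
  define z where "z a = as ! (a - s)" for a
  have "poly p x = (lead_coeff p * (-1) ^ length as) * (\<Prod>a\<in>R. z a - x)" for x
  proof -
    have "(\<Prod>a\<in>R. z a - x) = (\<Prod>i<length as. as ! i - x)"
      unfolding R_def z_def by (rule prod.reindex_bij_witness[of _ "\<lambda>i. i + s" "\<lambda>a. a - s"]) auto
    moreover have "(\<Prod>a\<leftarrow>as. x - a) = (\<Prod>i<length as. x - as ! i)"
      by (simp add: prod.list_conv_set_nth atLeast0LessThan)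
    moreover have "(\<Prod>i<length as. x - as ! i) = (-1) ^ length as * (\<Prod>i<length as. as ! i - x)"
      using prod_uminus[of "\<lambda>i. as ! i - x" "{..<length as}"] by simp
    moreover have "poly p x = lead_coeff p * (\<Prod>a\<leftarrow>as. x - a)"
      by (subst as) (simp add: poly_prod_list o_def)
    ultimately show ?thesis by simp
  qed
  moreover have "Good (\<lambda>u. (lead_coeff p * (-1) ^ length as) * (\<Prod>a\<in>R. z a - of_real u))"
    by (intro Good_cmult Good_prod) (auto simp: R_def)
  ultimately show ?thesis by simp
qed

lemma Good_continuous:
  assumes h: "continuous_on UNIV h" and B: "\<And>u. u \<ge> B \<Longrightarrow> h u = 0" and b: "\<And>u. \<bar>h u\<bar> \<le> 1"
  shows "Good (\<lambda>u. of_real (h u))"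
proof -
  define \<theta> where "\<theta> = 1 / (8 * real s)"
  have \<theta>: "\<theta> > 0" using s_pos by (simp add: \<theta>_def)
  have "wapprox \<theta> h"
    using B by (intro wapprox_continuous[of _ _ "max B 1"] \<theta> continuous_on_subset[OF h]) auto
  then have "\<forall>n. \<exists>p. \<forall>u\<ge>0. \<bar>h u - poly p u\<bar> \<le> inverse (real (Suc n)) * exp (\<theta> * u)"
    unfolding wapprox_def by simp
  then obtain p where p: "\<And>n u. u \<ge> 0 \<Longrightarrow> \<bar>h u - poly (p n) u\<bar> \<le> inverse (real (Suc n)) * exp (\<theta> * u)"
    by metis
  show ?thesis
  proof (rule Good_limit)
    show "Good (\<lambda>u. of_real (poly (p n) u))" for n
      using Good_poly[of "map_poly of_real (p n)"] by simp
    show "(\<lambda>u. complex_of_real (h u)) \<in> borel_measurable borel"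
      using borel_measurable_continuous_onI[OF h] by simp
    show "(\<lambda>n. complex_of_real (poly (p n) u)) \<longlonglongrightarrow> of_real (h u)" if u: "0 \<le> u" for u
    proof -
      have "(\<lambda>n. inverse (real (Suc n)) * exp (\<theta> * u)) \<longlonglongrightarrow> 0 * exp (\<theta> * u)"
        by (intro tendsto_intros LIMSEQ_inverse_real_of_nat)
      then have z: "(\<lambda>n. inverse (real (Suc n)) * exp (\<theta> * u)) \<longlonglongrightarrow> 0" by simp
      have "(\<lambda>n. poly (p n) u - h u) \<longlonglongrightarrow> 0"
      proof (rule Lim_null_comparison[rotated])
        show "\<forall>\<^sub>F n in sequentially. norm (poly (p n) u - h u) \<le> inverse (real (Suc n)) * exp (\<theta> * u)"
          unfolding real_norm_def by (intro always_eventually allI) (subst abs_minus_commute, rule p[OF u])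
      qed (rule z)
      then show ?thesis by (intro tendsto_of_real) (simp add: LIM_zero_cancel)
    qed
    show "norm (complex_of_real (poly (p n) u)) \<le> 2 * exp (u / (8 * real s))" if u: "0 \<le> u" for n u
    proof -
      have "\<bar>poly (p n) u\<bar> \<le> \<bar>h u\<bar> + \<bar>h u - poly (p n) u\<bar>" by simp
      also have "\<dots> \<le> 1 + 1 * exp (\<theta> * u)"
        by (intro add_mono b order.trans[OF p[OF u]] mult_right_mono) (auto simp: inverse_eq_divide)
      also have "\<dots> \<le> exp (\<theta> * u) + 1 * exp (\<theta> * u)" using \<theta> u by simp
      finally show ?thesis by (simp add: \<theta>_def)
    qed
  qed
qed

lemma Good_indicator: "Good (\<lambda>u. of_real (indicator {..x} u))"
proof (rule Good_limit)
  \<comment> \<open>A ramp from 1 at \<open>x\<close> down to 0 at \<open>x + 1 / n\<close>, equal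
    to 1 at \<open>x\<close> itself, so that the limit is the closed half-line. Below it is used at
    \<open>Suc n\<close>, since for \<open>n = 0\<close> it would be constantly 1.\<close>
  define h where "h n u = max 0 (min 1 (1 - real n * (u - x)))" for n u
  have "continuous_on UNIV (h (Suc n))" for n
    unfolding h_def by (intro continuous_intros)
  then show "Good (\<lambda>u. of_real (h (Suc n) u))" for n
  proof (rule Good_continuous)
    show "h (Suc n) u = 0" if "u \<ge> x + 1" for u
    proof -
      have "1 * 1 \<le> real (Suc n) * (u - x)" using that by (intro mult_mono) auto
      then show ?thesis by (simp add: h_def)
    qed
  qed (auto simp: h_def)
  show "(\<lambda>n. complex_of_real (h (Suc n) u)) \<longlonglongrightarrow> of_real (indicator {..x} u)" for u
  proof (cases "u \<le> x")
    case True
    then have "real n * (u - x) \<le> 0" for n by (intro mult_nonneg_nonpos) auto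
    then have "h n u = 1" for n using True by (simp add: h_def max_def min_def)
    then show ?thesis using True by simp
  next
    case False
    then obtain N :: nat where N: "1 \<le> real N * (u - x)"
      using reals_Archimedean3[of "u - x"] by (metis diff_gt_0_iff_gt less_eq_real_def not_le)
    have "h (Suc n) u = 0" if "n \<ge> N" for n
    proof -
      have "real N * (u - x) \<le> real (Suc n) * (u - x)" using that False by (intro mult_right_mono) auto
      then show ?thesis using N by (simp add: h_def)
    qed
    then have "\<forall>\<^sub>F n in sequentially. complex_of_real (h (Suc n) u) = 0"
      by (auto simp: eventually_sequentially)
    then show ?thesis using False by (simp add: tendsto_eventually)
  qed
  show "norm (complex_of_real (h (Suc n) u)) \<le> 1 * exp (u / (8 * real s))" if "0 \<le> u" for n u
  proof -
    have "\<bar>h (Suc n) u\<bar> \<le> 1" by (auto simp: h_def)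
    also have "1 \<le> exp (u / (8 * real s))" using that by simp
    finally show ?thesis by simp
  qed
qed simp

theorem prob_spec_le:
  "complex_of_real (measure G {X \<in> space G. \<forall>e\<in>set (spec s (s + q) X). Re e \<le> x}) * Nmat (\<lambda>_. 1) =
    Nmat (\<lambda>u. of_real (indicator {..x} u))"
proof -
  let ?f = "specprod s (s + q) (\<lambda>u. of_real (indicator {..x} u))"
  let ?S = "{X \<in> space G. \<forall>e\<in>set (spec s (s + q) X). Re e \<le> x}"
  interpret prob_space G by (rule prob_space_PiM[OF prob_space_cgauss])
  have f: "?f X = (if \<forall>e\<in>set (spec s (s + q) X). Re e \<le> x then 1 else 0)" for X
  proof -
    have "(\<Prod>e\<leftarrow>es. complex_of_real (indicator {..x} (Re e))) = (if \<forall>e\<in>set es. Re e \<le> x then 1 else 0)" for es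
      by (induction es) auto
    then show ?thesis by (simp add: specprod_def)
  qed
  have G: "?f \<in> borel_measurable G" "(\<integral>X. ?f X \<partial>G) * Nmat (\<lambda>_. 1) = Nmat (\<lambda>u. of_real (indicator {..x} u))"
    using Good_indicator[of x] by (auto simp: Good_def)
  \<comment> \<open>The event is a level set of the measurable product over the spectrum, which
    takes only the values 0 and 1.\<close>
  have "?S = ?f -` {1} \<inter> space G" by (auto simp: f split: if_splits)
  also have "\<dots> \<in> sets G" using G(1) by (rule measurable_sets) auto
  finally have S: "?S \<in> sets G" .
  have "(\<integral>X. ?f X \<partial>G) = (\<integral>X. complex_of_real (indicator ?S X) \<partial>G)"
    by (intro Bochner_Integration.integral_cong refl, simp only: f) (simp add: indicator_def)
  also have "\<dots> = of_real (measure G ?S)" using S by simp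
  finally show ?thesis using G(2) by simp
qed

end

section \<open>Nuttall integrals as truncated column moments\<close>

lemma besselI_gser: "besselI q z = (z / 2) ^ q * gser q (z\<^sup>2 / 4)"
proof -
  have e: "(z / 2) ^ (2 * k + q) / (fact k * fact (k + q)) = (z / 2) ^ q * ((z\<^sup>2 / 4) ^ k / (fact k * fact (k + q)))" for k
  proof -
    have "(z / 2)\<^sup>2 = z\<^sup>2 / 4" by (simp add: power_divide)
    then have "(z / 2) ^ (2 * k + q) = (z\<^sup>2 / 4) ^ k * (z / 2) ^ q" by (simp only: power_add power_mult)
    then show ?thesis by simp
  qed
  show ?thesis
    unfolding besselI_def gser_def e by (rule suminf_mult[OF gser_summable])
qed

text \<open>The change-of-variables theorem speaks of \<open>lebesgue\<close>, the integrals of the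
  theorem of \<open>lborel\<close>.\<close>

lemma set_integrable_lebesgue_iff:
  fixes f :: "real \<Rightarrow> real"
  assumes "f \<in> borel_measurable borel" "S \<in> sets borel"
  shows "set_integrable lebesgue S f \<longleftrightarrow> set_integrable lborel S f"
  unfolding set_integrable_def using assms by (intro integrable_completion) auto

lemma LBINT_half_square:
  fixes f :: "real \<Rightarrow> real"
  assumes f [measurable]: "f \<in> borel_measurable borel" and i: "set_integrable lborel {b\<^sup>2 / 2..} f" and b: "0 \<le> b"
  shows "(LBINT y:{b..}. y * f (y\<^sup>2 / 2)) = (LBINT u:{b\<^sup>2 / 2..}. f u)"
proof -
  let ?g = "\<lambda>y :: real. y\<^sup>2 / 2"
  have im: "?g ` {b..} = {b\<^sup>2 / 2..}"
  proof (intro equalityI subsetI)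
    fix u assume u: "u \<in> {b\<^sup>2 / 2..}"
    then have "0 \<le> u" by (auto intro: order.trans[of _ "b\<^sup>2 / 2"])
    then show "u \<in> ?g ` {b..}"
      using u b by (intro image_eqI[of _ _ "sqrt (2 * u)"]) (auto intro: real_le_rsqrt)
  qed (use b in \<open>auto intro: power_mono\<close>)
  have m: "(\<lambda>y. \<bar>y\<bar> * f (?g y)) \<in> borel_measurable borel" by measurable
  have "f absolutely_integrable_on ?g ` {b..} \<and> integral (?g ` {b..}) f = integral {b\<^sup>2 / 2..} f"
    unfolding im using i by (simp add: set_integrable_lebesgue_iff)
  moreover have "inj_on ?g {b..}"
    using b by (auto simp: inj_on_def)
  moreover have "(?g has_field_derivative y) (at y within {b..})" for y :: real
    by (auto intro!: derivative_eq_intros)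
  ultimately have "(\<lambda>y. \<bar>y\<bar> * f (?g y)) absolutely_integrable_on {b..} \<and>
      integral {b..} (\<lambda>y. \<bar>y\<bar> * f (?g y)) = integral {b\<^sup>2 / 2..} f"
    using has_absolute_integral_change_of_variables_1'[of "{b..}" ?g "\<lambda>y. y" f "integral {b\<^sup>2 / 2..} f"]
    by simp
  then have s: "set_integrable lborel {b..} (\<lambda>y. \<bar>y\<bar> * f (?g y))"
    and e: "integral {b..} (\<lambda>y. \<bar>y\<bar> * f (?g y)) = integral {b\<^sup>2 / 2..} f"
    using set_integrable_lebesgue_iff[OF m, of "{b..}"] by auto
  have "(LBINT y:{b..}. \<bar>y\<bar> * f (?g y)) = (LBINT u:{b\<^sup>2 / 2..}. f u)"
    unfolding set_borel_integral_eq_integral(2)[OF i] set_borel_integral_eq_integral(2)[OF s] by (rule e)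
  moreover have "(LBINT y:{b..}. \<bar>y\<bar> * f (?g y)) = (LBINT y:{b..}. y * f (?g y))"
    using b by (intro set_lebesgue_integral_cong) auto
  ultimately show ?thesis by simp
qed

context column
begin

lemma set_integrable_power: "set_integrable lborel {0..} (\<lambda>u. u ^ (r + q) * exp (- u) * w u)"
proof -
  obtain C where "\<And>u::real. 0 \<le> u \<Longrightarrow> u ^ r \<le> C * exp (u / 4)"
    using power_le_exp[of "1/4" r] by auto
  then have "integrable (colm q w) (\<lambda>u. u ^ r)"
    by (intro integrable_bound[of _ C]) auto
  then have "integrable lborel (\<lambda>u. (indicator {0..} u * (u ^ q * exp (- u) * w u)) * u ^ r)"
    unfolding colm_def using w_nonneg by (subst (asm) integrable_density) (auto simp: indicator_def)
  also have "(\<lambda>u. (indicator {0..} u * (u ^ q * exp (- u) * w u)) * u ^ r) =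
      (\<lambda>u. indicator {0..} u *\<^sub>R (u ^ (r + q) * exp (- u) * w u))"
    by (auto simp: indicator_def power_add mult_ac)
  finally show ?thesis by (simp add: set_integrable_def)
qed

lemma integral_power_indicator:
  assumes [measurable]: "A \<in> sets borel"
  shows "(\<integral>u. u ^ r * indicator A u \<partial>colm q w) = (LBINT u:{0..} \<inter> A. u ^ (r + q) * exp (- u) * w u)"
proof -
  have "(\<integral>u. u ^ r * indicator A u \<partial>colm q w) =
      (\<integral>u. (indicator {0..} u * (u ^ q * exp (- u) * w u)) * (u ^ r * indicator A u) \<partial>lborel)"
    unfolding colm_def using w_nonneg by (subst integral_density) (auto simp: indicator_def)
  also have "\<dots> = (LBINT u:{0..} \<inter> A. u ^ (r + q) * exp (- u) * w u)"
    unfolding set_lebesgue_integral_def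
    by (intro Bochner_Integration.integral_cong) (auto simp: indicator_def power_add)
  finally show ?thesis .
qed

lemma LBINT_split:
  assumes x: "0 \<le> x"
  shows "(LBINT u:{0..}. u ^ (r + q) * exp (- u) * w u) - (LBINT u:{x..}. u ^ (r + q) * exp (- u) * w u)
    = (LBINT u:{0..x}. u ^ (r + q) * exp (- u) * w u)"
proof -
  let ?f = "\<lambda>u. u ^ (r + q) * exp (- u) * w u"
  have i: "set_integrable lborel S ?f" if "S \<subseteq> {0..}" "S \<in> sets borel" for S
    by (rule set_integrable_subset[OF set_integrable_power]) (use that in auto)
  have "(LBINT u:{0..x} \<union> {x<..}. ?f u) = (LBINT u:{0..x}. ?f u) + (LBINT u:{x<..}. ?f u)"
    using x by (intro set_integral_Un i) auto
  moreover have "{0..x} \<union> {x<..} = {0..}" using x by auto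
  moreover have "(LBINT u:{x<..}. ?f u) = (LBINT u:{x..}. ?f u)"
  proof (rule set_integral_cong_set)
    show "AE u in lborel. (u \<in> {x..}) = (u \<in> {x<..})"
      using AE_lborel_singleton[of x] by eventually_elim auto
  qed (auto simp: set_borel_measurable_def)
  ultimately show ?thesis by simp
qed

end

text \<open>Substitute \<open>u = y\<^sup>2 / 2\<close>. The Bessel argument satisfies
  \<open>(sqrt (2 * l) * y)\<^sup>2 / 4 = l * u\<close>, which is the argument of
  \<open>gser\<close>. Powers of 2 arise from rewriting \<open>y\<close> in terms of
  \<open>u\<close>, and \<open>exp (- l)\<close> from the parameter
  \<open>sqrt (2 * l)\<close>.\<close>

lemma nuttallQ_eq:
  assumes l: "0 < l" and b: "0 \<le> b"
  shows "nuttallQ (2 * r + q + 1) q (sqrt (2 * l)) b =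
    2 ^ (r + q) * sqrt (l / 2) ^ q * exp (- l) * (LBINT u:{b\<^sup>2 / 2..}. u ^ (r + q) * exp (- u) * gser q (l * u))"
proof -
  interpret column q "\<lambda>u. gser q (l * u)" "exp (4 * l)" using l by (intro column_gser) auto
  define c where "c = 2 ^ (r + q) * sqrt (l / 2) ^ q * exp (- l)"
  let ?f = "\<lambda>u. u ^ (r + q) * exp (- u) * gser q (l * u)"
  have i: "set_integrable lborel {b\<^sup>2 / 2..} ?f"
    by (rule set_integrable_subset[OF set_integrable_power]) (auto intro: order.trans[of _ "b\<^sup>2 / 2"])
  have "y ^ (2 * r + q + 1) * exp (- (y\<^sup>2 + (sqrt (2 * l))\<^sup>2) / 2) * besselI q (sqrt (2 * l) * y) =
     c * (y * ?f (y\<^sup>2 / 2))" for y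
  proof -
    have arg: "(sqrt (2 * l) * y)\<^sup>2 / 4 = l * (y\<^sup>2 / 2)" using l by (simp add: power_mult_distrib)
    have half: "sqrt (2 * l) * y / 2 = sqrt (l / 2) * y"
    proof -
      have "sqrt (2 * l) = sqrt (4 * (l / 2))" by simp
      also have "\<dots> = 2 * sqrt (l / 2)" unfolding real_sqrt_mult by simp
      finally show ?thesis by simp
    qed
    have exp: "exp (- (y\<^sup>2 + (sqrt (2 * l))\<^sup>2) / 2) = exp (- l) * exp (- (y\<^sup>2 / 2))"
      using l by (simp add: add_divide_distrib flip: exp_add)
    have pow: "y ^ (2 * r + q + 1) * (sqrt (l / 2) * y) ^ q = 2 ^ (r + q) * sqrt (l / 2) ^ q * (y * (y\<^sup>2 / 2) ^ (r + q))"
    proof -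
      have e: "y ^ (2 * (r + q)) = (y\<^sup>2 / 2) ^ (r + q) * 2 ^ (r + q)"
        unfolding power_mult_distrib[symmetric] by (simp add: power_mult[symmetric])
      have "y ^ (2 * r + q + 1) * (sqrt (l / 2) * y) ^ q = sqrt (l / 2) ^ q * (y * y ^ (2 * (r + q)))"
      proof -
        have y: "y ^ (2 * r + q + 1) * y ^ q = y * y ^ (2 * (r + q))"
          unfolding power_Suc[symmetric] power_add[symmetric] by (rule arg_cong[where f = "power y"]) simp
        show ?thesis unfolding power_mult_distrib y[symmetric] by (simp only: mult_ac)
      qed
      then show ?thesis unfolding e by (simp only: mult_ac)
    qed
    have "y ^ (2 * r + q + 1) * exp (- (y\<^sup>2 + (sqrt (2 * l))\<^sup>2) / 2) * besselI q (sqrt (2 * l) * y) =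
        (y ^ (2 * r + q + 1) * (sqrt (l / 2) * y) ^ q) * (exp (- l) * exp (- (y\<^sup>2 / 2)) * gser q (l * (y\<^sup>2 / 2)))"
      unfolding besselI_gser exp half arg by (simp only: mult_ac)
    also have "\<dots> = c * (y * ?f (y\<^sup>2 / 2))"
      unfolding pow c_def by (simp only: mult_ac)
    finally show ?thesis .
  qed
  then have "nuttallQ (2 * r + q + 1) q (sqrt (2 * l)) b = (LBINT y:{b..}. c * (y * ?f (y\<^sup>2 / 2)))"
    unfolding nuttallQ_def by (simp only:)
  also have "\<dots> = c * (LBINT u:{b\<^sup>2 / 2..}. ?f u)"
    using LBINT_half_square[OF _ i b] by simp
  finally show ?thesis by (simp add: c_def)
qed

section \<open>Matching the determinants of the theorem\<close>

text \<open>The matrices of the theorem list the powers of \<open>u\<close> in decreasing order,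
  \<open>Nmat\<close> in increasing order. The reversal matrix is an involution, so its determinant
  is nonzero; its sign cancels in the final quotient.\<close>

lemma det_reverse_rows:
  "\<exists>c\<noteq>0. \<forall>B :: nat \<Rightarrow> nat \<Rightarrow> complex. det (fmat s (\<lambda>i k. B (s - 1 - i) k)) = c * det (fmat s B)"
proof -
  define J where "J = fmat s (\<lambda>i j. if j = s - 1 - i then 1 else (0 :: complex))"
  have J: "J * fmat s B = fmat s (\<lambda>i k. B (s - 1 - i) k)" for B
    unfolding J_def fmat_mult
  proof (rule cong_mat, goal_cases)
    case (3 i k)
    have "(\<Sum>j<s. (if j = s - 1 - i then 1 else 0) * B j k) = (\<Sum>j<s. if j = s - 1 - i then B (s - 1 - i) k else 0)"
      by (intro sum.cong) auto
    then show ?case using 3 by (simp add: sum.delta)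
  qed auto
  have "J * J = 1\<^sub>m s"
    by (subst (2) J_def, subst J, rule eq_matI) auto
  then have "det J * det J = 1"
    using det_mult[of J s J] by (simp add: J_def)
  then have "det J \<noteq> 0" by auto
  moreover have "det (fmat s (\<lambda>i k. B (s - 1 - i) k)) = det J * det (fmat s B)" for B
    unfolding J[symmetric] by (rule det_mult[of _ s]) (auto simp: J_def)
  ultimately show ?thesis by blast
qed

lemma gram_mat:
  assumes "M \<in> carrier_mat s t"
  shows "M * mat_adjoint M = fmat s (gram t (\<lambda>c. M $$ c))"
proof (rule eq_matI)
  fix i j assume "i < dim_row (fmat s (gram t (\<lambda>c. M $$ c)))" "j < dim_col (fmat s (gram t (\<lambda>c. M $$ c)))"
  then have ij: "i < s" "j < s" by auto
  show "(M * mat_adjoint M) $$ (i, j) = fmat s (gram t (\<lambda>c. M $$ c)) $$ (i, j)"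
    using assms ij
    by (auto simp: mat_adjoint_def gram_def scalar_prod_def atLeast0LessThan mat_of_rows_def intro!: sum.cong)
qed (use assms in \<open>auto simp: mat_adjoint_def\<close>)

text \<open>\<open>Max\<close> is meaningful here because the spectrum is real, finite and, as
  \<open>s > 0\<close>, nonempty.\<close>

lemma largest_eigenvalue_le_iff:
  assumes s: "0 < s"
  shows "largest_eigenvalue (fmat s (gram t X)) \<le> x \<longleftrightarrow> (\<forall>e\<in>set (spec s t X). Re e \<le> x)"
proof -
  have ev: "eigenvalue (fmat s (gram t X)) e \<longleftrightarrow> e \<in> set (spec s t X)" for e
  proof -
    have "eigenvalue (fmat s (gram t X)) e \<longleftrightarrow> (\<Prod>a\<leftarrow>spec s t X. e - a) = 0"
      by (subst eigenvalue_root_char_poly[of _ s]) (simp_all add: poly_char_poly_fmat det_gram_spec)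
    then show ?thesis by (auto simp: prod_list_zero_iff)
  qed
  have "{r. eigenvalue (fmat s (gram t X)) (complex_of_real r)} = Re ` set (spec s t X)"
    unfolding ev using spec_real(1)[of _ s t X] by (force simp: image_iff)
  moreover have "set (spec s t X) \<noteq> {}" using spec(2)[of s t X] s by auto
  ultimately show ?thesis unfolding largest_eigenvalue_def by simp
qed

context wishart
begin

lemma integral_cm_indicator:
  assumes A: "A \<in> sets borel" and k: "k < s"
  shows "(\<integral>u. of_real (u ^ r) * complex_of_real (indicator A u) \<partial>cm k) =
    of_real (LBINT u:{0..} \<inter> A. u ^ (r + q) * exp (- u) * W k u)"
proof -
  obtain K where "column (W k) K" using column_W by blast
  then interpret column q "W k" K .
  show ?thesis
    unfolding integral_power_indicator[OF A, symmetric] by (simp only: of_real_mult[symmetric] integral_complex_of_real)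
qed

text \<open>Applied with \<open>A = {..x}\<close> for the numerator and \<open>A = UNIV\<close> for
  the denominator. The factors \<open>c\<close> and \<open>\<kappa>\<close> are the same in both and
  cancel.\<close>

lemma det_column_integrals:
  assumes B: "B \<in> carrier_mat s s" and A: "A \<in> sets borel"
    and E: "\<And>i k. i < s \<Longrightarrow> k < s \<Longrightarrow> B $$ (i, k) = (LBINT u:{0..} \<inter> A. u ^ (s - 1 - i + q) * exp (- u) * W k u) * \<kappa> k"
    and c: "\<And>B :: nat \<Rightarrow> nat \<Rightarrow> complex. det (fmat s (\<lambda>i k. B (s - 1 - i) k)) = c * det (fmat s B)"
  shows "complex_of_real (det B) = (c * (\<Prod>k<s. of_real (\<kappa> k))) * Nmat (\<lambda>u. of_real (indicator A u))"
proof -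
  have "complex_of_real (det B) = det (map_mat complex_of_real B)"
    by (rule of_real_hom.hom_det[symmetric])
  also have "map_mat complex_of_real B = fmat s (\<lambda>i k. (\<integral>u. of_real (u ^ (s - 1 - i)) * complex_of_real (indicator A u) \<partial>cm k) * of_real (\<kappa> k))"
    using B by (intro eq_matI) (auto simp: E integral_cm_indicator[OF A] simp del: of_real_power)
  finally show ?thesis
    unfolding det_scale_columns c[of "\<lambda>i k. \<integral>u. of_real (u ^ i) * complex_of_real (indicator A u) \<partial>cm k"]
    by (simp add: Nmat_def mult_ac)
qed

text \<open>What the Nuttall prefactor leaves once the powers of 2 are gone; it depends on the
  column alone.\<close>

definition kappa :: "nat \<Rightarrow> real" where
  "kappa k = (if k < L then sqrt (l k) ^ q * exp (- l k) else 1)"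

text \<open>In terms of \<open>r = s - 1 - i\<close> the power of 2 in the theorem has exponent
  \<open>- (r + q) + q / 2\<close>, exactly what cancels the powers of 2 in
  \<open>nuttallQ_eq\<close>. The row number of the theorem is \<open>i + 1\<close>.\<close>

lemma nuttall_entry:
  assumes k: "k < L" and i: "i < s" and b: "0 \<le> b"
  shows "2 powr ((2 * real (i + 1) - real s - real (s + q)) / 2) *
      nuttallQ (s + (s + q) - 2 * (i + 1) + 1) q (sqrt (2 * l k)) b =
    (LBINT u:{b\<^sup>2 / 2..}. u ^ (s - 1 - i + q) * exp (- u) * W k u) * kappa k"
proof -
  define r where "r = s - 1 - i"
  have r: "s + (s + q) - 2 * (i + 1) + 1 = 2 * r + q + 1" using i by (auto simp: r_def)
  have e: "(2 * real (i + 1) - real s - real (s + q)) / 2 = - (real (r + q)) + real q / 2"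
    using i by (simp add: r_def of_nat_diff field_simps)
  have "2 powr (- (real (r + q)) + real q / 2) * (2 ^ (r + q) * sqrt (l k / 2) ^ q) = sqrt (l k) ^ q"
  proof -
    have p: "(2::real) powr (- real (r + q)) * 2 ^ (r + q) = 1"
      by (simp add: powr_minus powr_realpow del: of_nat_add)
    have h: "(2::real) powr (real q / 2) = sqrt 2 ^ q"
      by (simp add: powr_half_sqrt[symmetric] powr_power mult.commute)
    have "2 powr (- (real (r + q)) + real q / 2) * (2 ^ (r + q) * sqrt (l k / 2) ^ q) =
        (2 powr (- real (r + q)) * 2 ^ (r + q)) * (2 powr (real q / 2) * sqrt (l k / 2) ^ q)"
      by (simp only: powr_add mult_ac)
    also have "\<dots> = sqrt (l k) ^ q"
      unfolding p h power_mult_distrib[symmetric] real_sqrt_mult[symmetric] by simp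
    finally show ?thesis .
  qed
  then show ?thesis
    unfolding r e nuttallQ_eq[OF l_pos[OF k] b] r_def[symmetric] using k
    by (simp add: W_def[abs_def] kappa_def mult_ac)
qed

end

theorem theorem2:
  fixes s t L :: nat and M :: "complex mat" and lam :: "nat \<Rightarrow> real" and x :: real
  assumes "1 \<le> s" and "s \<le> t"
    and "M \<in> carrier_mat s t"
    and "L \<le> s"
    and "\<forall>k\<in>{1..<L}. lam k > lam (k + 1)"
    and "\<forall>k\<in>{1..L}. lam k > 0"
    and "char_poly (M * mat_adjoint M) =
           monom 1 (s - L) * (\<Prod>k\<in>{1..L}. [:- complex_of_real (lam k), 1:])"
    and "0 < x"
  shows "measure (gauss_matrix_measure s t M)
           {X \<in> space (gauss_matrix_measure s t M).
              largest_eigenvalue (to_mat s t X * mat_adjoint (to_mat s t X)) \<le> x}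
         = det (Xi_mat s t L lam x) / det (Psi0_mat s t L lam)"
proof -
  define q where "q = t - s"
  have t: "t = s + q" using assms(2) by (simp add: q_def)
  \<comment> \<open>Shift from the 1-based eigenvalues of the theorem to the 0-based ones of the
    locale, padded by zeros.\<close>
  define l where "l k = (if k < L then lam (k + 1) else 0)" for k
  define m where "m c = M $$ c" for c
  \<comment> \<open>Only consecutive eigenvalues are compared in the assumption; injectivity of
    \<open>l\<close> requires all pairs.\<close>
  have dec: "1 \<le> i \<Longrightarrow> i < j \<Longrightarrow> j \<le> L \<Longrightarrow> lam j < lam i" for i j
  proof (induction j)
    case (Suc j)
    then have "lam (Suc j) < lam j" using assms(5) by auto
    then show ?case using Suc by (cases "i = j") auto
  qed simp
  interpret wishart s q L m l
  proof
    show "0 < s" "L \<le> s" using assms by auto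
    show "0 < l k" if "k < L" for k using that assms(6) by (simp add: l_def)
    show "l k = 0" if "L \<le> k" "k < s" for k using that by (simp add: l_def)
    show "inj_on l {..<L}"
    proof (rule linorder_inj_onI)
      fix i j assume "i < j" "i \<in> {..<L}" "j \<in> {..<L}"
      then show "l i \<noteq> l j" using dec[of "i + 1" "j + 1"] by (simp add: l_def)
    qed auto
    fix w
    have "det (fmat s (\<lambda>i j. (if i = j then 1 else 0) * w - gram (s + q) m i j)) = poly (char_poly (M * mat_adjoint M)) w"
      unfolding gram_mat[OF assms(3)] poly_char_poly_fmat m_def t ..
    also have "\<dots> = (\<Prod>k\<in>{1..L}. w - of_real (lam k)) * w ^ (s - L)"
      unfolding assms(7) by (simp add: poly_monom poly_prod)
    also have "(\<Prod>k\<in>{1..L}. w - of_real (lam k)) = (\<Prod>k\<in>{..<L}. w - of_real (l k))"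
      by (rule prod.reindex_bij_witness[of _ "\<lambda>k. k + 1" "\<lambda>k. k - 1"]) (auto simp: l_def)
    also have "w ^ (s - L) = (\<Prod>k\<in>{L..<s}. w - of_real (l k))"
      by (simp add: l_def)
    also have "(\<Prod>k\<in>{..<L}. w - of_real (l k)) * (\<Prod>k\<in>{L..<s}. w - of_real (l k)) = (\<Prod>k<s. w - of_real (l k))"
      using assms(4) by (subst prod.union_disjoint[symmetric]) (auto simp: ivl_disj_un)
    finally show "det (fmat s (\<lambda>i j. (if i = j then 1 else 0) * w - gram (s + q) m i j)) = (\<Prod>k<s. w - of_real (l k))" .
  qed
  have Gm: "gauss_matrix_measure s t M = G"
    unfolding gauss_matrix_measure_def t by (intro arg_cong[where f = "PiM _"]) (auto simp: m_def fun_eq_iff)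
  have "to_mat s t X * mat_adjoint (to_mat s t X) = fmat s (gram (s + q) X)" for X
  proof -
    have "to_mat s t X * mat_adjoint (to_mat s t X) = fmat s (gram t (\<lambda>c. to_mat s t X $$ c))"
      by (rule gram_mat) (simp add: to_mat_def)
    also have "\<dots> = fmat s (gram (s + q) X)"
      by (rule cong_mat) (auto simp: gram_def to_mat_def t)
    finally show ?thesis .
  qed
  then have ev: "{X \<in> space G. largest_eigenvalue (to_mat s t X * mat_adjoint (to_mat s t X)) \<le> x} =
    {X \<in> space G. \<forall>e\<in>set (spec s (s + q) X). Re e \<le> x}"
    by (simp add: largest_eigenvalue_le_iff[OF s_pos])
  obtain c where c: "c \<noteq> 0" "\<And>B :: nat \<Rightarrow> nat \<Rightarrow> complex. det (fmat s (\<lambda>i k. B (s - 1 - i) k)) = c * det (fmat s B)"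
    using det_reverse_rows[of s] by blast
  define C where "C = c * (\<Prod>k<s. complex_of_real (kappa k))"
  have "C \<noteq> 0"
    using c(1) l_pos by (auto simp: C_def kappa_def less_imp_neq[symmetric])
  have lk: "lam (Suc k) = l k" if "k < L" for k using that by (simp add: l_def)
  have Xi: "complex_of_real (det (Xi_mat s t L lam x)) = C * Nmat (\<lambda>u. of_real (indicator {..x} u))"
    unfolding C_def
  proof (rule det_column_integrals[OF _ _ _ c(2)])
    fix i k assume ik: "i < s" "k < s"
    obtain K where "column (W k) K" using column_W by blast
    then interpret column q "W k" K .
    have I: "{0..} \<inter> {..x} = {0..x}" by auto
    show "Xi_mat s t L lam x $$ (i, k) = (LBINT u:{0..} \<inter> {..x}. u ^ (s - 1 - i + q) * exp (- u) * W k u) * kappa k"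
    proof (cases "k < L")
      case True
      have "Xi_mat s t L lam x $$ (i, k) = 2 powr ((2 * real (i + 1) - real s - real (s + q)) / 2) *
          nuttallQ (s + (s + q) - 2 * (i + 1) + 1) q (sqrt (2 * l k)) 0 -
        2 powr ((2 * real (i + 1) - real s - real (s + q)) / 2) *
          nuttallQ (s + (s + q) - 2 * (i + 1) + 1) q (sqrt (2 * l k)) (sqrt (2 * x))"
        using ik True by (simp add: Xi_mat_def Let_def lk t right_diff_distrib)
      also have "\<dots> = ((LBINT u:{0..}. u ^ (s - 1 - i + q) * exp (- u) * W k u) -
          (LBINT u:{x..}. u ^ (s - 1 - i + q) * exp (- u) * W k u)) * kappa k"
        using assms(8) by (subst (1 2) nuttall_entry[OF True ik(1)]) (auto simp: left_diff_distrib)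
      finally show ?thesis using LBINT_split[of x "s - 1 - i"] assms(8) by (simp add: I)
    next
      case False
      \<comment> \<open>The exponent splits into \<open>s - 1 - i + q\<close> from the row and the
        density, and \<open>s - 1 - k\<close> from the confluent weight \<open>W k\<close>.\<close>
      have "t + s - (i + 1) - (k + 1) = s - 1 - i + q + (s - 1 - k)" using ik by (simp add: t)
      then have "Xi_mat s t L lam x $$ (i, k) = lower_gamma (s - 1 - i + q + (s - 1 - k) + 1) x"
        using ik False by (simp add: Xi_mat_def Let_def)
      also have "\<dots> = (LBINT u:{0..x}. u ^ (s - 1 - i + q) * exp (- u) * u ^ (s - 1 - k))"
        unfolding lower_gamma_def add_diff_cancel_right' power_add by (simp only: mult_ac)
      finally show ?thesis
        unfolding I using False by (simp add: W_def[abs_def] kappa_def)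
    qed
  qed (auto simp: Xi_mat_def)
  \<comment> \<open>The indicator of \<open>UNIV\<close> is the test function 1, so the denominator
    is the normalisation \<open>Nmat (\<lambda>_. 1)\<close>, already known to be nonzero.\<close>
  have Psi: "complex_of_real (det (Psi0_mat s t L lam)) = C * Nmat (\<lambda>u. of_real (indicator UNIV u))"
    unfolding C_def
  proof (rule det_column_integrals[OF _ _ _ c(2)])
    fix i k assume ik: "i < s" "k < s"
    obtain K where "column (W k) K" using column_W by blast
    then interpret column q "W k" K .
    show "Psi0_mat s t L lam $$ (i, k) = (LBINT u:{0..} \<inter> UNIV. u ^ (s - 1 - i + q) * exp (- u) * W k u) * kappa k"
    proof (cases "k < L")
      case True
      have "Psi0_mat s t L lam $$ (i, k) = 2 powr ((2 * real (i + 1) - real s - real (s + q)) / 2) *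
          nuttallQ (s + (s + q) - 2 * (i + 1) + 1) q (sqrt (2 * l k)) 0"
        using ik True by (simp add: Psi0_mat_def Let_def lk t)
      then show ?thesis by (subst (asm) nuttall_entry[OF True ik(1)]) auto
    next
      case False
      have "t + s - (i + 1) - (k + 1) = s - 1 - i + q + (s - 1 - k)" using ik by (simp add: t)
      then have "Psi0_mat s t L lam $$ (i, k) = fact (s - 1 - i + q + (s - 1 - k))"
        using ik False by (simp add: Psi0_mat_def Let_def)
      also have "\<dots> = (\<integral>u. u ^ (s - 1 - i) * indicator UNIV u \<partial>cm k)"
        using integral_colm_power[of q "s - 1 - k" "s - 1 - i"] False by (simp add: W_def[abs_def] ac_simps)
      finally show ?thesis
        using False by (subst (asm) integral_power_indicator) (auto simp: kappa_def)
    qed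
  qed (auto simp: Psi0_mat_def)
  define P where "P = measure G {X \<in> space G. \<forall>e\<in>set (spec s (s + q) X). Re e \<le> x}"
  have "complex_of_real (P * det (Psi0_mat s t L lam)) = complex_of_real (det (Xi_mat s t L lam x))"
    unfolding of_real_mult Xi Psi using prob_spec_le[of x] by (simp add: P_def mult_ac)
  then have "P * det (Psi0_mat s t L lam) = det (Xi_mat s t L lam x)"
    by (simp only: of_real_eq_iff)
  moreover have "complex_of_real (det (Psi0_mat s t L lam)) \<noteq> 0"
    unfolding Psi using \<open>C \<noteq> 0\<close> Nmat_one_nonzero by simp
  ultimately have "P = det (Xi_mat s t L lam x) / det (Psi0_mat s t L lam)"
    by (auto simp: field_simps)
  then show ?thesis unfolding Gm ev P_def .
qed

end
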